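(* Let $1<p\le\infty$, $1\le q\le\infty$, $\frac12<\alpha<\frac14\left(5-\frac3p\right)$, $\nu>0$ and $\Omega\in\mathbb R$. Put $I=[0,\infty)$ and $\mathcal X=\mathcal L^\infty(I;\dot{FB}^{4-2\alpha-\frac3p}_{p,q})$, and let $K>0$ be a constant such that $\|B_\Omega(u,v)\|_{\mathcal X}\le K\|u\|_{\mathcal X}\|v\|_{\mathcal X}$ for all $u,v\in\mathcal X$. Then there are constants $C>0$ and $0<\varepsilon<\frac1{4K}$ such that the following holds. Let $F=F(x)\in\dot{FB}^{4-4\alpha-\frac3p}_{p,q}$ with $\|F\|_{\dot{FB}^{4-4\alpha-\frac3p}_{p,q}}<\frac{\varepsilon\nu}C$, and let $u_\infty$ be the stationary mild solution with external force $F$ that is unique in the ball $\{u\in\dot{FB}^{4-2\alpha-\frac3p}_{p,q}:\|u\|_{\dot{FB}^{4-2\alpha-\frac3p}_{p,q}}\le2\varepsilon\}$. Let $v_0\in\dot{FB}^{4-2\alpha-\frac3p}_{p,q}$ and $G\in\mathcal L^\infty(I;\dot{FB}^{4-4\alpha-\frac3p}_{p,q})$ satisfy $$\|v_0\|_{\dot{FB}^{4-2\alpha-\frac3p}_{p,q}}+\|G\|_{\mathcal L^\infty(I;\dot{FB}^{4-4\alpha-\frac3p}_{p,q})}\le\varepsilon,$$ and let $v\in\mathcal X$, $\|v\|_{\mathcal X}\le2\varepsilon$, be the global mild solution of the fractional Navier-Stokes-Coriolis system with initial velocity $v_0$ and external force $G$. If $$\lim_{t\to\infty}\|S^\alpha_\Omega(t)(v_0-u_\infty)\|_{\dot{FB}^{4-2\alpha-\frac3p}_{p,q}}=0\quad\text{and}\quad\lim_{t\to\infty}\|G(t)-F\|_{\dot{FB}^{4-4\alpha-\frac3p}_{p,q}}=0,$$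 then $$\lim_{t\to\infty}\|v(t)-u_\infty\|_{\dot{FB}^{4-2\alpha-\frac3p}_{p,q}}=0.$$
   Context: Fourier-Besov spaces on $\mathbb R^3$: fix a radially symmetric $\varphi\in\mathcal S(\mathbb R^3)$ supported in $\{\xi:\frac34\le|\xi|\le\frac83\}$ with $\sum_{j\in\mathbb Z}\varphi(2^{-j}\xi)=1$ for all $\xi\ne0$, and put $\varphi_j(\xi)=\varphi(2^{-j}\xi)$. For $s\in\mathbb R$, $1\le p,q\le\infty$, $\dot{FB}^s_{p,q}$ is the set of $f\in\mathcal S'$ with $\hat f\in L^1_{loc}$ and $\|f\|_{\dot{FB}^s_{p,q}}=\big\|\big(2^{js}\|\varphi_j\hat f\|_{L^p}\big)_{j\in\mathbb Z}\big\|_{\ell^q}<\infty$ (vector-valued versions are understood). With $I=[0,\infty)$, $\mathcal L^\infty(I;\dot{FB}^s_{p,q})$ is the space of Bochner measurable $f:I\to\dot{FB}^s_{p,q}$ with $\|f\|=\big\|\big(2^{js}\|\varphi_j\hat f\|_{L^\infty(I;L^p)}\big)_{j\in\mathbb Z}\big\|_{\ell^q}<\infty$. The fractional Navier-Stokes-Coriolis system is $\partial_tu+\nu(-\Delta)^\alpha u+u\cdot\nabla u+\Omega e_3\times u+\nabla p=F$, $\mathrm{div}\,u=0$ in $\mathbb R^3\times(0,\infty)$, $u(\cdot,0)=u_0$, with $\nu>0$, $\Omega\in\mathbb R$, $e_3=(0,0,1)$. Semigroup: $(S^\alpha_\Omega(t)f)^\wedge(\xi)=e^{-\nu|\xi|^{2\alpha}t}\big[\cos(\Omega\tfrac{\xi_3}{|\xi|}t)\,I_3+\sin(\Omega\tfrac{\xi_3}{|\xi|}t)\,R(\xi)\big]\hat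 f(\xi)$, where $I_3$ is the identity matrix and $R(\xi)=\frac1{|\xi|}\begin{pmatrix}0&\xi_3&-\xi_2\\-\xi_3&0&\xi_1\\\xi_2&-\xi_1&0\end{pmatrix}$. $\mathbb P$ is the Leray projector, with symbol $\hat{\mathbb P}(\xi)_{mk}=\delta_{mk}-\xi_m\xi_k/|\xi|^2$. Bilinear operator: $B_\Omega(v,w)(t)=-\int_0^tS^\alpha_\Omega(t-\tau)\mathbb P\nabla\cdot(v\otimes w)(\tau)\,d\tau$, understood in Fourier variables, i.e. $[B_\Omega(v,w)]^\wedge(\xi,t)=-\int_0^t[S^\alpha_\Omega(t-\tau)]^\wedge(\xi)\hat{\mathbb P}(\xi)\,[i\xi\cdot(v\otimes w)^\wedge(\xi,\tau)]\,d\tau$ with $((v\otimes w)^\wedge)_{mk}=\hat v_m*\hat w_k$. A mild solution with data $(u_0,F)$ is a solution $u$ of $u(t)=S^\alpha_\Omega(t)u_0+B_\Omega(u,u)(t)+\int_0^tS^\alpha_\Omega(t-\tau)\mathbb PF(\tau)\,d\tau$. A stationary mild solution with external force $F=F(x)$ is a time-independent $u\in\dot{FB}^{4-2\alpha-\frac3p}_{p,q}$ such that $u=S^\alpha_\Omega(t)u-\int_0^tS^\alpha_\Omega(t-\tau)\mathbb P\nabla\cdot(u\otimes u)\,d\tau+\int_0^tS^\alpha_\Omega(\tau)\mathbb PF\,d\tau$ for every $t>0$; equivalently, $u=-\int_0^\infty S^\alpha_\Omega(\tau)\mathbb P\nabla\cdot(u\otimes u)\,d\tau+\int_0^\infty S^\alpha_\Omega(\tau)\mathbb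 PF\,d\tau$ (integrals in Fourier variables, for a.e. $\xi$). *)

theory Defs
  imports "HOL-Analysis.Analysis" "HOL-Probability.Essential_Supremum"
begin

section \<open>Tempered distributions and the Fourier transform\<close>

definition partial_deriv :: "3 \<Rightarrow> (real^3 \<Rightarrow> complex) \<Rightarrow> real^3 \<Rightarrow> complex" where
  "partial_deriv i f x = vector_derivative (\<lambda>h. f (x + h *\<^sub>R axis i 1)) (at 0)"

abbreviation iter_partial :: "3 list \<Rightarrow> (real^3 \<Rightarrow> complex) \<Rightarrow> real^3 \<Rightarrow> complex" where
  "iter_partial is f \<equiv> foldr partial_deriv is f"

definition smooth :: "(real^3 \<Rightarrow> complex) \<Rightarrow> bool" where
  "smooth f \<longleftrightarrow> (\<forall>is x. iter_partial is f differentiable (at x))"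

definition schwartz :: "(real^3 \<Rightarrow> complex) set" where
  "schwartz = {f. smooth f \<and>
     (\<forall>N is. \<exists>C. \<forall>x. (1 + norm x) ^ N * norm (iter_partial is f x) \<le> C)}"

definition test_functions :: "(real^3 \<Rightarrow> complex) set" where
  "test_functions = {f. smooth f \<and> (\<exists>r. \<forall>x. norm x > r \<longrightarrow> f x = 0)}"

definition schwartz_converges ::
    "(nat \<Rightarrow> real^3 \<Rightarrow> complex) \<Rightarrow> (real^3 \<Rightarrow> complex) \<Rightarrow> bool" where
  "schwartz_converges f g \<longleftrightarrow> (\<forall>N is.
     uniform_limit UNIV (\<lambda>n x. (1 + norm x) ^ N *\<^sub>R iter_partial is (f n) x)
       (\<lambda>x. (1 + norm x) ^ N *\<^sub>R iter_partial is g x) sequentially)"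

text \<open>
  A \<open>\<complex>\<^sup>3\<close>-valued distribution is a functional on scalar test functions with values in
  \<open>\<complex>\<^sup>3\<close>, so that its three components are scalar distributions.
\<close>

type_synonym distr = "(real^3 \<Rightarrow> complex) \<Rightarrow> complex^3"

text \<open>
  The Schwartz space is metrizable, so continuity is sequential continuity. Functionals
  vanish off the Schwartz space, which makes equality of distributions equality in HOL.
\<close>

definition tempered :: "distr set" where
  "tempered = {T.
     (\<forall>f\<in>schwartz. \<forall>g\<in>schwartz. \<forall>a b. T (\<lambda>x. a * f x + b * g x) = a *s T f + b *s T g) \<and>
     (\<forall>f g. (\<forall>n. f n \<in> schwartz) \<and> g \<in> schwartz \<and> schwartz_converges f g
        \<longrightarrow> (\<lambda>n. T (f n)) \<longlonglongrightarrow> T g) \<and>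
     (\<forall>f. f \<notin> schwartz \<longrightarrow> T f = 0)}"

text \<open>
  The factor \<open>(2\<pi>)\<^sup>-\<^sup>3\<close> is the normalisation for which products are sent to convolutions and
  \<open>\<partial>\<^sub>m\<close> to multiplication by \<open>\<i> \<xi>\<^sub>m\<close>, both without constants.
\<close>

definition fourier :: "(real^3 \<Rightarrow> complex) \<Rightarrow> real^3 \<Rightarrow> complex" where
  "fourier f \<xi> = complex_of_real (1 / (2 * pi) ^ 3) *
     (LINT x|lborel. exp (- \<i> * complex_of_real (x \<bullet> \<xi>)) * f x)"

text \<open>
  \<open>fourier_rep f g\<close>: the Fourier transform of \<open>f\<close>, which is the distribution
  \<open>\<psi> \<mapsto> f (fourier \<psi>)\<close>, is the locally integrable function \<open>g\<close>. The test functions are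
  compactly supported because \<open>g * \<psi>\<close> need not be integrable for a Schwartz function \<open>\<psi>\<close>.
\<close>

definition fourier_rep :: "distr \<Rightarrow> (real^3 \<Rightarrow> complex^3) \<Rightarrow> bool" where
  "fourier_rep f g \<longleftrightarrow>
     g \<in> borel_measurable borel \<and>
     (\<forall>K. compact K \<longrightarrow> set_integrable lborel K g) \<and>
     (\<forall>\<psi>\<in>test_functions. f (fourier \<psi>) = (LINT \<xi>|lborel. \<psi> \<xi> *s g \<xi>))"

text \<open>The function \<open>g\<close> is determined up to a null set.\<close>

definition ft :: "distr \<Rightarrow> real^3 \<Rightarrow> complex^3" where
  "ft f = (SOME g. fourier_rep f g)"

text \<open>
  For a time-dependent distribution, the representatives of the Fourier transforms at the
  individual times are chosen jointly measurable. Such a choice is unique up to a null set of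
  pairs \<open>(t, \<xi>)\<close>, so time integrals at fixed \<open>\<xi>\<close> are well defined for almost every \<open>\<xi>\<close>.
\<close>

definition ft_time :: "(real \<Rightarrow> distr) \<Rightarrow> real \<Rightarrow> real^3 \<Rightarrow> complex^3" where
  "ft_time f = (SOME g. (\<lambda>(t, \<xi>). g t \<xi>) \<in> borel_measurable borel \<and>
     (AE t in lebesgue_on {0..}. fourier_rep (f t) (g t)))"


section \<open>Fourier-Besov spaces\<close>

definition ennreal_powr :: "ennreal \<Rightarrow> real \<Rightarrow> ennreal" where
  "ennreal_powr x r = (if x = \<infinity> then \<infinity> else ennreal (enn2real x powr r))"

text \<open>
  Applied to the pointwise norm of a function; over \<open>count_space UNIV\<close> this is the \<open>\<ell>\<^sup>p\<close> norm.
\<close>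

definition Lp_norm :: "ennreal \<Rightarrow> 'a measure \<Rightarrow> ('a \<Rightarrow> ennreal) \<Rightarrow> ennreal" where
  "Lp_norm p M f =
     (if p = \<infinity> then esssup M f
      else ennreal_powr (\<integral>\<^sup>+x. ennreal_powr (f x) (enn2real p) \<partial>M) (1 / enn2real p))"

definition dyadic_partition :: "(real^3 \<Rightarrow> complex) \<Rightarrow> bool" where
  "dyadic_partition \<phi> \<longleftrightarrow>
     \<phi> \<in> schwartz \<and>
     (\<forall>\<xi> \<eta>. norm \<xi> = norm \<eta> \<longrightarrow> \<phi> \<xi> = \<phi> \<eta>) \<and>
     (\<forall>\<xi>. \<phi> \<xi> \<noteq> 0 \<longrightarrow> 3/4 \<le> norm \<xi> \<and> norm \<xi> \<le> 8/3) \<and>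
     (\<forall>\<xi>. \<xi> \<noteq> 0 \<longrightarrow> ((\<lambda>j::int. \<phi> ((2 powi (- j)) *\<^sub>R \<xi>)) has_sum 1) UNIV)"

definition dyadic_norm ::
    "(real^3 \<Rightarrow> complex) \<Rightarrow> ennreal \<Rightarrow> int \<Rightarrow> (real^3 \<Rightarrow> complex^3) \<Rightarrow> ennreal" where
  "dyadic_norm \<phi> p j g =
     Lp_norm p lborel (\<lambda>\<xi>. ennreal (norm (\<phi> ((2 powi (- j)) *\<^sub>R \<xi>) *s g \<xi>)))"

text \<open>The norms with suffix \<open>_ft\<close> take the Fourier transform of the element.\<close>

definition FB_norm_ft ::
    "(real^3 \<Rightarrow> complex) \<Rightarrow> real \<Rightarrow> ennreal \<Rightarrow> ennreal \<Rightarrow> (real^3 \<Rightarrow> complex^3) \<Rightarrow> ennreal" where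
  "FB_norm_ft \<phi> s p q g =
     Lp_norm q (count_space UNIV)
       (\<lambda>j::int. ennreal (2 powr (of_int j * s)) * dyadic_norm \<phi> p j g)"

definition FB_norm ::
    "(real^3 \<Rightarrow> complex) \<Rightarrow> real \<Rightarrow> ennreal \<Rightarrow> ennreal \<Rightarrow> distr \<Rightarrow> ennreal" where
  "FB_norm \<phi> s p q f = FB_norm_ft \<phi> s p q (ft f)"

definition FB :: "(real^3 \<Rightarrow> complex) \<Rightarrow> real \<Rightarrow> ennreal \<Rightarrow> ennreal \<Rightarrow> distr set" where
  "FB \<phi> s p q = {f \<in> tempered. (\<exists>g. fourier_rep f g) \<and> FB_norm \<phi> s p q f < \<infinity>}"

definition LFB_norm_ft ::
    "(real^3 \<Rightarrow> complex) \<Rightarrow> real \<Rightarrow> ennreal \<Rightarrow> ennreal \<Rightarrow>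
     (real \<Rightarrow> real^3 \<Rightarrow> complex^3) \<Rightarrow> ennreal" where
  "LFB_norm_ft \<phi> s p q g =
     Lp_norm q (count_space UNIV)
       (\<lambda>j::int. ennreal (2 powr (of_int j * s)) *
          esssup (lebesgue_on {0..}) (\<lambda>t. dyadic_norm \<phi> p j (g t)))"

definition LFB_norm ::
    "(real^3 \<Rightarrow> complex) \<Rightarrow> real \<Rightarrow> ennreal \<Rightarrow> ennreal \<Rightarrow> (real \<Rightarrow> distr) \<Rightarrow> ennreal" where
  "LFB_norm \<phi> s p q f = LFB_norm_ft \<phi> s p q (\<lambda>t. ft (f t))"

definition bochner_measurable ::
    "(real^3 \<Rightarrow> complex) \<Rightarrow> real \<Rightarrow> ennreal \<Rightarrow> ennreal \<Rightarrow> (real \<Rightarrow> distr) \<Rightarrow> bool" where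
  "bochner_measurable \<phi> s p q f \<longleftrightarrow>
     (\<exists>h. (\<forall>n::nat. simple_function (lebesgue_on {0..}) (h n) \<and> (\<forall>t\<ge>0. h n t \<in> FB \<phi> s p q)) \<and>
        (AE t in lebesgue_on {0..}.
           (\<lambda>n. FB_norm \<phi> s p q (\<lambda>\<psi>. h n t \<psi> - f t \<psi>)) \<longlonglongrightarrow> 0))"

definition LFB ::
    "(real^3 \<Rightarrow> complex) \<Rightarrow> real \<Rightarrow> ennreal \<Rightarrow> ennreal \<Rightarrow> (real \<Rightarrow> distr) set" where
  "LFB \<phi> s p q = {f. (\<forall>t\<ge>0. f t \<in> FB \<phi> s p q) \<and> bochner_measurable \<phi> s p q f \<and>
     LFB_norm \<phi> s p q f < \<infinity>}"


section \<open>The fractional Navier-Stokes-Coriolis system in Fourier variables\<close>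

definition coriolis_matrix :: "real^3 \<Rightarrow> real^3^3" where
  "coriolis_matrix \<xi> = (1 / norm \<xi>) *\<^sub>R vector
     [vector [0, \<xi>$3, - (\<xi>$2)],
      vector [- (\<xi>$3), 0, \<xi>$1],
      vector [\<xi>$2, - (\<xi>$1), 0]]"

definition semigroup_symbol :: "real \<Rightarrow> real \<Rightarrow> real \<Rightarrow> real \<Rightarrow> real^3 \<Rightarrow> complex^3^3" where
  "semigroup_symbol \<nu> \<Omega> \<alpha> t \<xi> = map_matrix complex_of_real
     (exp (- \<nu> * norm \<xi> powr (2 * \<alpha>) * t) *\<^sub>R
        (cos (\<Omega> * (\<xi>$3 / norm \<xi>) * t) *\<^sub>R mat 1 +
         sin (\<Omega> * (\<xi>$3 / norm \<xi>) * t) *\<^sub>R coriolis_matrix \<xi>))"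

definition leray_symbol :: "real^3 \<Rightarrow> complex^3^3" where
  "leray_symbol \<xi> = map_matrix complex_of_real
     (\<chi> m k. (if m = k then 1 else 0) - \<xi>$m * \<xi>$k / (norm \<xi>)\<^sup>2)"

definition semigroup_ft ::
    "real \<Rightarrow> real \<Rightarrow> real \<Rightarrow> real \<Rightarrow> (real^3 \<Rightarrow> complex^3) \<Rightarrow> real^3 \<Rightarrow> complex^3" where
  "semigroup_ft \<nu> \<Omega> \<alpha> t g \<xi> = semigroup_symbol \<nu> \<Omega> \<alpha> t \<xi> *v g \<xi>"

definition tensor_ft ::
    "(real^3 \<Rightarrow> complex^3) \<Rightarrow> (real^3 \<Rightarrow> complex^3) \<Rightarrow> real^3 \<Rightarrow> complex^3^3" where
  "tensor_ft g h \<xi> = (\<chi> m k. LINT \<eta>|lborel. g (\<xi> - \<eta>) $ m * h \<eta> $ k)"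

definition div_tensor_ft ::
    "(real^3 \<Rightarrow> complex^3) \<Rightarrow> (real^3 \<Rightarrow> complex^3) \<Rightarrow> real^3 \<Rightarrow> complex^3" where
  "div_tensor_ft g h \<xi> = (\<chi> m. \<i> * complex_of_real (\<xi>$m)) v* tensor_ft g h \<xi>"

definition bilinear_ft ::
    "real \<Rightarrow> real \<Rightarrow> real \<Rightarrow> (real \<Rightarrow> real^3 \<Rightarrow> complex^3) \<Rightarrow> (real \<Rightarrow> real^3 \<Rightarrow> complex^3) \<Rightarrow>
     real \<Rightarrow> real^3 \<Rightarrow> complex^3" where
  "bilinear_ft \<nu> \<Omega> \<alpha> g h t \<xi> =
     - (LINT \<tau>:{0..t}|lborel.
          semigroup_symbol \<nu> \<Omega> \<alpha> (t - \<tau>) \<xi> *v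
            (leray_symbol \<xi> *v div_tensor_ft (g \<tau>) (h \<tau>) \<xi>))"

text \<open>The equations hold in Fourier variables, for almost every frequency.\<close>

definition mild_solution ::
    "real \<Rightarrow> real \<Rightarrow> real \<Rightarrow> distr \<Rightarrow> (real \<Rightarrow> distr) \<Rightarrow> (real \<Rightarrow> distr) \<Rightarrow> bool" where
  "mild_solution \<nu> \<Omega> \<alpha> u0 F u \<longleftrightarrow> (\<forall>t\<ge>0. AE \<xi> in lborel.
     ft (u t) \<xi> = semigroup_ft \<nu> \<Omega> \<alpha> t (ft u0) \<xi>
       + bilinear_ft \<nu> \<Omega> \<alpha> (ft_time u) (ft_time u) t \<xi>
       + (LINT \<tau>:{0..t}|lborel.
            semigroup_symbol \<nu> \<Omega> \<alpha> (t - \<tau>) \<xi> *v (leray_symbol \<xi> *v ft_time F \<tau> \<xi>)))"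

definition stationary_mild_solution ::
    "real \<Rightarrow> real \<Rightarrow> real \<Rightarrow> distr \<Rightarrow> distr \<Rightarrow> bool" where
  "stationary_mild_solution \<nu> \<Omega> \<alpha> F u \<longleftrightarrow> (\<forall>t>0. AE \<xi> in lborel.
     ft u \<xi> = semigroup_ft \<nu> \<Omega> \<alpha> t (ft u) \<xi>
       + bilinear_ft \<nu> \<Omega> \<alpha> (\<lambda>_. ft u) (\<lambda>_. ft u) t \<xi>
       + (LINT \<tau>:{0..t}|lborel.
            semigroup_symbol \<nu> \<Omega> \<alpha> \<tau> \<xi> *v (leray_symbol \<xi> *v ft F \<xi>)))"

end

theory Submission
  imports Defs
begin

text \<open>
  All estimates are made for absolute values in Fourier variables, with the cutoffs
  \<open>\<phi>\<^sub>j\<close> replaced by indicators of dyadic annuli, which gives an equivalent norm. The difference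
  \<open>D = v - u\<^sub>\<infinity>\<close> satisfies
  \<open>D(t) = S(t)(v\<^sub>0 - u\<^sub>\<infinity>) + B(D, v)(t) + B(u\<^sub>\<infinity>, D)(t) + \<integral> S(t - \<tau>) P (G(\<tau>) - F) d\<tau>\<close>.
  Split each time integral at \<open>\<theta> t\<close>. On the annulus of index \<open>j\<close> the heat factor turns a factor
  \<open>2\<^bsup>2\<alpha>j\<^esup>\<close> in the integrand into \<open>2\<theta>/\<nu>\<close> on \<open>[0, \<theta> t]\<close> and into \<open>1/\<nu>\<close> on \<open>[\<theta> t, t]\<close>, uniformly in \<open>j\<close> and \<open>t\<close>.
  In the product estimate \<open>v\<close> and \<open>u\<^sub>\<infinity>\<close> contribute a factor \<open>\<epsilon>\<close>, which is chosen small, so a bound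
  \<open>\<rho>\<close> for the norm of \<open>D\<close> in \<open>\<L>\<^sup>\<infinity>([T, \<infinity>))\<close> improves to \<open>3\<rho>/4\<close> at a later time: choose \<open>\<theta>\<close>
  small first and then \<open>t\<close> large. The data terms converge to zero in these tail norms as well, by
  dominated convergence in \<open>\<ell>\<^sup>q\<close> if \<open>q < \<infinity>\<close> and trivially if \<open>q = \<infinity>\<close>.
\<close>

section \<open>Minkowski's integral inequality\<close>

text \<open>In \<L>^\<infinity> the supremum over time stands inside the \<open>ell q\<close> norm,
  so a tail bound is not carried as a number but as a sequence that dominates every shell norm from
  some time on; its \<open>ell q\<close> norm is taken only at the end of an estimate. The exponents
  fit because one derivative and one product cost exactly what the heat factor returns, 2s - 3(1 -
  1/p) = s - 2\<alpha> + 1, while \<alpha> > 1/2 makes the sums over low frequencies converge and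
  \<alpha> < (5 - 3/p)/4 those over high frequencies. A second obstacle is that \<open>ft\<close>
  and \<open>ft_time\<close> are choices. Subtracting the two equations at almost every frequency
  rests on the uniqueness of the representing function, on the existence of jointly measurable
  representatives and on absolute convergence of all integrals involved. The improvement of the tail
  bound takes a bound at almost every time and returns one at every late time, since the mild
  equation holds at each time; this yields a genuine limit as t tends to infinity.\<close>

lemma ennreal_powr_0 [simp]: "r > 0 \<Longrightarrow> ennreal_powr 0 r = 0"
  by (simp add: ennreal_powr_def)

lemma ennreal_powr_top [simp]: "ennreal_powr top r = top"
  by (simp add: ennreal_powr_def)

lemma ennreal_powr_ennreal: "0 \<le> a \<Longrightarrow> ennreal_powr (ennreal a) r = ennreal (a powr r)"
  by (simp add: ennreal_powr_def)

lemma ennreal_powr_one [simp]: "ennreal_powr x 1 = x"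
  by (cases x) (auto simp: ennreal_powr_def)

lemma ennreal_powr_eq_0_iff: "r > 0 \<Longrightarrow> ennreal_powr x r = 0 \<longleftrightarrow> x = 0"
  by (cases x) (auto simp: ennreal_powr_ennreal ennreal_eq_0_iff)

lemma ennreal_powr_mono: "x \<le> y \<Longrightarrow> 0 \<le> r \<Longrightarrow> ennreal_powr x r \<le> ennreal_powr y r"
  by (cases x; cases y) (auto simp: ennreal_powr_ennreal powr_mono2 top_unique)

lemma ennreal_powr_mult: "r > 0 \<Longrightarrow> ennreal_powr (x * y) r = ennreal_powr x r * ennreal_powr y r"
  by (cases x; cases y)
    (auto simp: ennreal_powr_ennreal powr_mult ennreal_mult'[symmetric] ennreal_top_mult
        ennreal_mult_top ennreal_eq_0_iff)

lemma ennreal_powr_powr: "ennreal_powr (ennreal_powr x a) b = ennreal_powr x (a * b)"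
  by (cases x) (auto simp: ennreal_powr_ennreal powr_powr)

lemma measurable_ennreal_powr [measurable]: "(\<lambda>x. ennreal_powr x r) \<in> borel_measurable borel"
  unfolding ennreal_powr_def infinity_ennreal_def by measurable

lemma ennreal_mult_divide_cancel: "0 < c \<Longrightarrow> c < top \<Longrightarrow> c * (x / c) = (x::ennreal)"
  by (cases x; cases c)
    (auto simp: divide_ennreal ennreal_mult'[symmetric] ennreal_mult_top ennreal_top_divide)

text \<open>Convexity of the power function: the graph of \<open>a powr r\<close> lies above its
  tangent at \<open>m\<close>.\<close>

lemma young_tangent:
  fixes a m r :: real
  assumes "0 \<le> a" "0 \<le> m" "1 \<le> r"
  shows "a * m powr (r - 1) \<le> 1 / r * a powr r + (1 - 1 / r) * m powr r"
proof (cases "r = 1")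
  case True
  then show ?thesis using assms by auto
next
  case False
  then have r: "r > 1" using assms by auto
  have "a * m powr (r - 1) \<le> a powr r / r + (m powr (r - 1)) powr (r / (r - 1)) / (r / (r - 1))"
    using r assms by (intro Youngs_inequality) (auto simp: field_simps)
  also have "(m powr (r - 1)) powr (r / (r - 1)) = m powr r"
    using r by (simp add: powr_powr)
  also have "m powr r / (r / (r - 1)) = (1 - 1 / r) * m powr r"
    using r by (simp add: field_simps)
  finally show ?thesis by simp
qed

text \<open>Integrate \<open>young_tangent\<close> at the mean \<open>m\<close> of \<open>h\<close>.
  The mean has to be finite before \<open>m powr r\<close> can be absorbed on the left, hence the
  preliminary comparison of \<open>h\<close> with 1 + h^r.\<close>

lemma nn_integral_jensen_powr:
  assumes [measurable]: "h \<in> borel_measurable M" and M: "emeasure M (space M) = 1" and r: "1 \<le> r"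
  shows "ennreal_powr (\<integral>\<^sup>+x. h x \<partial>M) r \<le> (\<integral>\<^sup>+x. ennreal_powr (h x) r \<partial>M)"
proof (cases "(\<integral>\<^sup>+x. ennreal_powr (h x) r \<partial>M) = top")
  case False
  have "h x \<le> 1 + ennreal_powr (h x) r" for x
  proof (cases "h x")
    case (real a)
    have "a \<le> 1 + a powr r"
    proof (cases "a \<le> 1")
      case False
      then have "a powr 1 \<le> a powr r" using r by (intro powr_mono) auto
      then show ?thesis using False by auto
    qed (auto intro: add_increasing2)
    then show ?thesis using real
      by (simp add: ennreal_powr_ennreal flip: ennreal_1 ennreal_plus)
  qed auto
  then have "(\<integral>\<^sup>+x. h x \<partial>M) \<le> (\<integral>\<^sup>+x. 1 + ennreal_powr (h x) r \<partial>M)"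
    by (intro nn_integral_mono) auto
  also have "\<dots> = 1 + (\<integral>\<^sup>+x. ennreal_powr (h x) r \<partial>M)"
    using M by (subst nn_integral_add) auto
  also have "\<dots> < top" using False by (simp add: less_top)
  finally obtain m where m: "(\<integral>\<^sup>+x. h x \<partial>M) = ennreal m" "m \<ge> 0"
    by (cases "\<integral>\<^sup>+x. h x \<partial>M") auto
  obtain J where J: "(\<integral>\<^sup>+x. ennreal_powr (h x) r \<partial>M) = ennreal J" "J \<ge> 0"
    using False by (cases "\<integral>\<^sup>+x. ennreal_powr (h x) r \<partial>M") auto
  have "h x * ennreal (m powr (r - 1)) \<le>
      ennreal (1 / r) * ennreal_powr (h x) r + ennreal ((1 - 1 / r) * m powr r)" for x
  proof (cases "h x")
    case (real a)
    then show ?thesis using young_tangent[of a m r] r m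
      by (simp add: ennreal_powr_ennreal flip: ennreal_mult' ennreal_plus)
  qed (use r in \<open>auto simp: ennreal_mult_top\<close>)
  then have "(\<integral>\<^sup>+x. h x * ennreal (m powr (r - 1)) \<partial>M) \<le>
      (\<integral>\<^sup>+x. ennreal (1 / r) * ennreal_powr (h x) r + ennreal ((1 - 1 / r) * m powr r) \<partial>M)"
    by (intro nn_integral_mono) auto
  also have "\<dots> = ennreal (1 / r) * ennreal J + ennreal ((1 - 1 / r) * m powr r)"
    using M by (subst nn_integral_add) (auto simp: nn_integral_cmult J)
  also have "\<dots> = ennreal (1 / r * J + (1 - 1 / r) * m powr r)"
    using r J by (simp add: ennreal_mult'[symmetric] flip: ennreal_plus)
  also have "(\<integral>\<^sup>+x. h x * ennreal (m powr (r - 1)) \<partial>M) = ennreal (m * m powr (r - 1))"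
    using m by (subst nn_integral_multc) (auto simp: ennreal_mult')
  finally have "m * m powr (r - 1) \<le> 1 / r * J + (1 - 1 / r) * m powr r"
    using r J by (subst (asm) ennreal_le_iff) auto
  also have "m * m powr (r - 1) = m powr r"
    using m by (cases "m = 0") (auto simp: powr_diff)
  finally have "m powr r \<le> J" using r by (simp add: field_simps)
  then show ?thesis by (simp add: m J ennreal_powr_ennreal ennreal_leI)
qed auto

text \<open>The inner integral is \<open>L\<close> times the average of \<open>f / l\<close> for the
  probability density \<open>l / L\<close>; Jensen's inequality for this average and an exchange of
  the integrals give the claim without duality.\<close>

lemma (in pair_sigma_finite) nn_integral_minkowski:
  assumes f [measurable]: "(\<lambda>(x, y). f x y) \<in> borel_measurable (M1 \<Otimes>\<^sub>M M2)"
    and l [measurable]: "l \<in> borel_measurable M2" and r: "1 \<le> r"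
    and le: "AE y in M2. (\<integral>\<^sup>+x. ennreal_powr (f x y) r \<partial>M1) \<le> ennreal_powr (l y) r"
  shows "(\<integral>\<^sup>+x. ennreal_powr (\<integral>\<^sup>+y. f x y \<partial>M2) r \<partial>M1) \<le> ennreal_powr (\<integral>\<^sup>+y. l y \<partial>M2) r"
proof -
  define L where "L = (\<integral>\<^sup>+y. l y \<partial>M2)"
  have f1 [measurable]: "(\<lambda>x. f x y) \<in> borel_measurable M1" if "y \<in> space M2" for y
    using measurable_compose[OF measurable_Pair2'[OF that] f] by simp
  \<comment> \<open>The quotient \<open>f / l\<close> says nothing about \<open>f\<close> where
    \<open>l\<close> vanishes; the hypothesis forces \<open>f\<close> to vanish there too.\<close>
  have zero: "AE x in M1. AE y in M2. l y = 0 \<longrightarrow> f x y = 0"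
  proof (subst AE_commute)
    have "AE y in M2. y \<in> space M2 \<longrightarrow> l y = 0 \<longrightarrow> (AE x in M1. f x y = 0)"
      using le
    proof eventually_elim
      case (elim y)
      show ?case
      proof (intro impI)
        assume y: "y \<in> space M2" "l y = 0"
        then have "(\<integral>\<^sup>+x. ennreal_powr (f x y) r \<partial>M1) = 0"
          using elim r by simp
        then have "AE x in M1. ennreal_powr (f x y) r = 0"
          using y by (subst (asm) nn_integral_0_iff_AE) auto
        then show "AE x in M1. f x y = 0"
          using r by (simp add: ennreal_powr_eq_0_iff)
      qed
    qed
    then show "AE y in M2. AE x in M1. l y = 0 \<longrightarrow> f x y = 0"
      using AE_space by eventually_elim auto
  qed measurable
  consider "L = top" | "L = 0" | "0 < L" "L < top"
    by (metis less_top not_gr_zero)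
  then show ?thesis
  proof cases
    case 1
    then show ?thesis by (simp add: L_def)
  next
    case 2
    then have l0: "AE y in M2. l y = 0"
      unfolding L_def by (subst (asm) nn_integral_0_iff_AE) auto
    from zero have "AE x in M1. (\<integral>\<^sup>+y. f x y \<partial>M2) = 0"
    proof eventually_elim
      case (elim x)
      with l0 have "AE y in M2. f x y = 0" by auto
      then have "(\<integral>\<^sup>+y. f x y \<partial>M2) = (\<integral>\<^sup>+y. 0 \<partial>M2)" by (rule nn_integral_cong_AE)
      then show ?case by simp
    qed
    then have "(\<integral>\<^sup>+x. ennreal_powr (\<integral>\<^sup>+y. f x y \<partial>M2) r \<partial>M1) = (\<integral>\<^sup>+x. 0 \<partial>M1)"
      using r by (intro nn_integral_cong_AE) auto
    then show ?thesis by simp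
  next
    case 3
    define P where "P = density M2 (\<lambda>y. l y / L)"
    have P1: "emeasure P (space P) = 1"
      using 3 by (simp add: P_def emeasure_density nn_integral_divide L_def[symmetric]
          ennreal_divide_self cong: nn_integral_cong)
    have lfin: "AE y in M2. l y \<noteq> top"
      using nn_integral_PInf_AE[of l M2] 3 by (auto simp: L_def infinity_ennreal_def)
    have A: "AE x in M1. ennreal_powr (\<integral>\<^sup>+y. f x y \<partial>M2) r \<le>
        ennreal_powr L r * (\<integral>\<^sup>+y. (l y / L) * ennreal_powr (f x y / l y) r \<partial>M2)"
      using zero AE_space
    proof eventually_elim
      case (elim x)
      have [measurable]: "(\<lambda>y. f x y) \<in> borel_measurable M2"
        using measurable_compose[OF measurable_Pair1'[OF elim(2)] f] by simp
      have "(\<integral>\<^sup>+y. f x y \<partial>M2) = (\<integral>\<^sup>+y. L * ((l y / L) * (f x y / l y)) \<partial>M2)"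
      proof (intro nn_integral_cong_AE)
        show "AE y in M2. f x y = L * ((l y / L) * (f x y / l y))"
          using elim(1) lfin
        proof eventually_elim
          case (elim y)
          have "L * (l y / L) = l y"
            using 3 by (intro ennreal_mult_divide_cancel)
          moreover have "l y * (f x y / l y) = f x y"
            using elim by (cases "l y = 0")
              (auto intro!: ennreal_mult_divide_cancel simp: less_top zero_less_iff_neq_zero)
          ultimately show ?case by (metis mult.assoc)
        qed
      qed
      also have "\<dots> = L * (\<integral>\<^sup>+y. f x y / l y \<partial>P)"
        unfolding P_def by (subst nn_integral_density) (auto simp: nn_integral_cmult)
      finally have "ennreal_powr (\<integral>\<^sup>+y. f x y \<partial>M2) r = ennreal_powr L r * ennreal_powr (\<integral>\<^sup>+y. f x y / l y \<partial>P) r"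
        using r by (simp add: ennreal_powr_mult)
      also have "\<dots> \<le> ennreal_powr L r * (\<integral>\<^sup>+y. ennreal_powr (f x y / l y) r \<partial>P)"
        using P1 r by (intro mult_left_mono nn_integral_jensen_powr) (auto simp: P_def)
      also have "(\<integral>\<^sup>+y. ennreal_powr (f x y / l y) r \<partial>P)
          = (\<integral>\<^sup>+y. (l y / L) * ennreal_powr (f x y / l y) r \<partial>M2)"
        unfolding P_def by (subst nn_integral_density) auto
      finally show ?case .
    qed
    have B: "AE y in M2. (l y / L) * (\<integral>\<^sup>+x. ennreal_powr (f x y / l y) r \<partial>M1) \<le> l y / L"
      using le lfin AE_space
    proof eventually_elim
      case (elim y)
      show ?case
      proof (cases "l y = 0")
        case False
        have "ennreal_powr (f x y / l y) r = ennreal_powr (f x y) r * ennreal_powr (inverse (l y)) r" for x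
          using r by (simp add: divide_ennreal_def ennreal_powr_mult)
        then have "(\<integral>\<^sup>+x. ennreal_powr (f x y / l y) r \<partial>M1)
           = (\<integral>\<^sup>+x. ennreal_powr (f x y) r \<partial>M1) * ennreal_powr (inverse (l y)) r"
          using elim(3) by (simp add: nn_integral_multc)
        also have "\<dots> \<le> ennreal_powr (l y) r * ennreal_powr (inverse (l y)) r"
          using elim by (intro mult_right_mono) auto
        also have "\<dots> = 1"
          using r elim False by (cases "l y")
            (auto simp: ennreal_powr_mult[symmetric] inverse_ennreal ennreal_mult'[symmetric]
              ennreal_powr_ennreal ennreal_eq_0_iff inverse_powr)
        finally have "(l y / L) * (\<integral>\<^sup>+x. ennreal_powr (f x y / l y) r \<partial>M1) \<le> (l y / L) * 1"
          by (intro mult_left_mono) auto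
        then show ?thesis by simp
      qed auto
    qed
    have "(\<integral>\<^sup>+x. ennreal_powr (\<integral>\<^sup>+y. f x y \<partial>M2) r \<partial>M1) \<le>
       (\<integral>\<^sup>+x. ennreal_powr L r * (\<integral>\<^sup>+y. (l y / L) * ennreal_powr (f x y / l y) r \<partial>M2) \<partial>M1)"
      by (rule nn_integral_mono_AE[OF A])
    also have "\<dots> = ennreal_powr L r * (\<integral>\<^sup>+x. (\<integral>\<^sup>+y. (l y / L) * ennreal_powr (f x y / l y) r \<partial>M2) \<partial>M1)"
      by (rule nn_integral_cmult) measurable
    also have "(\<integral>\<^sup>+x. (\<integral>\<^sup>+y. (l y / L) * ennreal_powr (f x y / l y) r \<partial>M2) \<partial>M1)
        = (\<integral>\<^sup>+y. (\<integral>\<^sup>+x. (l y / L) * ennreal_powr (f x y / l y) r \<partial>M1) \<partial>M2)"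
      by (rule Fubini'[symmetric]) measurable
    also have "\<dots> = (\<integral>\<^sup>+y. (l y / L) * (\<integral>\<^sup>+x. ennreal_powr (f x y / l y) r \<partial>M1) \<partial>M2)"
      by (intro nn_integral_cong nn_integral_cmult) auto
    also have "\<dots> \<le> (\<integral>\<^sup>+y. l y / L \<partial>M2)"
      by (rule nn_integral_mono_AE[OF B])
    also have "\<dots> = 1"
      using 3 by (simp add: nn_integral_divide L_def[symmetric] ennreal_divide_self)
    finally show ?thesis by (simp add: L_def mult_left_mono)
  qed
qed

section \<open>Lebesgue norms with values in \<open>ennreal\<close>\<close>

lemma one_le_enn2real: "1 \<le> p \<Longrightarrow> p \<noteq> top \<Longrightarrow> 1 \<le> enn2real p"
  by (cases p) auto

lemma Lp_norm_top: "Lp_norm top M f = esssup M f"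
  by (simp add: Lp_norm_def)

lemma Lp_norm_le_iff:
  assumes "1 \<le> p" "p \<noteq> top"
  shows "Lp_norm p M f \<le> c \<longleftrightarrow>
    (\<integral>\<^sup>+x. ennreal_powr (f x) (enn2real p) \<partial>M) \<le> ennreal_powr c (enn2real p)"
proof -
  let ?r = "enn2real p" let ?I = "\<integral>\<^sup>+x. ennreal_powr (f x) ?r \<partial>M"
  have r: "1 \<le> ?r" using one_le_enn2real assms by auto
  have *: "ennreal_powr (ennreal_powr x ?r) (1 / ?r) = x" "ennreal_powr (ennreal_powr x (1 / ?r)) ?r = x" for x
    using r by (simp_all add: ennreal_powr_powr)
  show ?thesis
    using ennreal_powr_mono[of ?I "ennreal_powr c ?r" "1 / ?r"]
      ennreal_powr_mono[of "ennreal_powr ?I (1 / ?r)" c ?r] * r assms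
    by (auto simp: Lp_norm_def)
qed

lemma Lp_norm_mono_AE:
  assumes "f \<in> borel_measurable M" "AE x in M. f x \<le> g x" "1 \<le> p"
  shows "Lp_norm p M f \<le> Lp_norm p M g"
proof (cases "p = top")
  case True
  then show ?thesis using assms by (simp add: Lp_norm_top esssup_AE_mono)
next
  case False
  have "(\<integral>\<^sup>+x. ennreal_powr (f x) (enn2real p) \<partial>M) \<le> (\<integral>\<^sup>+x. ennreal_powr (g x) (enn2real p) \<partial>M)"
    using assms(2) by (intro nn_integral_mono_AE) (auto elim!: eventually_mono intro: ennreal_powr_mono)
  then show ?thesis using False assms by (auto simp: Lp_norm_def intro!: ennreal_powr_mono)
qed

lemma Lp_norm_mono:
  assumes "f \<in> borel_measurable M" "\<And>x. f x \<le> g x" "1 \<le> p"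
  shows "Lp_norm p M f \<le> Lp_norm p M g"
  using assms by (intro Lp_norm_mono_AE) auto

lemma Lp_norm_cmult_le:
  assumes [measurable]: "f \<in> borel_measurable M" and p: "1 \<le> p"
  shows "Lp_norm p M (\<lambda>x. c * f x) \<le> c * Lp_norm p M f"
proof (cases "p = top")
  case True
  have "AE x in M. c * f x \<le> c * esssup M f"
    using esssup_AE[of f M] by eventually_elim (rule mult_left_mono, auto)
  then show ?thesis using True by (auto simp: Lp_norm_top intro!: esssup_I)
next
  case False
  have r: "1 \<le> enn2real p" using one_le_enn2real p False by auto
  have "Lp_norm p M f \<le> Lp_norm p M f" by simp
  then have "(\<integral>\<^sup>+x. ennreal_powr (f x) (enn2real p) \<partial>M) \<le> ennreal_powr (Lp_norm p M f) (enn2real p)"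
    using Lp_norm_le_iff[OF p False] by blast
  then show ?thesis
    using r by (auto simp: Lp_norm_le_iff[OF p False] ennreal_powr_mult nn_integral_cmult mult_left_mono)
qed

text \<open>
  The bound \<open>l\<close> replaces the norms of the sections, which need not depend measurably on \<open>y\<close>
  for \<open>p = \<infinity>\<close>.
\<close>

lemma (in pair_sigma_finite) Lp_norm_nn_integral_le:
  assumes f [measurable]: "(\<lambda>(x, y). f x y) \<in> borel_measurable (M1 \<Otimes>\<^sub>M M2)"
    and l [measurable]: "l \<in> borel_measurable M2" and p: "1 \<le> p"
    and le: "AE y in M2. Lp_norm p M1 (\<lambda>x. f x y) \<le> l y"
  shows "Lp_norm p M1 (\<lambda>x. \<integral>\<^sup>+y. f x y \<partial>M2) \<le> (\<integral>\<^sup>+y. l y \<partial>M2)"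
proof (cases "p = top")
  case True
  have "AE y in M2. AE x in M1. f x y \<le> l y"
    using le
  proof eventually_elim
    case (elim y)
    show ?case
      using esssup_AE[of "\<lambda>x. f x y" M1]
      by eventually_elim (use elim True in \<open>auto simp: Lp_norm_top\<close>)
  qed
  then have "AE x in M1. AE y in M2. f x y \<le> l y"
    by (subst AE_commute) measurable
  then have "AE x in M1. (\<integral>\<^sup>+y. f x y \<partial>M2) \<le> (\<integral>\<^sup>+y. l y \<partial>M2)"
    by eventually_elim (rule nn_integral_mono_AE)
  then show ?thesis
    using True by (auto simp: Lp_norm_top intro!: esssup_I)
next
  case False
  have r: "1 \<le> enn2real p" using one_le_enn2real p False by auto
  show ?thesis
    unfolding Lp_norm_le_iff[OF p False]
    using le by (intro nn_integral_minkowski f l r) (simp add: Lp_norm_le_iff[OF p False])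
qed

text \<open>Minkowski's inequality with counting measure in the second variable. The infinite sum is
  needed for decompositions into dyadic annuli.\<close>

lemma (in sigma_finite_measure) Lp_norm_suminf_le:
  assumes [measurable]: "\<And>i. f i \<in> borel_measurable M" and p: "1 \<le> p"
  shows "Lp_norm p M (\<lambda>x. \<Sum>i::nat. f i x) \<le> (\<Sum>i. Lp_norm p M (f i))"
proof -
  interpret N: sigma_finite_measure "count_space (UNIV::nat set)"
    by (rule sigma_finite_measure_count_space)
  interpret P: pair_sigma_finite M "count_space (UNIV::nat set)" ..
  have "Lp_norm p M (\<lambda>x. \<integral>\<^sup>+i. f i x \<partial>count_space UNIV) \<le> (\<integral>\<^sup>+i. Lp_norm p M (f i) \<partial>count_space UNIV)"
    using p by (intro P.Lp_norm_nn_integral_le) auto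
  then show ?thesis by (simp add: nn_integral_count_space_nat)
qed

lemma Lp_norm_zero [simp]: "1 \<le> p \<Longrightarrow> Lp_norm p M (\<lambda>x. 0) = 0"
  using Lp_norm_cmult_le[of "\<lambda>x. 0" M p 0] by simp

lemma (in sigma_finite_measure) Lp_norm_add_le:
  assumes [measurable]: "f \<in> borel_measurable M" "g \<in> borel_measurable M" and p: "1 \<le> p"
  shows "Lp_norm p M (\<lambda>x. f x + g x) \<le> Lp_norm p M f + Lp_norm p M g"
proof -
  let ?f = "\<lambda>i::nat. if i = 0 then f else if i = 1 then g else (\<lambda>_. 0)"
  have "(\<Sum>i. ?f i x) = (\<Sum>i\<in>{0,1}. ?f i x)" for x
    by (rule suminf_finite) auto
  moreover have "(\<Sum>i. Lp_norm p M (?f i)) = (\<Sum>i\<in>{0,1}. Lp_norm p M (?f i))"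
    using p by (intro suminf_finite) auto
  ultimately show ?thesis
    using Lp_norm_suminf_le[of ?f p] p by simp
qed

section \<open>Sequence norms over the dyadic index\<close>

abbreviation ell :: "ennreal \<Rightarrow> (int \<Rightarrow> ennreal) \<Rightarrow> ennreal" where
  "ell q \<equiv> Lp_norm q (count_space UNIV)"

lemma sigma_finite_count_int: "sigma_finite_measure (count_space (UNIV::int set))"
  by (rule sigma_finite_measure_count_space)

lemmas ell_add_le = sigma_finite_measure.Lp_norm_add_le[OF sigma_finite_count_int, simplified]
lemmas ell_suminf_le = sigma_finite_measure.Lp_norm_suminf_le[OF sigma_finite_count_int, simplified]
lemmas ell_cmult_le = Lp_norm_cmult_le[of _ "count_space (UNIV::int set)", simplified]

lemma ell_mono: "1 \<le> q \<Longrightarrow> (\<And>j. x j \<le> y j) \<Longrightarrow> ell q x \<le> ell q y"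
  by (rule Lp_norm_mono) auto

lemma ell_top: "ell top x = (SUP j. x j)"
proof (rule antisym)
  show "ell top x \<le> (SUP j. x j)"
    unfolding Lp_norm_top by (rule esssup_I) (auto intro: SUP_upper)
  have "AE j in count_space UNIV. x j \<le> esssup (count_space UNIV) x"
    by (rule esssup_AE)
  then show "(SUP j. x j) \<le> ell top x"
    by (auto simp: Lp_norm_top AE_count_space intro: SUP_least)
qed

lemma le_ell:
  assumes q: "1 \<le> q"
  shows "x j \<le> ell q x"
proof (cases "q = top")
  case True
  then show ?thesis by (auto simp: ell_top intro: SUP_upper)
next
  case False
  have r: "1 \<le> enn2real q" using one_le_enn2real q False by auto
  have "ennreal_powr (x j) (enn2real q)
      = (\<integral>\<^sup>+i. ennreal_powr (x i) (enn2real q) * indicator {j} i \<partial>count_space UNIV)"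
    by (subst nn_integral_count_space'[where A = "{j}"]) auto
  also have "\<dots> \<le> (\<integral>\<^sup>+i. ennreal_powr (x i) (enn2real q) \<partial>count_space UNIV)"
    by (intro nn_integral_mono) (auto simp: indicator_def)
  also have "\<dots> \<le> ennreal_powr (ell q x) (enn2real q)"
    using Lp_norm_le_iff[OF q False, of "count_space UNIV" x "ell q x"] by simp
  finally have "ennreal_powr (ennreal_powr (x j) (enn2real q)) (1 / enn2real q)
      \<le> ennreal_powr (ennreal_powr (ell q x) (enn2real q)) (1 / enn2real q)"
    by (rule ennreal_powr_mono) simp
  moreover have "ennreal_powr (ennreal_powr y (enn2real q)) (1 / enn2real q) = y" for y
    using r by (simp add: ennreal_powr_powr)
  ultimately show ?thesis by (simp only:)
qed

lemma ell_shift: "ell q (\<lambda>j. x (j + i)) = ell q x"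
proof (cases "q = top")
  case True
  have "range (\<lambda>j. x (j + i)) = range x"
    by (auto simp: image_def) (metis diff_add_cancel)
  then show ?thesis using True by (simp add: ell_top)
next
  case False
  have "bij_betw (\<lambda>j. j + i) UNIV (UNIV::int set)"
    by (rule bij_betw_byWitness[where f' = "\<lambda>j. j - i"]) auto
  then have "(\<integral>\<^sup>+j. ennreal_powr (x (j + i)) (enn2real q) \<partial>count_space UNIV)
      = (\<integral>\<^sup>+j. ennreal_powr (x j) (enn2real q) \<partial>count_space UNIV)"
    by (rule nn_integral_bij_count_space[where f = "\<lambda>j. ennreal_powr (x j) (enn2real q)"])
  then show ?thesis using False by (simp add: Lp_norm_def)
qed

section \<open>Dyadic annuli\<close>

text \<open>The weight is never \<open>0\<close> or \<open>top\<close>, so it can be cancelled even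
  though the norms it multiplies may be infinite.\<close>

definition exp2 :: "real \<Rightarrow> ennreal" where "exp2 a = ennreal (2 powr a)"

lemma exp2_add: "exp2 (a + b) = exp2 a * exp2 b"
  by (simp add: exp2_def powr_add ennreal_mult')

lemma exp2_0 [simp]: "exp2 0 = 1"
  by (simp add: exp2_def)

lemma exp2_neq [simp]: "exp2 a \<noteq> 0" "exp2 a \<noteq> top"
  by (simp_all add: exp2_def)

lemma exp2_less_top [simp]: "exp2 a < top"
  by (simp add: exp2_def)

lemma exp2_mono: "a \<le> b \<Longrightarrow> exp2 a \<le> exp2 b"
  by (simp add: exp2_def ennreal_leI)

lemma exp2_mult_cancel: "exp2 a * (exp2 (-a) * x) = x" "exp2 (-a) * (exp2 a * x) = x"
  by (simp_all flip: mult.assoc exp2_add)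

lemma ennreal_le_suminf: "f i \<le> (\<Sum>i. f i :: ennreal)"
  using sum_le_suminf[of f "{i}"] by simp

lemma suminf_exp2:
  assumes "\<delta> > 0"
  shows "(\<Sum>i::nat. exp2 (- (real i * \<delta>))) = ennreal (1 / (1 - 2 powr (-\<delta>)))"
proof -
  have "2 powr (- (real i * \<delta>)) = (2 powr (-\<delta>)) ^ i" for i
    by (simp add: powr_realpow[symmetric] powr_powr mult.commute)
  moreover have "(\<Sum>i::nat. ennreal ((2 powr (-\<delta>)) ^ i)) = ennreal (1 / (1 - 2 powr (-\<delta>)))"
    using assms by (intro suminf_ennreal_eq geometric_sums) (auto simp: powr_less_one)
  ultimately show ?thesis by (simp add: exp2_def)
qed

text \<open>Half-open, so that the nonzero frequencies are partitioned.\<close>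

definition annulus :: "int \<Rightarrow> (real^3) set" where
  "annulus j = {\<xi>. 2 powr (of_int j) \<le> norm \<xi> \<and> norm \<xi> < 2 powr (of_int j + 1)}"

lemma annulus_borel [measurable]: "annulus j \<in> sets borel"
  unfolding annulus_def by measurable

lemma ex_annulus:
  assumes "\<xi> \<noteq> 0"
  shows "\<exists>j. \<xi> \<in> annulus j"
proof -
  define k where "k = \<lfloor>log 2 (norm \<xi>)\<rfloor>"
  have "of_int k \<le> log 2 (norm \<xi>)" "log 2 (norm \<xi>) < of_int k + 1"
    by (auto simp: k_def)
  then have "2 powr (of_int k) \<le> norm \<xi>" "norm \<xi> < 2 powr (of_int k + 1)"
    using assms by (simp_all add: le_log_iff log_less_iff)
  then show ?thesis by (auto simp: annulus_def)
qed

definition ann :: "ennreal \<Rightarrow> int \<Rightarrow> (real^3 \<Rightarrow> ennreal) \<Rightarrow> ennreal" where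
  "ann p j f = Lp_norm p lborel (\<lambda>\<xi>. indicator (annulus j) \<xi> * f \<xi>)"

lemma ann_mono_AE:
  assumes [measurable]: "f \<in> borel_measurable borel" and "1 \<le> p"
    and "AE \<xi> in lborel. \<xi> \<in> annulus j \<longrightarrow> f \<xi> \<le> g \<xi>"
  shows "ann p j f \<le> ann p j g"
  unfolding ann_def using assms(2,3)
  by (intro Lp_norm_mono_AE) (auto elim!: eventually_mono simp: indicator_def)

lemma ann_add_le:
  assumes [measurable]: "f \<in> borel_measurable borel" "g \<in> borel_measurable borel" and "1 \<le> p"
  shows "ann p j (\<lambda>\<xi>. f \<xi> + g \<xi>) \<le> ann p j f + ann p j g"
  unfolding ann_def distrib_left using assms(3)
  by (intro lborel.Lp_norm_add_le) auto

lemma ann_cmult_le: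
  assumes [measurable]: "f \<in> borel_measurable borel" and "1 \<le> p"
  shows "ann p j (\<lambda>\<xi>. c * f \<xi>) \<le> c * ann p j f"
  unfolding ann_def using assms(2) Lp_norm_cmult_le[of "\<lambda>\<xi>. indicator (annulus j) \<xi> * f \<xi>" lborel p c]
  by (simp add: mult.left_commute)

lemma ann_suminf_le:
  assumes [measurable]: "\<And>i. f i \<in> borel_measurable borel" and "1 \<le> p"
  shows "ann p j (\<lambda>\<xi>. \<Sum>i::nat. f i \<xi>) \<le> (\<Sum>i. ann p j (f i))"
  unfolding ann_def using assms(2)
  by (subst ennreal_suminf_cmult[symmetric], intro lborel.Lp_norm_suminf_le) auto

lemma ann_le_Lp_norm:
  assumes [measurable]: "f \<in> borel_measurable borel" and "1 \<le> p"
  shows "ann p j f \<le> Lp_norm p lborel f"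
  unfolding ann_def using assms(2)
  by (intro Lp_norm_mono) (auto simp: indicator_def)

text \<open>The exponent 3(1 - 1/p) of the volume factor in Hoelder's inequality on a ball. For
  \<open>p = top\<close> the value of \<open>enn2real p\<close> is \<open>0\<close> and so is the
  quotient by it, which gives the correct value 3.\<close>

abbreviation dual_dim :: "ennreal \<Rightarrow> real" where
  "dual_dim p \<equiv> 3 - 3 / enn2real p"

text \<open>Hoelder's inequality on the annulus, obtained for finite \<open>p\<close> from Jensen's
  inequality for the uniform probability measure on a surrounding cube. The cube has half side
  2^(l+1), hence volume 64 * 2^(3l), and 64^(1 - 1/p) \<le> 64 makes the constant independent of
  \<open>p\<close>.\<close>

lemma bernstein:
  assumes f [measurable]: "f \<in> borel_measurable borel" and p: "1 \<le> p"
  shows "(\<integral>\<^sup>+\<xi>. indicator (annulus l) \<xi> * f \<xi> \<partial>lborel) \<le> 64 * exp2 (of_int l * dual_dim p) * ann p l f"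
proof -
  define R :: real where "R = 2 powr (of_int l + 1)"
  define B :: "(real^3) set" where "B = cbox (- (R *\<^sub>R One)) (R *\<^sub>R One)"
  have R: "R > 0" by (simp add: R_def)
  have [measurable]: "B \<in> sets borel" by (simp add: B_def)
  have sub: "annulus l \<subseteq> B"
  proof
    fix x assume "x \<in> annulus l"
    then have "norm x \<le> R" by (simp add: annulus_def R_def)
    then have "\<bar>x \<bullet> b\<bar> \<le> R" if "b \<in> Basis" for b
      using Basis_le_norm[OF that, of x] by auto
    then show "x \<in> B" by (auto simp: B_def mem_box abs_le_iff) (metis minus_le_iff)
  qed
  have "emeasure lborel B = ennreal ((2 * R) ^ 3)"
  proof -
    have One: "(One :: real^3) \<bullet> b = 1" if "b \<in> Basis" for b
      using inner_sum_left_Basis[OF that, of "\<lambda>_. 1"] by simp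
    have "(\<Prod>b\<in>Basis. (R *\<^sub>R One - - (R *\<^sub>R One) :: real^3) \<bullet> b) = (\<Prod>b\<in>(Basis :: (real^3) set). 2 * R)"
    proof (rule prod.cong)
      fix b :: "real^3" assume b: "b \<in> Basis"
      show "(R *\<^sub>R One - - (R *\<^sub>R One) :: real^3) \<bullet> b = 2 * R"
        unfolding inner_diff_left inner_minus_left inner_scaleR_left One[OF b] by linarith
    qed (rule refl)
    also have "\<dots> = (2 * R) ^ 3"
      unfolding prod_constant by (rule arg_cong[where f = "power (2 * R)"]) simp
    finally have *: "(\<Prod>b\<in>Basis. (R *\<^sub>R One - - (R *\<^sub>R One) :: real^3) \<bullet> b) = (2 * R) ^ 3" .
    have "emeasure lborel B = ennreal (\<Prod>b\<in>Basis. (R *\<^sub>R One - - (R *\<^sub>R One) :: real^3) \<bullet> b)"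
      unfolding B_def
    proof (rule emeasure_lborel_cbox)
      fix b :: "real^3" assume b: "b \<in> Basis"
      show "(- (R *\<^sub>R One)) \<bullet> b \<le> (R *\<^sub>R One) \<bullet> b"
        unfolding inner_minus_left inner_scaleR_left One[OF b] using R by linarith
    qed
    then show ?thesis unfolding * .
  qed
  also have "(2 * R) ^ 3 = 64 * 2 powr (3 * of_int l)"
  proof -
    have "R ^ 3 = R powr 3" using R by simp
    also have "\<dots> = 2 powr ((of_int l + 1) * 3)" by (simp only: R_def powr_powr)
    also have "(of_int l + 1) * 3 = 3 * of_int l + (3 :: real)" by simp
    also have "2 powr \<dots> = 2 powr (3 * of_int l) * 8" by (simp add: powr_add)
    finally show ?thesis by (simp add: power_mult_distrib)
  qed
  finally have mB: "emeasure lborel B = ennreal (64 * 2 powr (3 * of_int l))" .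
  let ?h = "\<lambda>\<xi>. indicator (annulus l) \<xi> * f \<xi>"
  have hB: "?h \<xi> = indicator B \<xi> * ?h \<xi>" for \<xi>
    using sub by (auto simp: indicator_def)
  show ?thesis
  proof (cases "p = top")
    case True
    have "AE \<xi> in lborel. ?h \<xi> \<le> indicator B \<xi> * ann p l f"
      using esssup_AE[of ?h lborel]
      by eventually_elim (use sub in \<open>auto simp: True ann_def Lp_norm_top indicator_def\<close>)
    then have "(\<integral>\<^sup>+\<xi>. ?h \<xi> \<partial>lborel) \<le> (\<integral>\<^sup>+\<xi>. indicator B \<xi> * ann p l f \<partial>lborel)"
      by (rule nn_integral_mono_AE)
    also have "\<dots> = emeasure lborel B * ann p l f"
      by (subst nn_integral_multc) auto
    finally show ?thesis using True
      by (simp add: mB exp2_def mult.commute ennreal_mult')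
  next
    case False
    define r where "r = enn2real p"
    have r: "1 \<le> r" using one_le_enn2real p False by (auto simp: r_def)
    define b :: real where "b = 64 * 2 powr (3 * of_int l)"
    have b: "b > 0" by (simp add: b_def)
    define P where "P = density lborel (\<lambda>\<xi>. ennreal (1 / b) * indicator B \<xi>)"
    have "emeasure P (space P) = 1"
      using b by (simp add: P_def emeasure_density nn_integral_cmult mB b_def[symmetric] ennreal_mult'[symmetric])
    then have J: "ennreal_powr (\<integral>\<^sup>+\<xi>. ?h \<xi> \<partial>P) r \<le> (\<integral>\<^sup>+\<xi>. ennreal_powr (?h \<xi>) r \<partial>P)"
      using r by (intro nn_integral_jensen_powr) (auto simp: P_def)
    have 1: "(\<integral>\<^sup>+\<xi>. ?h \<xi> \<partial>P) = ennreal (1 / b) * (\<integral>\<^sup>+\<xi>. ?h \<xi> \<partial>lborel)"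
      unfolding P_def
      by (subst nn_integral_density) (auto simp: mult.assoc nn_integral_cmult hB[symmetric])
    have 2: "(\<integral>\<^sup>+\<xi>. ennreal_powr (?h \<xi>) r \<partial>P) = ennreal (1 / b) * (\<integral>\<^sup>+\<xi>. ennreal_powr (?h \<xi>) r \<partial>lborel)"
    proof -
      have "indicator B \<xi> * ennreal_powr (?h \<xi>) r = ennreal_powr (?h \<xi>) r" for \<xi>
        using sub r by (auto simp: indicator_def)
      then show ?thesis
        unfolding P_def
        by (subst nn_integral_density) (auto simp: mult.assoc nn_integral_cmult)
    qed
    have inv: "ennreal_powr (ennreal_powr x r) (1 / r) = x" for x
      using r by (simp add: ennreal_powr_powr)
    have "ennreal_powr (ennreal_powr (\<integral>\<^sup>+\<xi>. ?h \<xi> \<partial>P) r) (1 / r) \<le> ennreal_powr (\<integral>\<^sup>+\<xi>. ennreal_powr (?h \<xi>) r \<partial>P) (1 / r)"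
      using J r by (intro ennreal_powr_mono) auto
    then have "ennreal (1 / b) * (\<integral>\<^sup>+\<xi>. ?h \<xi> \<partial>lborel) \<le> ennreal_powr (ennreal (1 / b)) (1 / r) * ann p l f"
      unfolding inv 1 2 using r False by (simp add: ennreal_powr_mult ann_def Lp_norm_def r_def)
    then have "ennreal b * (ennreal (1 / b) * (\<integral>\<^sup>+\<xi>. ?h \<xi> \<partial>lborel))
        \<le> ennreal b * (ennreal_powr (ennreal (1 / b)) (1 / r) * ann p l f)"
      by (rule mult_left_mono) simp
    also have "ennreal b * (ennreal (1 / b) * (\<integral>\<^sup>+\<xi>. ?h \<xi> \<partial>lborel)) = (\<integral>\<^sup>+\<xi>. ?h \<xi> \<partial>lborel)"
      using b by (simp flip: mult.assoc ennreal_mult')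
    also have "ennreal b * (ennreal_powr (ennreal (1 / b)) (1 / r) * ann p l f)
        = ennreal (b powr (1 - 1 / r)) * ann p l f"
      using b r by (simp add: ennreal_powr_ennreal powr_diff powr_divide flip: mult.assoc ennreal_mult')
    also have "b powr (1 - 1 / r) \<le> 64 * 2 powr (of_int l * dual_dim p)"
    proof -
      have "b powr (1 - 1 / r) = 64 powr (1 - 1 / r) * 2 powr (of_int l * dual_dim p)"
        by (simp add: b_def powr_mult powr_powr r_def algebra_simps)
      moreover have "64 powr (1 - 1 / r) \<le> (64::real) powr 1"
        using r by (intro powr_mono) auto
      ultimately show ?thesis by simp
    qed
    then have "ennreal (b powr (1 - 1 / r)) * ann p l f \<le> ennreal (64 * 2 powr (of_int l * dual_dim p)) * ann p l f"
      by (intro mult_right_mono ennreal_leI) auto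
    finally show ?thesis by (simp add: exp2_def ennreal_mult')
  qed
qed

text \<open>Up to the origin the ball is the union of the annuli of index \<open>k - i\<close>.
  Bernstein's inequality on each of them leaves a geometric series with ratio 2^-(dual_dim p -
  s).\<close>

lemma low_frequency:
  assumes f [measurable]: "f \<in> borel_measurable borel" and p: "1 \<le> p" and \<delta>: "0 < dual_dim p - s"
    and B: "\<And>l. exp2 (of_int l * s) * ann p l f \<le> B"
  shows "(\<integral>\<^sup>+\<xi>. indicator {\<xi>. norm \<xi> < 2 powr (of_int k + 1)} \<xi> * f \<xi> \<partial>lborel)
    \<le> ennreal (64 / (1 - 2 powr (-(dual_dim p - s)))) * exp2 (of_int k * (dual_dim p - s)) * B"
proof -
  let ?d = "dual_dim p - s"
  have "AE \<xi> in lborel. (\<xi>::real^3) \<noteq> 0"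
    by (rule AE_lborel_singleton)
  then have "AE \<xi> in lborel. indicator {\<xi>. norm \<xi> < 2 powr (of_int k + 1)} \<xi> * f \<xi> \<le>
      (\<Sum>i::nat. indicator (annulus (k - int i)) \<xi> * f \<xi>)"
  proof eventually_elim
    case (elim \<xi>)
    obtain l where l: "\<xi> \<in> annulus l" using ex_annulus[OF elim] by auto
    show ?case
    proof (cases "norm \<xi> < 2 powr (of_int k + 1)")
      case True
      moreover have "2 powr (of_int l) \<le> norm \<xi>"
        using l by (simp add: annulus_def)
      ultimately have "2 powr (of_int l) < 2 powr (of_int k + 1 :: real)"
        by linarith
      then have "real_of_int l < real_of_int k + 1"
        by simp
      then have "l \<le> k" by linarith
      then have "indicator {\<xi>. norm \<xi> < 2 powr (of_int k + 1)} \<xi> * f \<xi> = indicator (annulus (k - int (nat (k - l)))) \<xi> * f \<xi>"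
        using l True by simp
      also have "\<dots> \<le> (\<Sum>i::nat. indicator (annulus (k - int i)) \<xi> * f \<xi>)"
        by (rule ennreal_le_suminf)
      finally show ?thesis .
    qed simp
  qed
  then have "(\<integral>\<^sup>+\<xi>. indicator {\<xi>. norm \<xi> < 2 powr (of_int k + 1)} \<xi> * f \<xi> \<partial>lborel) \<le>
      (\<integral>\<^sup>+\<xi>. (\<Sum>i::nat. indicator (annulus (k - int i)) \<xi> * f \<xi>) \<partial>lborel)"
    by (rule nn_integral_mono_AE)
  also have "\<dots> = (\<Sum>i::nat. \<integral>\<^sup>+\<xi>. indicator (annulus (k - int i)) \<xi> * f \<xi> \<partial>lborel)"
    by (rule nn_integral_suminf) measurable
  also have "\<dots> \<le> (\<Sum>i::nat. exp2 (- (real i * ?d)) * (64 * exp2 (of_int k * ?d) * B))"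
  proof (rule suminf_le)
    fix i :: nat
    define l where "l = k - int i"
    have "(\<integral>\<^sup>+\<xi>. indicator (annulus l) \<xi> * f \<xi> \<partial>lborel) \<le> 64 * exp2 (of_int l * dual_dim p) * ann p l f"
      by (rule bernstein[OF f p])
    also have "\<dots> = 64 * exp2 (of_int l * ?d) * (exp2 (of_int l * s) * ann p l f)"
    proof -
      have "exp2 (of_int l * dual_dim p) = exp2 (of_int l * ?d) * exp2 (of_int l * s)"
        unfolding exp2_add[symmetric] by (simp add: algebra_simps)
      then show ?thesis by (simp only: mult.assoc)
    qed
    also have "\<dots> \<le> 64 * exp2 (of_int l * ?d) * B"
      by (intro mult_left_mono B) auto
    also have "exp2 (of_int l * ?d) = exp2 (- (real i * ?d)) * exp2 (of_int k * ?d)"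
    proof -
      have "(of_int k - real i) * c = - (real i * c) + of_int k * c" for c by (simp add: left_diff_distrib)
      then show ?thesis unfolding exp2_add[symmetric] l_def of_int_diff of_int_of_nat_eq by (simp only:)
    qed
    finally show "(\<integral>\<^sup>+\<xi>. indicator (annulus (k - int i)) \<xi> * f \<xi> \<partial>lborel) \<le> exp2 (- (real i * ?d)) * (64 * exp2 (of_int k * ?d) * B)"
      by (simp add: l_def mult_ac)
  qed auto
  also have "\<dots> = ennreal (1 / (1 - 2 powr (-?d))) * (64 * exp2 (of_int k * ?d) * B)"
    unfolding ennreal_suminf_multc suminf_exp2[OF \<delta>] ..
  also have "\<dots> = ennreal (64 / (1 - 2 powr (-?d))) * exp2 (of_int k * ?d) * B"
  proof -
    have "ennreal (64 / (1 - 2 powr (-?d))) = ennreal (1 / (1 - 2 powr (-?d))) * 64"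
      using \<delta> by (simp add: ennreal_mult''[symmetric] flip: ennreal_numeral)
    then show ?thesis by (simp add: mult_ac)
  qed
  finally show ?thesis .
qed

section \<open>The product estimate\<close>

lemma lborel_eq_distr_reflect: "lborel = distr lborel borel (\<lambda>x. c - x :: 'a::euclidean_space)"
  using lborel_affine[of "-1" c] by (simp add: density_1)

lemma lborel_eq_distr_translate: "lborel = distr lborel borel (\<lambda>x. x - c :: 'a::euclidean_space)"
  using lborel_affine[of "1" "-c"] by (simp add: density_1)

lemma Lp_norm_translate_le:
  assumes [measurable]: "f \<in> borel_measurable borel" and p: "1 \<le> p"
  shows "Lp_norm p lborel (\<lambda>x. f (x - c :: 'a::euclidean_space)) \<le> Lp_norm p lborel f"
proof (cases "p = top")
  case True
  have "AE x in distr lborel borel (\<lambda>x. x - c). f x \<le> esssup lborel f"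
    unfolding lborel_eq_distr_translate[symmetric] by (rule esssup_AE)
  then have "AE x in lborel. f (x - c) \<le> esssup lborel f"
    by (subst (asm) AE_distr_iff) auto
  then show ?thesis using True by (auto simp: Lp_norm_top intro!: esssup_I)
next
  case False
  have "(\<integral>\<^sup>+x. ennreal_powr (f x) r \<partial>distr lborel borel (\<lambda>x. x - c)) = (\<integral>\<^sup>+x. ennreal_powr (f (x - c)) r \<partial>lborel)" for r
    by (rule nn_integral_distr) measurable
  then show ?thesis using False
    by (simp add: Lp_norm_def lborel_eq_distr_translate[symmetric])
qed

section \<open>Young's inequality for convolutions\<close>

definition conv :: "(real^3 \<Rightarrow> ennreal) \<Rightarrow> (real^3 \<Rightarrow> ennreal) \<Rightarrow> real^3 \<Rightarrow> ennreal" where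
  "conv g h \<xi> = (\<integral>\<^sup>+\<eta>. g (\<xi> - \<eta>) * h \<eta> \<partial>lborel)"

lemma conv_measurable [measurable]:
  assumes [measurable]: "g \<in> borel_measurable borel" "h \<in> borel_measurable borel"
  shows "conv g h \<in> borel_measurable borel"
  unfolding conv_def by measurable

text \<open>The convolution superposes translates of \<open>g\<close> with weights \<open>h\<close>,
  so Minkowski's inequality and translation invariance suffice.\<close>

lemma young:
  assumes [measurable]: "g \<in> borel_measurable borel" "h \<in> borel_measurable borel" and p: "1 \<le> p"
  shows "Lp_norm p lborel (conv g h) \<le> Lp_norm p lborel g * (\<integral>\<^sup>+\<eta>. h \<eta> \<partial>lborel)"
proof -
  have "Lp_norm p lborel (conv g h) \<le> (\<integral>\<^sup>+\<eta>. h \<eta> * Lp_norm p lborel g \<partial>lborel)"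
    unfolding conv_def
  proof (rule pair_sigma_finite.Lp_norm_nn_integral_le)
    show "pair_sigma_finite (lborel :: (real^3) measure) (lborel :: (real^3) measure)" ..
    have "Lp_norm p lborel (\<lambda>\<xi>. h \<eta> * g (\<xi> - \<eta>)) \<le> h \<eta> * Lp_norm p lborel g" for \<eta>
    proof -
      have "Lp_norm p lborel (\<lambda>\<xi>. h \<eta> * g (\<xi> - \<eta>)) \<le> h \<eta> * Lp_norm p lborel (\<lambda>\<xi>. g (\<xi> - \<eta>))"
        using p by (intro Lp_norm_cmult_le) auto
      also have "\<dots> \<le> h \<eta> * Lp_norm p lborel g"
        using p by (intro mult_left_mono Lp_norm_translate_le) auto
      finally show ?thesis .
    qed
    then show "AE \<eta> in lborel. Lp_norm p lborel (\<lambda>\<xi>. g (\<xi> - \<eta>) * h \<eta>) \<le> h \<eta> * Lp_norm p lborel g"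
      by (simp add: mult.commute)
  qed (use p in auto)
  also have "\<dots> = Lp_norm p lborel g * (\<integral>\<^sup>+\<eta>. h \<eta> \<partial>lborel)"
    by (simp add: nn_integral_multc mult.commute)
  finally show ?thesis .
qed

text \<open>With k = j - 1 + i this is the sum over k \<ge> j - 1 of 2^((j - k)\<sigma>) x(k), a
  discrete convolution with a one-sided geometric kernel.\<close>

definition high_sum :: "real \<Rightarrow> (int \<Rightarrow> ennreal) \<Rightarrow> int \<Rightarrow> ennreal" where
  "high_sum \<sigma> x j = (\<Sum>i::nat. exp2 ((1 - real i) * \<sigma>) * x (j - 1 + int i))"

text \<open>Discrete Young inequality: the triangle inequality over \<open>i\<close>, shift
  invariance of each term, and a geometric series whose first term is 2^\<sigma>.\<close>

lemma ell_high_sum_le: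
  assumes q: "1 \<le> q" and \<sigma>: "\<sigma> > 0"
  shows "ell q (high_sum \<sigma> x) \<le> ennreal (2 powr \<sigma> / (1 - 2 powr (-\<sigma>))) * ell q x"
proof -
  have "ell q (high_sum \<sigma> x) \<le> (\<Sum>i::nat. ell q (\<lambda>j. exp2 ((1 - real i) * \<sigma>) * x (j - 1 + int i)))"
    unfolding high_sum_def using q by (intro ell_suminf_le)
  also have "\<dots> \<le> (\<Sum>i::nat. exp2 ((1 - real i) * \<sigma>) * ell q x)"
  proof (rule suminf_le)
    fix i :: nat
    have "ell q (\<lambda>j. exp2 ((1 - real i) * \<sigma>) * x (j - 1 + int i)) \<le> exp2 ((1 - real i) * \<sigma>) * ell q (\<lambda>j. x (j - 1 + int i))"
      using q by (rule ell_cmult_le)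
    also have "ell q (\<lambda>j. x (j - 1 + int i)) = ell q x"
      using ell_shift[of q x "int i - 1"] by (simp add: algebra_simps)
    finally show "ell q (\<lambda>j. exp2 ((1 - real i) * \<sigma>) * x (j - 1 + int i)) \<le> exp2 ((1 - real i) * \<sigma>) * ell q x" .
  qed auto
  also have "\<dots> = (\<Sum>i::nat. exp2 \<sigma> * exp2 (- (real i * \<sigma>))) * ell q x"
    by (simp add: left_diff_distrib flip: exp2_add)
  also have "(\<Sum>i::nat. exp2 \<sigma> * exp2 (- (real i * \<sigma>))) = ennreal (2 powr \<sigma> / (1 - 2 powr (-\<sigma>)))"
    unfolding ennreal_suminf_cmult suminf_exp2[OF \<sigma>] unfolding exp2_def
    using \<sigma> by (subst ennreal_mult'[symmetric]) auto
  finally show ?thesis .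
qed

text \<open>
  The half \<open>\<bar>\<eta>\<bar> \<le> \<bar>\<xi> - \<eta>\<bar>\<close> of the convolution. For \<open>\<xi>\<close> in the annulus \<open>j\<close> the factor \<open>g\<close> is then evaluated
  in an annulus \<open>k \<ge> j - 1\<close> and \<open>h\<close> at frequencies below \<open>2\<^bsup>k+1\<^esup>\<close>, whose \<open>L\<^sup>1\<close> norm is controlled since
  \<open>s < 3(1 - 1/p)\<close>. The sum over \<open>k\<close> is harmless for \<open>2s > 3(1 - 1/p)\<close>.
\<close>

lemma product_half:
  assumes [measurable]: "g \<in> borel_measurable borel" "h \<in> borel_measurable borel"
    and p: "1 \<le> p" and \<delta>: "0 < dual_dim p - s"
    and x: "\<And>k. exp2 (of_int k * s) * ann p k g \<le> x k"
    and B: "\<And>l. exp2 (of_int l * s) * ann p l h \<le> B"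
  shows "exp2 (of_int j * (2 * s - dual_dim p)) *
      ann p j (\<lambda>\<xi>. \<integral>\<^sup>+\<eta>. indicator {\<eta>. norm \<eta> \<le> norm (\<xi> - \<eta>)} \<eta> * (g (\<xi> - \<eta>) * h \<eta>) \<partial>lborel)
    \<le> ennreal (64 / (1 - 2 powr (-(dual_dim p - s)))) * (B * high_sum (2 * s - dual_dim p) x j)"
    (is "?E * ann p j ?f \<le> ?c * _")
proof -
  let ?d = "dual_dim p"
  define gi where "gi i = (\<lambda>\<xi>. indicator (annulus (j - 1 + int i)) \<xi> * g \<xi>)" for i :: nat
  define hi where "hi i = (\<lambda>\<xi>. indicator {\<xi>. norm \<xi> < 2 powr (of_int (j - 1 + int i) + 1)} \<xi> * h \<xi>)" for i :: nat
  have [measurable]: "gi i \<in> borel_measurable borel" "hi i \<in> borel_measurable borel" for i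
    by (simp_all add: gi_def hi_def)
  have le: "?f \<xi> \<le> (\<Sum>i. conv (gi i) (hi i) \<xi>)" if \<xi>: "\<xi> \<in> annulus j" for \<xi>
  proof -
    have "indicator {\<eta>. norm \<eta> \<le> norm (\<xi> - \<eta>)} \<eta> * (g (\<xi> - \<eta>) * h \<eta>) \<le> (\<Sum>i. gi i (\<xi> - \<eta>) * hi i \<eta>)" for \<eta>
    proof (cases "norm \<eta> \<le> norm (\<xi> - \<eta>)")
      case True
      have "norm \<xi> \<le> norm (\<xi> - \<eta>) + norm \<eta>"
        using norm_triangle_ineq[of "\<xi> - \<eta>" \<eta>] by simp
      with True have *: "norm \<xi> \<le> 2 * norm (\<xi> - \<eta>)" by simp
      have pos: "2 powr (of_int j) \<le> norm \<xi>" "0 < (2::real) powr (of_int j)"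
        using \<xi> by (simp_all add: annulus_def)
      then have "\<xi> - \<eta> \<noteq> 0" using * by auto
      then obtain k where k: "\<xi> - \<eta> \<in> annulus k" using ex_annulus by blast
      then have k': "norm (\<xi> - \<eta>) < 2 powr (of_int k + 1)" by (simp add: annulus_def)
      \<comment> \<open>From 2^j \<le> |\<xi>| \<le> 2|\<xi> - \<eta>| < 2^(k+2) one only gets k
        \<ge> j - 1, which is why the sum over annuli starts one index below
        \<open>j\<close>.\<close>
      have "2 powr (of_int j) < 2 * 2 powr (of_int k + 1 :: real)"
        using pos * k' by linarith
      also have "\<dots> = 2 powr (of_int k + 2)" by (simp add: powr_add)
      finally have "real_of_int j < of_int k + 2" by simp
      then have "j - 1 \<le> k" by linarith
      then have k_eq: "k = j - 1 + int (nat (k - (j - 1)))" by simp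
      let ?i = "nat (k - (j - 1))"
      have "g (\<xi> - \<eta>) * h \<eta> = gi ?i (\<xi> - \<eta>) * hi ?i \<eta>"
        using k k' True k_eq by (simp add: gi_def hi_def)
      also have "\<dots> \<le> (\<Sum>i. gi i (\<xi> - \<eta>) * hi i \<eta>)"
        by (rule ennreal_le_suminf)
      finally show ?thesis by (simp add: True)
    qed simp
    then have "?f \<xi> \<le> (\<integral>\<^sup>+\<eta>. (\<Sum>i. gi i (\<xi> - \<eta>) * hi i \<eta>) \<partial>lborel)"
      by (intro nn_integral_mono) auto
    also have "\<dots> = (\<Sum>i. conv (gi i) (hi i) \<xi>)"
      unfolding conv_def by (rule nn_integral_suminf) measurable
    finally show ?thesis .
  qed
  have "ann p j ?f \<le> ann p j (\<lambda>\<xi>. \<Sum>i. conv (gi i) (hi i) \<xi>)"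
    using p le by (intro ann_mono_AE) auto
  also have "\<dots> \<le> (\<Sum>i. ann p j (conv (gi i) (hi i)))"
    using p by (intro ann_suminf_le) auto
  also have "\<dots> \<le> (\<Sum>i. ann p (j - 1 + int i) g * (?c * exp2 (of_int (j - 1 + int i) * (?d - s)) * B))"
  proof (rule suminf_le)
    fix i
    have "ann p j (conv (gi i) (hi i)) \<le> Lp_norm p lborel (conv (gi i) (hi i))"
      using p by (intro ann_le_Lp_norm) auto
    also have "\<dots> \<le> Lp_norm p lborel (gi i) * (\<integral>\<^sup>+\<eta>. hi i \<eta> \<partial>lborel)"
      using p by (intro young) auto
    also have "Lp_norm p lborel (gi i) = ann p (j - 1 + int i) g"
      by (simp add: gi_def ann_def)
    also have "(\<integral>\<^sup>+\<eta>. hi i \<eta> \<partial>lborel) \<le> ?c * exp2 (of_int (j - 1 + int i) * (?d - s)) * B"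
      unfolding hi_def by (rule low_frequency[OF _ p \<delta> B]) simp
    finally show "ann p j (conv (gi i) (hi i)) \<le> ann p (j - 1 + int i) g * (?c * exp2 (of_int (j - 1 + int i) * (?d - s)) * B)"
      by (simp add: mult_left_mono)
  qed auto
  finally have "?E * ann p j ?f \<le> ?E * (\<Sum>i. ann p (j - 1 + int i) g * (?c * exp2 (of_int (j - 1 + int i) * (?d - s)) * B))"
    by (rule mult_left_mono) simp
  also have "\<dots> = (\<Sum>i. ?E * (ann p (j - 1 + int i) g * (?c * exp2 (of_int (j - 1 + int i) * (?d - s)) * B)))"
    by simp
  also have "\<dots> \<le> (\<Sum>i. ?c * B * (exp2 ((1 - real i) * (2 * s - ?d)) * x (j - 1 + int i)))"
  proof (rule suminf_le)
    fix i
    define k where "k = j - 1 + int i"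
    have "?E * (ann p k g * (?c * exp2 (of_int k * (?d - s)) * B)) = ?c * B * ((?E * exp2 (of_int k * (?d - s))) * ann p k g)"
      by (simp only: mult_ac)
    \<comment> \<open>The balance of exponents, with d = \<open>dual_dim p\<close>: j(2s - d) + k(d
      - s) = (j - k)(2s - d) + ks. The part ks is the weight of \<open>g\<close>, the rest is the
      kernel of \<open>high_sum\<close>.\<close>
    also have "?E * exp2 (of_int k * (?d - s)) = exp2 ((1 - real i) * (2 * s - ?d)) * exp2 (of_int k * s)"
    proof -
      have j: "real_of_int j = of_int k + 1 - real i" by (simp add: k_def)
      have "(K + 1 - I) * (2 * s - D) + K * (D - s) = (1 - I) * (2 * s - D) + K * s" for K I D :: real
        by (simp add: algebra_simps)
      then show ?thesis unfolding exp2_add[symmetric] j by (simp only:)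
    qed
    also have "?c * B * (exp2 ((1 - real i) * (2 * s - ?d)) * exp2 (of_int k * s) * ann p k g)
        \<le> ?c * B * (exp2 ((1 - real i) * (2 * s - ?d)) * x k)"
      unfolding mult.assoc by (intro mult_left_mono x) auto
    finally show "?E * (ann p (j - 1 + int i) g * (?c * exp2 (of_int (j - 1 + int i) * (?d - s)) * B))
        \<le> ?c * B * (exp2 ((1 - real i) * (2 * s - ?d)) * x (j - 1 + int i))"
      unfolding k_def .
  qed auto
  also have "\<dots> = ?c * (B * high_sum (2 * s - ?d) x j)"
    by (simp add: high_sum_def mult.assoc)
  finally show ?thesis .
qed

text \<open>The bounds of \<open>product_half\<close> for the two halves of a convolution. In each
  half one factor enters only through its \<open>ell\<close> norm and the other through its
  individual shells.\<close>

definition para :: "ennreal \<Rightarrow> real \<Rightarrow> ennreal \<Rightarrow> (int \<Rightarrow> ennreal) \<Rightarrow> (int \<Rightarrow> ennreal) \<Rightarrow> int \<Rightarrow> ennreal" where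
  "para p s q x y j = ennreal (64 / (1 - 2 powr (-(dual_dim p - s)))) *
     (ell q y * high_sum (2 * s - dual_dim p) x j + ell q x * high_sum (2 * s - dual_dim p) y j)"

text \<open>Two halves, each with the constant of \<open>low_frequency\<close> and the norm of the
  kernel in \<open>high_sum\<close>.\<close>

definition para_const :: "ennreal \<Rightarrow> real \<Rightarrow> real" where
  "para_const p s = 2 * (64 / (1 - 2 powr (-(dual_dim p - s)))) *
     (2 powr (2 * s - dual_dim p) / (1 - 2 powr (-(2 * s - dual_dim p))))"

lemma para_const_pos:
  assumes "0 < dual_dim p - s" "0 < 2 * s - dual_dim p"
  shows "0 < para_const p s"
proof -
  have "2 powr (-(dual_dim p - s)) < 1" "2 powr (-(2 * s - dual_dim p)) < 1"
    using assms by (simp_all add: powr_less_one)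
  then show ?thesis unfolding para_const_def by (intro mult_pos_pos divide_pos_pos) auto
qed

lemma ell_para_le:
  assumes q: "1 \<le> q" and \<delta>: "0 < dual_dim p - s" and \<sigma>: "0 < 2 * s - dual_dim p"
  shows "ell q (para p s q x y) \<le> ennreal (para_const p s) * (ell q x * ell q y)"
proof -
  let ?\<sigma> = "2 * s - dual_dim p"
  let ?c = "64 / (1 - 2 powr (-(dual_dim p - s)))" and ?C = "2 powr ?\<sigma> / (1 - 2 powr (-?\<sigma>))"
  have lt1: "2 powr (-(dual_dim p - s)) < 1" "2 powr (-?\<sigma>) < 1"
    using \<delta> \<sigma> by (simp_all add: powr_less_one)
  have *: "ell q (\<lambda>j. ell q y * high_sum ?\<sigma> x j) \<le> ennreal ?C * (ell q x * ell q y)" for x y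
  proof -
    have "ell q (\<lambda>j. ell q y * high_sum ?\<sigma> x j) \<le> ell q y * (ennreal ?C * ell q x)"
      by (intro order_trans[OF ell_cmult_le[OF q]] mult_left_mono ell_high_sum_le q \<sigma>) simp
    then show ?thesis by (simp add: mult_ac)
  qed
  have "ell q (para p s q x y) \<le> ennreal ?c * (ell q (\<lambda>j. ell q y * high_sum ?\<sigma> x j) + ell q (\<lambda>j. ell q x * high_sum ?\<sigma> y j))"
    unfolding para_def by (intro order_trans[OF ell_cmult_le[OF q]] mult_left_mono ell_add_le q) simp
  also have "\<dots> \<le> ennreal ?c * (ennreal ?C * (ell q x * ell q y) + ennreal ?C * (ell q y * ell q x))"
    by (intro mult_left_mono add_mono *) simp
  also have "\<dots> = 2 * ennreal ?c * ennreal ?C * (ell q x * ell q y)"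
    by (simp add: mult_ac mult_2[symmetric] del: mult_2)
  also have "2 * ennreal ?c * ennreal ?C = ennreal (para_const p s)"
  proof -
    have "2 * ennreal a * ennreal b = ennreal (2 * a * b)" if "a \<ge> 0" "b \<ge> 0" for a b
      using that by (simp add: ennreal_mult)
    then show ?thesis unfolding para_const_def
      using lt1 by (simp only: divide_nonneg_pos diff_gt_0_iff_gt powr_ge_zero zero_le_numeral)
  qed
  finally show ?thesis .
qed

lemma para_finite:
  assumes "1 \<le> q" "0 < dual_dim p - s" "0 < 2 * s - dual_dim p" "ell q x < top" "ell q y < top"
  shows "para p s q x y j < top"
proof -
  have "para p s q x y j \<le> ennreal (para_const p s) * (ell q x * ell q y)"
    using assms by (intro order_trans[OF le_ell ell_para_le])
  also have "\<dots> < top" using assms by (simp add: ennreal_mult_less_top)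
  finally show ?thesis .
qed

text \<open>Split the convolution according to which of |\<eta>| and |\<xi> - \<eta>| is larger. The
  reflection of \<eta> into \<xi> - \<eta> exchanges the two factors, so \<open>product_half\<close>
  covers both parts.\<close>

lemma product_estimate:
  assumes [measurable]: "g \<in> borel_measurable borel" "h \<in> borel_measurable borel"
    and p: "1 \<le> p" and q: "1 \<le> q" and \<delta>: "0 < dual_dim p - s"
    and x: "\<And>k. exp2 (of_int k * s) * ann p k g \<le> x k"
    and y: "\<And>k. exp2 (of_int k * s) * ann p k h \<le> y k"
  shows "exp2 (of_int j * (2 * s - dual_dim p)) * ann p j (conv g h)
    \<le> para p s q x y j"
proof -
  let ?c = "ennreal (64 / (1 - 2 powr (-(dual_dim p - s))))" and ?\<sigma> = "2 * s - dual_dim p"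
  let ?F = "\<lambda>g h \<xi>. \<integral>\<^sup>+\<eta>. indicator {\<eta>. norm \<eta> \<le> norm (\<xi> - \<eta>)} \<eta> * (g (\<xi> - \<eta>) * h \<eta>) \<partial>(lborel :: (real^3) measure)"
  have "conv g h \<xi> \<le> ?F g h \<xi> + ?F h g \<xi>" for \<xi>
  proof -
    have "conv g h \<xi> \<le> (\<integral>\<^sup>+\<eta>. indicator {\<eta>. norm \<eta> \<le> norm (\<xi> - \<eta>)} \<eta> * (g (\<xi> - \<eta>) * h \<eta>)
        + indicator {\<eta>. norm (\<xi> - \<eta>) \<le> norm \<eta>} \<eta> * (h \<eta> * g (\<xi> - \<eta>)) \<partial>lborel)"
      unfolding conv_def by (intro nn_integral_mono) (auto simp: indicator_def mult.commute)
    also have "\<dots> = ?F g h \<xi> + (\<integral>\<^sup>+\<eta>. indicator {\<eta>. norm (\<xi> - \<eta>) \<le> norm \<eta>} \<eta> * (h \<eta> * g (\<xi> - \<eta>)) \<partial>lborel)"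
      by (rule nn_integral_add) measurable
    also have "(\<integral>\<^sup>+\<eta>. indicator {\<eta>. norm (\<xi> - \<eta>) \<le> norm \<eta>} \<eta> * (h \<eta> * g (\<xi> - \<eta>)) \<partial>lborel)
      = (\<integral>\<^sup>+\<eta>. indicator {\<eta>. norm (\<xi> - \<eta>) \<le> norm \<eta>} \<eta> * (h \<eta> * g (\<xi> - \<eta>)) \<partial>distr lborel borel (\<lambda>\<eta>. \<xi> - \<eta>))"
      by (simp add: lborel_eq_distr_reflect[symmetric])
    also have "\<dots> = ?F h g \<xi>"
      by (subst nn_integral_distr) (auto simp: indicator_def)
    finally show ?thesis .
  qed
  then have "ann p j (conv g h) \<le> ann p j (\<lambda>\<xi>. ?F g h \<xi> + ?F h g \<xi>)"
    using p by (intro ann_mono_AE) auto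
  also have "\<dots> \<le> ann p j (?F g h) + ann p j (?F h g)"
    using p by (intro ann_add_le) measurable
  finally have "exp2 (of_int j * ?\<sigma>) * ann p j (conv g h)
    \<le> exp2 (of_int j * ?\<sigma>) * ann p j (?F g h) + exp2 (of_int j * ?\<sigma>) * ann p j (?F h g)"
    by (simp add: mult_left_mono flip: distrib_left)
  also have "\<dots> \<le> ?c * (ell q y * high_sum ?\<sigma> x j)
      + ?c * (ell q x * high_sum ?\<sigma> y j)"
    by (intro add_mono product_half p \<delta> x y order_trans[OF x le_ell[OF q]] order_trans[OF y le_ell[OF q]]) auto
  finally show ?thesis by (simp add: para_def distrib_left)
qed

section \<open>Fourier-Besov norms on annuli\<close>

lemma norm_smult: "norm (c *s v) = norm c * norm (v :: complex^'n)"
  by (simp add: norm_vec_def norm_mult L2_set_right_distrib)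

lemma measurable_smult [measurable]:
  assumes [measurable]: "f \<in> borel_measurable M" "g \<in> borel_measurable M"
  shows "(\<lambda>x. f x *s g x :: complex^3) \<in> borel_measurable M"
proof -
  have "continuous_on UNIV (\<lambda>(c, v :: complex^3). c *s v)"
    unfolding vector_scalar_mult_def case_prod_beta
    by (intro continuous_intros continuous_on_vec_lambda continuous_on_component)
  then have "(\<lambda>(c, v :: complex^3). c *s v) \<in> borel_measurable borel"
    by (rule borel_measurable_continuous_onI)
  then have "(\<lambda>x. (\<lambda>(c, v :: complex^3). c *s v) (f x, g x)) \<in> borel_measurable M"
    by (rule measurable_compose[rotated]) (simp add: borel_prod[symmetric])
  then show ?thesis by simp
qed

text \<open>Kept as a sequence, so that bounds uniform in time can be stated entrywise before
  \<open>ell q\<close> is applied.\<close>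

definition FB_seq :: "real \<Rightarrow> ennreal \<Rightarrow> (real^3 \<Rightarrow> complex^3) \<Rightarrow> int \<Rightarrow> ennreal" where
  "FB_seq s p g j = exp2 (of_int j * s) * ann p j (\<lambda>\<xi>. ennreal (norm (g \<xi>)))"

text \<open>Passing between smooth cutoffs and annuli couples each index with its two neighbours.
  Moving the weight by one index costs at most 2^|s|.\<close>

lemma ell_neighbours_le:
  assumes q: "1 \<le> q"
  shows "ell q (\<lambda>j. exp2 (of_int j * s) * (d (j - 1) + d j + d (j + 1)))
    \<le> 3 * exp2 \<bar>s\<bar> * ell q (\<lambda>j. exp2 (of_int j * s) * d j)"
proof -
  let ?d = "\<lambda>j. exp2 (of_int j * s) * d j"
  have *: "ell q (\<lambda>j. exp2 (of_int j * s) * d (j + i)) \<le> exp2 \<bar>s\<bar> * ell q ?d" if "\<bar>i\<bar> \<le> 1" for i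
  proof -
    have "\<bar>real_of_int i\<bar> \<le> 1" using that by linarith
    then have "\<bar>of_int i * s\<bar> \<le> 1 * \<bar>s\<bar>"
      unfolding abs_mult by (intro mult_right_mono) auto
    then have "exp2 (- of_int i * s) \<le> exp2 \<bar>s\<bar>"
      by (intro exp2_mono) auto
    moreover have "exp2 (of_int j * s) * d (j + i) = exp2 (- of_int i * s) * ?d (j + i)" for j
      by (simp add: algebra_simps flip: mult.assoc exp2_add)
    ultimately have "ell q (\<lambda>j. exp2 (of_int j * s) * d (j + i)) \<le> ell q (\<lambda>j. exp2 \<bar>s\<bar> * ?d (j + i))"
      by (auto intro!: ell_mono q mult_right_mono simp only: zero_le)
    also have "\<dots> \<le> exp2 \<bar>s\<bar> * ell q (\<lambda>j. ?d (j + i))"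
      by (rule ell_cmult_le[OF q])
    finally show ?thesis
      using ell_shift[of q ?d i] by simp
  qed
  have "ell q (\<lambda>j. exp2 (of_int j * s) * (d (j - 1) + d j + d (j + 1))) \<le>
      ell q (\<lambda>j. exp2 (of_int j * s) * d (j + -1) + exp2 (of_int j * s) * d (j + 0))
      + ell q (\<lambda>j. exp2 (of_int j * s) * d (j + 1))"
    using ell_add_le[OF q] by (simp add: distrib_left)
  also have "\<dots> \<le> ell q (\<lambda>j. exp2 (of_int j * s) * d (j + -1)) + ell q (\<lambda>j. exp2 (of_int j * s) * d (j + 0))
      + ell q (\<lambda>j. exp2 (of_int j * s) * d (j + 1))"
    by (intro add_mono ell_add_le[OF q]) simp
  also have "\<dots> \<le> exp2 \<bar>s\<bar> * ell q ?d + exp2 \<bar>s\<bar> * ell q ?d + exp2 \<bar>s\<bar> * ell q ?d"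
    by (intro add_mono *) auto
  also have "\<dots> = 3 * exp2 \<bar>s\<bar> * ell q ?d"
  proof -
    have "(3::ennreal) = 1 + 1 + 1" by simp
    then show ?thesis by (simp only: mult.assoc distrib_right mult_1)
  qed
  finally show ?thesis .
qed

lemma powi_eq_powr: "(2::real) powi k = 2 powr (of_int k)"
  by (simp add: powr_real_of_int')

section \<open>Comparison of the smooth cutoffs with the annuli\<close>

context
  fixes \<phi> assumes \<phi>: "dyadic_partition \<phi>"
begin

lemma cutoff_measurable [measurable]: "\<phi> \<in> borel_measurable borel"
proof -
  have "iter_partial [] \<phi> differentiable (at x)" for x
    using \<phi> unfolding dyadic_partition_def schwartz_def smooth_def by blast
  then have "continuous_on UNIV \<phi>"
    by (auto intro!: continuous_at_imp_continuous_on differentiable_imp_continuous_within)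
  then show ?thesis by (rule borel_measurable_continuous_onI)
qed

lemma cutoff_bounded: "\<exists>M>0. \<forall>\<xi>. norm (\<phi> \<xi>) \<le> M"
proof -
  have "\<exists>C. \<forall>x. (1 + norm x) ^ 0 * norm (iter_partial [] \<phi> x) \<le> C"
    using \<phi> unfolding dyadic_partition_def schwartz_def by blast
  then obtain C where "\<forall>x. norm (\<phi> x) \<le> C" by auto
  then have "0 < \<bar>C\<bar> + 1" "norm (\<phi> x) \<le> \<bar>C\<bar> + 1" for x
    by (auto intro: order_trans[of _ C])
  then show ?thesis by blast
qed

text \<open>The bounds 3/4 and 8/3 of the support give 2^k < 4 * 2^j and 2^j < 4 * 2^k, hence |j -
  k| < 2.\<close>

lemma cutoff_support:
  assumes \<xi>: "\<xi> \<in> annulus j" and nz: "\<phi> ((2 powi (- k)) *\<^sub>R \<xi>) \<noteq> 0"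
  shows "k \<in> {j - 1, j, j + 1}"
proof -
  have "3/4 \<le> norm ((2 powi (- k)) *\<^sub>R \<xi>)" "norm ((2 powi (- k)) *\<^sub>R \<xi>) \<le> 8/3"
    using \<phi> nz unfolding dyadic_partition_def by blast+
  then have "3/4 * 2 powr (of_int k) \<le> norm \<xi>" "norm \<xi> \<le> 8/3 * 2 powr (of_int k)"
    by (simp_all add: powi_eq_powr powr_minus field_simps)
  moreover have "2 powr (of_int j) \<le> norm \<xi>" "norm \<xi> < 2 powr (of_int j) * 2"
    using \<xi> by (simp_all add: annulus_def powr_add)
  moreover have "(0::real) < 2 powr (of_int k)" "(0::real) < 2 powr (of_int j)" by auto
  ultimately have "2 powr (of_int k) < (4 * 2 powr (of_int j) :: real)" "2 powr (of_int j) < (4 * 2 powr (of_int k) :: real)"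
    by linarith+
  moreover have "(4 * 2 powr (of_int j) :: real) = 2 powr (of_int j + 2)" "(4 * 2 powr (of_int k) :: real) = 2 powr (of_int k + 2)"
    by (simp_all add: powr_add)
  ultimately have "2 powr (of_int k) < (2 powr (of_int j + 2) :: real)" "2 powr (of_int j) < (2 powr (of_int k + 2) :: real)"
    by simp_all
  then have "real_of_int k < of_int j + 2" "real_of_int j < of_int k + 2"
    by simp_all
  then have "k < j + 2" "j < k + 2" by linarith+
  then show ?thesis by auto
qed

text \<open>On an annulus only three members of the partition of unity can be nonzero, and these
  three add up to 1.\<close>

lemma ann_le_dyadic_norm:
  assumes [measurable]: "g \<in> borel_measurable borel" and p: "1 \<le> p"
  shows "ann p j (\<lambda>\<xi>. ennreal (norm (g \<xi>)))
    \<le> dyadic_norm \<phi> p (j - 1) g + dyadic_norm \<phi> p j g + dyadic_norm \<phi> p (j + 1) g"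
proof -
  let ?f = "\<lambda>k \<xi>. ennreal (norm (\<phi> ((2 powi (- k)) *\<^sub>R \<xi>) *s g \<xi>))"
  have "indicator (annulus j) \<xi> * ennreal (norm (g \<xi>)) \<le> ?f (j - 1) \<xi> + ?f j \<xi> + ?f (j + 1) \<xi>" for \<xi>
  proof (cases "\<xi> \<in> annulus j")
    case True
    have nz: "\<xi> \<noteq> 0"
      using True by (auto simp: annulus_def not_le)
    have "((\<lambda>k::int. \<phi> ((2 powi (- k)) *\<^sub>R \<xi>)) has_sum 1) UNIV"
      using \<phi> nz unfolding dyadic_partition_def by blast
    moreover have "((\<lambda>k::int. \<phi> ((2 powi (- k)) *\<^sub>R \<xi>)) has_sum 1) UNIV \<longleftrightarrow>
        ((\<lambda>k::int. \<phi> ((2 powi (- k)) *\<^sub>R \<xi>)) has_sum 1) {j - 1, j, j + 1}"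
      by (rule has_sum_cong_neutral) (use cutoff_support[OF True] in auto)
    ultimately have "((\<lambda>k::int. \<phi> ((2 powi (- k)) *\<^sub>R \<xi>)) has_sum 1) {j - 1, j, j + 1}"
      by blast
    then have "(\<Sum>k\<in>{j - 1, j, j + 1}. \<phi> ((2 powi (- k)) *\<^sub>R \<xi>)) = 1"
      by (rule has_sum_unique[rotated]) (intro has_sum_finite, simp)
    then have "norm (g \<xi>) = norm (\<Sum>k\<in>{j - 1, j, j + 1}. \<phi> ((2 powi (- k)) *\<^sub>R \<xi>)) * norm (g \<xi>)"
      by simp
    also have "\<dots> \<le> (\<Sum>k\<in>{j - 1, j, j + 1}. norm (\<phi> ((2 powi (- k)) *\<^sub>R \<xi>))) * norm (g \<xi>)"
      by (intro mult_right_mono norm_sum) simp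
    also have "\<dots> = (\<Sum>k\<in>{j - 1, j, j + 1}. norm (\<phi> ((2 powi (- k)) *\<^sub>R \<xi>) *s g \<xi>))"
      unfolding norm_smult sum_distrib_right ..
    finally have "ennreal (norm (g \<xi>)) \<le> ennreal (\<Sum>k\<in>{j - 1, j, j + 1}. norm (\<phi> ((2 powi (- k)) *\<^sub>R \<xi>) *s g \<xi>))"
      by (rule ennreal_leI)
    also have "\<dots> = (\<Sum>k\<in>{j - 1, j, j + 1}. ?f k \<xi>)"
      by (rule sum_ennreal[symmetric]) simp
    finally show ?thesis using True by (simp add: add.assoc)
  qed simp
  then have "ann p j (\<lambda>\<xi>. ennreal (norm (g \<xi>))) \<le> Lp_norm p lborel (\<lambda>\<xi>. ?f (j - 1) \<xi> + ?f j \<xi> + ?f (j + 1) \<xi>)"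
    unfolding ann_def using p by (intro Lp_norm_mono) auto
  also have "\<dots> \<le> Lp_norm p lborel (\<lambda>\<xi>. ?f (j - 1) \<xi> + ?f j \<xi>) + Lp_norm p lborel (?f (j + 1))"
    using p by (intro lborel.Lp_norm_add_le) auto
  also have "\<dots> \<le> Lp_norm p lborel (?f (j - 1)) + Lp_norm p lborel (?f j) + Lp_norm p lborel (?f (j + 1))"
    using p by (intro add_mono lborel.Lp_norm_add_le) auto
  finally show ?thesis by (simp add: dyadic_norm_def)
qed

text \<open>The converse comparison uses only that the cutoff is bounded and that its support meets
  at most three annuli.\<close>

lemma dyadic_norm_le_ann:
  assumes [measurable]: "g \<in> borel_measurable borel" and p: "1 \<le> p" and M: "\<And>\<xi>. norm (\<phi> \<xi>) \<le> M"
  shows "dyadic_norm \<phi> p j g \<le> ennreal M * (ann p (j - 1) (\<lambda>\<xi>. ennreal (norm (g \<xi>)))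
    + ann p j (\<lambda>\<xi>. ennreal (norm (g \<xi>))) + ann p (j + 1) (\<lambda>\<xi>. ennreal (norm (g \<xi>))))"
proof -
  let ?f = "\<lambda>k \<xi>. indicator (annulus k) \<xi> * ennreal (norm (g \<xi>))"
  have M0: "M \<ge> 0" using M[of 0] norm_ge_zero order_trans by blast
  have "AE \<xi> in lborel. (\<xi>::real^3) \<noteq> 0"
    by (rule AE_lborel_singleton)
  then have "AE \<xi> in lborel. ennreal (norm (\<phi> ((2 powi (- j)) *\<^sub>R \<xi>) *s g \<xi>))
      \<le> ennreal M * (?f (j - 1) \<xi> + ?f j \<xi> + ?f (j + 1) \<xi>)"
  proof eventually_elim
    case (elim \<xi>)
    obtain k where k: "\<xi> \<in> annulus k" using ex_annulus[OF elim] by auto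
    show ?case
    proof (cases "\<phi> ((2 powi (- j)) *\<^sub>R \<xi>) = 0")
      case False
      then have "j \<in> {k - 1, k, k + 1}" using cutoff_support[OF k] by auto
      then have "\<xi> \<in> annulus (j - 1) \<or> \<xi> \<in> annulus j \<or> \<xi> \<in> annulus (j + 1)"
        using k by auto
      then have 1: "ennreal (norm (g \<xi>)) \<le> ?f (j - 1) \<xi> + ?f j \<xi> + ?f (j + 1) \<xi>"
        by (auto simp: indicator_def intro: add_increasing add_increasing2)
      have "ennreal (norm (\<phi> ((2 powi (- j)) *\<^sub>R \<xi>) *s g \<xi>)) \<le> ennreal M * ennreal (norm (g \<xi>))"
        using M M0 by (simp add: norm_smult mult_right_mono ennreal_leI flip: ennreal_mult')
      also have "\<dots> \<le> ennreal M * (?f (j - 1) \<xi> + ?f j \<xi> + ?f (j + 1) \<xi>)"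
        by (rule mult_left_mono[OF 1]) simp
      finally show ?thesis .
    qed (simp add: norm_smult)
  qed
  then have "dyadic_norm \<phi> p j g \<le> Lp_norm p lborel (\<lambda>\<xi>. ennreal M * (?f (j - 1) \<xi> + ?f j \<xi> + ?f (j + 1) \<xi>))"
    unfolding dyadic_norm_def using p by (intro Lp_norm_mono_AE) auto
  also have "\<dots> \<le> ennreal M * Lp_norm p lborel (\<lambda>\<xi>. ?f (j - 1) \<xi> + ?f j \<xi> + ?f (j + 1) \<xi>)"
    using p by (intro Lp_norm_cmult_le) auto
  also have "\<dots> \<le> ennreal M * (Lp_norm p lborel (\<lambda>\<xi>. ?f (j - 1) \<xi> + ?f j \<xi>) + Lp_norm p lborel (?f (j + 1)))"
    using p by (intro mult_left_mono lborel.Lp_norm_add_le) auto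
  also have "\<dots> \<le> ennreal M * (Lp_norm p lborel (?f (j - 1)) + Lp_norm p lborel (?f j) + Lp_norm p lborel (?f (j + 1)))"
    using p by (intro mult_left_mono add_mono lborel.Lp_norm_add_le) auto
  finally show ?thesis by (simp add: ann_def)
qed

lemma ell_FB_seq_le:
  assumes [measurable]: "g \<in> borel_measurable borel" and p: "1 \<le> p" and q: "1 \<le> q"
  shows "ell q (FB_seq s p g) \<le> 3 * exp2 \<bar>s\<bar> * FB_norm_ft \<phi> s p q g"
proof -
  have "ell q (FB_seq s p g) \<le> ell q (\<lambda>j. exp2 (of_int j * s) *
      (dyadic_norm \<phi> p (j - 1) g + dyadic_norm \<phi> p j g + dyadic_norm \<phi> p (j + 1) g))"
    unfolding FB_seq_def using p by (intro ell_mono q mult_left_mono ann_le_dyadic_norm) auto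
  also have "\<dots> \<le> 3 * exp2 \<bar>s\<bar> * FB_norm_ft \<phi> s p q g"
    unfolding FB_norm_ft_def exp2_def[symmetric] by (rule ell_neighbours_le[OF q])
  finally show ?thesis .
qed

lemma FB_norm_ft_le_ell:
  assumes [measurable]: "g \<in> borel_measurable borel" and p: "1 \<le> p" and q: "1 \<le> q"
    and M: "\<And>\<xi>. norm (\<phi> \<xi>) \<le> M"
  shows "FB_norm_ft \<phi> s p q g \<le> ennreal M * (3 * exp2 \<bar>s\<bar>) * ell q (FB_seq s p g)"
proof -
  let ?a = "\<lambda>j. ann p j (\<lambda>\<xi>. ennreal (norm (g \<xi>)))"
  have "FB_norm_ft \<phi> s p q g \<le> ell q (\<lambda>j. ennreal M * (exp2 (of_int j * s) * (?a (j - 1) + ?a j + ?a (j + 1))))"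
    unfolding FB_norm_ft_def exp2_def[symmetric] mult.left_commute[of "ennreal M"]
    using p M by (intro ell_mono q mult_left_mono dyadic_norm_le_ann) auto
  also have "\<dots> \<le> ennreal M * ell q (\<lambda>j. exp2 (of_int j * s) * (?a (j - 1) + ?a j + ?a (j + 1)))"
    by (rule ell_cmult_le[OF q])
  also have "\<dots> \<le> ennreal M * (3 * exp2 \<bar>s\<bar> * ell q (\<lambda>j. exp2 (of_int j * s) * ?a j))"
    by (intro mult_left_mono ell_neighbours_le q) simp
  finally show ?thesis by (simp add: FB_seq_def[abs_def] mult.assoc)
qed

text \<open>
  No measurability in time is assumed: \<open>esssup\<close> of a non-measurable function is \<open>\<infinity>\<close>.
\<close>

lemma LFB_dominated:
  assumes g: "\<And>t. t \<ge> 0 \<Longrightarrow> g t \<in> borel_measurable borel" and p: "1 \<le> p" and q: "1 \<le> q"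
  shows "\<exists>m. ell q m \<le> 3 * exp2 \<bar>s\<bar> * LFB_norm_ft \<phi> s p q g \<and>
    (AE t in lebesgue_on {0..}. \<forall>j. FB_seq s p (g t) j \<le> m j)"
proof -
  define d where "d j = esssup (lebesgue_on {0..}) (\<lambda>t. dyadic_norm \<phi> p j (g t))" for j
  define m where "m j = exp2 (of_int j * s) * (d (j - 1) + d j + d (j + 1))" for j
  have "AE t in lebesgue_on {0..}. \<forall>j. dyadic_norm \<phi> p j (g t) \<le> d j"
    unfolding AE_all_countable d_def by (auto intro: esssup_AE)
  then have "AE t in lebesgue_on {0..}. \<forall>j. FB_seq s p (g t) j \<le> m j"
    using AE_space
  proof eventually_elim
    case (elim t)
    then have [measurable]: "g t \<in> borel_measurable borel" using g by auto
    show ?case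
    proof
      fix j
      have "ann p j (\<lambda>\<xi>. ennreal (norm (g t \<xi>))) \<le> d (j - 1) + d j + d (j + 1)"
        using elim(1) by (intro order_trans[OF ann_le_dyadic_norm] add_mono p) auto
      then show "FB_seq s p (g t) j \<le> m j"
        unfolding FB_seq_def m_def by (rule mult_left_mono) simp
    qed
  qed
  moreover have "ell q m \<le> 3 * exp2 \<bar>s\<bar> * LFB_norm_ft \<phi> s p q g"
    unfolding m_def[abs_def] LFB_norm_ft_def exp2_def[symmetric] d_def[symmetric]
    by (rule ell_neighbours_le[OF q])
  ultimately show ?thesis by blast
qed

end

section \<open>Tail bounds uniform in time\<close>

lemma ennreal_tendsto_0I:
  assumes "\<And>e::real. e > 0 \<Longrightarrow> eventually (\<lambda>x. f x \<le> ennreal e) F"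
  shows "(f \<longlongrightarrow> (0::ennreal)) F"
proof (rule order_tendstoI)
  fix a :: ennreal assume "0 < a"
  then obtain b where b: "0 < b" "b < a" using dense by blast
  then obtain e where e: "b = ennreal e" "e > 0" by (cases b) (auto simp: less_top[symmetric] ennreal_eq_0_iff)
  from assms[OF e(2)] show "eventually (\<lambda>x. f x < a) F"
    by eventually_elim (use b e in auto)
qed auto

text \<open>Turns convergence of the norms at single times into one sequence that dominates all late
  times. For finite \<open>q\<close> it consists of the entrywise suprema over late times: each
  entry tends to 0 because it is bounded by the norms, and \<open>m\<close> is the summable
  majorant. For \<open>q = top\<close> a constant sequence does. The set \<open>S\<close> allows for
  a domination that holds only at almost every time.\<close>

lemma ell_tail:
  assumes q: "1 \<le> q" and dom: "\<And>t j. t \<in> S \<Longrightarrow> y t j \<le> m j" and m: "ell q m < top"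
    and lim: "((\<lambda>t. ell q (y t)) \<longlongrightarrow> 0) at_top" and \<delta>: "\<delta> > 0"
  shows "\<exists>T x. ell q x \<le> ennreal \<delta> \<and> (\<forall>t\<in>S. t \<ge> T \<longrightarrow> (\<forall>j. y (t::real) j \<le> x j))"
proof (cases "q = top")
  case True
  have "eventually (\<lambda>t. ell q (y t) < ennreal \<delta>) at_top"
    using \<delta> by (intro order_tendstoD(2)[OF lim]) simp
  then obtain T where T: "\<And>t. t \<ge> T \<Longrightarrow> ell q (y t) < ennreal \<delta>"
    by (auto simp: eventually_at_top_linorder)
  then have "y t j \<le> ennreal \<delta>" if "t \<ge> T" for t j
    using le_ell[OF q, of "y t" j] that by (meson order_le_less_trans less_imp_le)
  moreover have "ell q (\<lambda>_. ennreal \<delta>) \<le> ennreal \<delta>"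
    using True by (simp add: ell_top)
  ultimately show ?thesis by blast
next
  case False
  define r where "r = enn2real q"
  have r: "1 \<le> r" using one_le_enn2real q False by (auto simp: r_def)
  define X where "X n j = (SUP t\<in>{t\<in>S. t \<ge> real n}. y t j)" for n :: nat and j
  have Xm: "X n j \<le> m j" for n j
    unfolding X_def using dom by (intro SUP_least) auto
  have X0: "(\<lambda>n. ennreal_powr (X n j) r) \<longlonglongrightarrow> 0" for j
  proof (rule ennreal_tendsto_0I)
    fix e :: real assume e: "e > 0"
    have "eventually (\<lambda>t. ell q (y t) < ennreal (e powr (1 / r))) at_top"
      using e by (intro order_tendstoD(2)[OF lim]) simp
    then obtain T where T: "\<And>t. t \<ge> T \<Longrightarrow> ell q (y t) < ennreal (e powr (1 / r))"
      by (auto simp: eventually_at_top_linorder)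
    have "ennreal_powr (X n j) r \<le> ennreal e" if n: "n \<ge> nat \<lceil>T\<rceil>" for n
    proof -
      have "T \<le> real n" using n by linarith
      then have "X n j \<le> ennreal (e powr (1 / r))"
        unfolding X_def
        by (intro SUP_least order_trans[OF le_ell[OF q] less_imp_le[OF T]]) auto
      then have "ennreal_powr (X n j) r \<le> ennreal_powr (ennreal (e powr (1 / r))) r"
        using r by (intro ennreal_powr_mono) auto
      also have "\<dots> = ennreal e" using e r by (simp add: ennreal_powr_ennreal powr_powr)
      finally show ?thesis .
    qed
    then show "eventually (\<lambda>n. ennreal_powr (X n j) r \<le> ennreal e) sequentially"
      unfolding eventually_sequentially by blast
  qed
  have "ell q m \<le> ell q m" by simp
  then have "(\<integral>\<^sup>+j. ennreal_powr (m j) r \<partial>count_space UNIV) \<le> ennreal_powr (ell q m) r"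
    unfolding Lp_norm_le_iff[OF q False] r_def .
  also have "\<dots> < top" using m by (simp add: ennreal_powr_def)
  finally have mfin: "(\<integral>\<^sup>+j. ennreal_powr (m j) r \<partial>count_space UNIV) < \<infinity>" by simp
  have "(\<lambda>n. \<integral>\<^sup>+j. ennreal_powr (X n j) r \<partial>count_space UNIV) \<longlonglongrightarrow> (\<integral>\<^sup>+j. 0 \<partial>count_space (UNIV :: int set))"
    using X0 r by (intro nn_integral_dominated_convergence[OF _ _ _ _ mfin]) (auto intro!: ennreal_powr_mono Xm)
  then have "eventually (\<lambda>n. (\<integral>\<^sup>+j. ennreal_powr (X n j) r \<partial>count_space UNIV) < ennreal (\<delta> powr r)) sequentially"
    using \<delta> by (intro order_tendstoD(2)) auto
  then obtain n where "(\<integral>\<^sup>+j. ennreal_powr (X n j) r \<partial>count_space UNIV) < ennreal (\<delta> powr r)"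
    by (auto simp: eventually_sequentially)
  then have "ell q (X n) \<le> ennreal \<delta>"
    unfolding Lp_norm_le_iff[OF q False] using \<delta> by (simp add: r_def ennreal_powr_ennreal)
  moreover have "y t j \<le> X n j" if "t \<in> S" "t \<ge> real n" for t j
    unfolding X_def using that by (intro SUP_upper) auto
  ultimately show ?thesis by blast
qed

section \<open>Time integrals against the heat factor\<close>

lemma nn_integral_exp_decay:
  assumes c: "c > 0" and t: "t \<ge> 0"
  shows "(\<integral>\<^sup>+\<tau>. indicator {0..t} \<tau> * ennreal (exp (- c * (t - \<tau>))) \<partial>lborel) \<le> ennreal (1 / c)"
proof -
  have "(\<integral>\<^sup>+\<tau>. ennreal (exp (- c * (t - \<tau>))) * indicator {0..t} \<tau> \<partial>lborel)
      = ennreal (exp (- c * (t - t)) / c - exp (- c * (t - 0)) / c)"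
    using c t by (intro nn_integral_FTC_Icc) (auto intro!: derivative_eq_intros)
  also have "\<dots> \<le> ennreal (1 / c)"
    using c by (intro ennreal_leI) simp
  finally show ?thesis by (simp add: mult.commute)
qed

text \<open>Since \<theta> \<le> 1/2, the remaining time t - \<tau> is at least t/2, so the integral
  is at most \<theta> t exp(-ct/2). With y = ct/2 this is (2\<theta>/c) y exp(-y), and y exp(-y)
  \<le> 1 gives a bound free of \<open>t\<close>.\<close>

lemma nn_integral_exp_decay_initial:
  assumes c: "c > 0" and t: "t \<ge> 0" and \<theta>: "0 \<le> \<theta>" "\<theta> \<le> 1/2"
  shows "(\<integral>\<^sup>+\<tau>. indicator {0..\<theta> * t} \<tau> * ennreal (exp (- c * (t - \<tau>))) \<partial>lborel) \<le> ennreal (2 * \<theta> / c)"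
proof -
  have "(\<integral>\<^sup>+\<tau>. indicator {0..\<theta> * t} \<tau> * ennreal (exp (- c * (t - \<tau>))) \<partial>lborel)
      \<le> (\<integral>\<^sup>+\<tau>. ennreal (exp (- (c * t / 2))) * indicator {0..\<theta> * t} \<tau> \<partial>lborel)"
  proof (rule nn_integral_mono)
    fix \<tau> :: real
    have "exp (- c * (t - \<tau>)) \<le> exp (- (c * t / 2))" if "\<tau> \<in> {0..\<theta> * t}"
    proof -
      have "\<tau> \<le> \<theta> * t" using that by simp
      also have "\<dots> \<le> 1/2 * t" using \<theta> t by (intro mult_right_mono) auto
      finally have "c * (t / 2) \<le> c * (t - \<tau>)" using c by (intro mult_left_mono) auto
      then show ?thesis by simp
    qed
    then show "indicator {0..\<theta> * t} \<tau> * ennreal (exp (- c * (t - \<tau>))) \<le> ennreal (exp (- (c * t / 2))) * indicator {0..\<theta> * t} \<tau>"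
      by (auto simp: indicator_def intro: ennreal_leI)
  qed
  also have "\<dots> = ennreal (exp (- (c * t / 2)) * (\<theta> * t))"
    using \<theta> t by (simp add: nn_integral_cmult ennreal_mult')
  also have "\<dots> \<le> ennreal (2 * \<theta> / c)"
  proof (rule ennreal_leI)
    have "c * t / 2 \<le> exp (c * t / 2)"
      using exp_ge_add_one_self[of "c * t / 2"] by linarith
    then have "exp (- (c * t / 2)) * (c * t / 2) \<le> 1"
      by (simp add: exp_minus field_simps)
    then have "(2 * \<theta> / c) * (exp (- (c * t / 2)) * (c * t / 2)) \<le> (2 * \<theta> / c) * 1"
      using c \<theta> by (intro mult_left_mono) auto
    then show "exp (- (c * t / 2)) * (\<theta> * t) \<le> 2 * \<theta> / c"
      using c by (simp add: field_simps)
  qed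
  finally show ?thesis .
qed

text \<open>On the annulus \<open>j\<close> the heat factor is dominated by exp(-c(t - \<tau>)) with
  c = \<nu> 2^(2\<alpha>j), so Minkowski's inequality in time leaves scalar integrals of size 1/c.
  The bound \<open>m\<close> holds at all times and gains the small factor 2\<theta>; the better
  bound \<open>x\<close> is available only from \<theta> t on.\<close>

lemma time_estimate:
  assumes f [measurable]: "(\<lambda>(\<tau>, \<xi>). f \<tau> \<xi>) \<in> borel_measurable borel"
    and p: "1 \<le> p" and \<nu>: "\<nu> > 0" and \<alpha>: "\<alpha> > 0" and t: "t \<ge> 0" and \<theta>: "0 \<le> \<theta>" "\<theta> \<le> 1/2"
    and m: "AE \<tau> in lborel. 0 \<le> \<tau> \<and> \<tau> \<le> t \<longrightarrow> ann p j (f \<tau>) \<le> m"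
    and x: "AE \<tau> in lborel. \<theta> * t \<le> \<tau> \<and> \<tau> \<le> t \<longrightarrow> ann p j (f \<tau>) \<le> x"
  shows "ann p j (\<lambda>\<xi>. \<integral>\<^sup>+\<tau>. indicator {0..t} \<tau> * (ennreal (exp (- \<nu> * norm \<xi> powr (2 * \<alpha>) * (t - \<tau>))) * f \<tau> \<xi>) \<partial>lborel)
    \<le> ennreal (1 / \<nu>) * exp2 (- (2 * \<alpha> * of_int j)) * (ennreal (2 * \<theta>) * m + x)"
proof -
  have f' [measurable]: "(\<lambda>(\<xi>, \<tau>). f \<tau> \<xi>) \<in> borel_measurable (borel \<Otimes>\<^sub>M borel)"
    using f by (simp add: borel_prod[symmetric])
  have f1 [measurable]: "f \<tau> \<in> borel_measurable borel" for \<tau>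
    using measurable_compose[OF measurable_Pair1'[of \<tau> borel borel] f[folded borel_prod]] by simp
  define c where "c = \<nu> * 2 powr (2 * \<alpha> * of_int j)"
  have c: "c > 0" using \<nu> by (simp add: c_def)
  let ?e = "\<lambda>\<tau>. ennreal (exp (- c * (t - \<tau>)))"
  let ?g = "\<lambda>\<tau> \<xi>. ennreal (exp (- \<nu> * norm \<xi> powr (2 * \<alpha>) * (t - \<tau>))) * f \<tau> \<xi>"
  \<comment> \<open>The second term is extended to all of [0, t]: this only enlarges the majorant
    and leaves an integral of size 1/c.\<close>
  define l where "l \<tau> = m * (indicator {0..\<theta> * t} \<tau> * ?e \<tau>) + x * (indicator {0..t} \<tau> * ?e \<tau>)" for \<tau>
  have "ann p j (\<lambda>\<xi>. \<integral>\<^sup>+\<tau>. indicator {0..t} \<tau> * ?g \<tau> \<xi> \<partial>lborel)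
      = Lp_norm p lborel (\<lambda>\<xi>. \<integral>\<^sup>+\<tau>. indicator (annulus j) \<xi> * (indicator {0..t} \<tau> * ?g \<tau> \<xi>) \<partial>lborel)"
    unfolding ann_def by (subst nn_integral_cmult) auto
  also have "\<dots> \<le> (\<integral>\<^sup>+\<tau>. l \<tau> \<partial>lborel)"
  proof (rule pair_sigma_finite.Lp_norm_nn_integral_le)
    show "pair_sigma_finite (lborel :: (real^3) measure) (lborel :: real measure)" ..
    show "AE \<tau> in lborel. Lp_norm p lborel (\<lambda>\<xi>. indicator (annulus j) \<xi> * (indicator {0..t} \<tau> * ?g \<tau> \<xi>)) \<le> l \<tau>"
      using m x
    proof eventually_elim
      case (elim \<tau>)
      show ?case
      proof (cases "\<tau> \<in> {0..t}")
        case True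
        have "indicator (annulus j) \<xi> * (indicator {0..t} \<tau> * ?g \<tau> \<xi>) \<le> ?e \<tau> * (indicator (annulus j) \<xi> * f \<tau> \<xi>)" for \<xi>
        proof (cases "\<xi> \<in> annulus j")
          case \<xi>: True
          have "2 powr (2 * \<alpha> * of_int j) = (2 powr of_int j) powr (2 * \<alpha>)"
            by (simp add: powr_powr mult_ac)
          also have "\<dots> \<le> norm \<xi> powr (2 * \<alpha>)"
            using \<xi> \<alpha> by (intro powr_mono2) (auto simp: annulus_def)
          finally have "c * (t - \<tau>) \<le> \<nu> * norm \<xi> powr (2 * \<alpha>) * (t - \<tau>)"
            unfolding c_def using \<nu> True by (intro mult_right_mono mult_left_mono) auto
          then have "exp (- \<nu> * norm \<xi> powr (2 * \<alpha>) * (t - \<tau>)) \<le> exp (- c * (t - \<tau>))" by simp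
          then show ?thesis using \<xi> True by (simp add: mult_right_mono ennreal_leI)
        qed simp
        then have "Lp_norm p lborel (\<lambda>\<xi>. indicator (annulus j) \<xi> * (indicator {0..t} \<tau> * ?g \<tau> \<xi>))
            \<le> Lp_norm p lborel (\<lambda>\<xi>. ?e \<tau> * (indicator (annulus j) \<xi> * f \<tau> \<xi>))"
          using p by (intro Lp_norm_mono) auto
        also have "\<dots> \<le> ?e \<tau> * ann p j (f \<tau>)"
          unfolding ann_def using p by (intro Lp_norm_cmult_le) auto
        also have "\<dots> \<le> l \<tau>"
        proof (cases "\<tau> \<le> \<theta> * t")
          case \<tau>: True
          have "?e \<tau> * ann p j (f \<tau>) \<le> ?e \<tau> * m"
            using elim True by (intro mult_left_mono) auto
          then show ?thesis using True \<tau> by (auto simp: l_def mult.commute intro: add_increasing2)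
        next
          case \<tau>: False
          have "?e \<tau> * ann p j (f \<tau>) \<le> ?e \<tau> * x"
            using elim True \<tau> by (intro mult_left_mono) auto
          then show ?thesis using True \<tau> by (auto simp: l_def mult.commute)
        qed
        finally show ?thesis .
      qed (use p in simp)
    qed
    show "l \<in> borel_measurable lborel" unfolding l_def by measurable
    show "(\<lambda>(\<xi>, \<tau>). indicator (annulus j) \<xi> * (indicator {0..t} \<tau> * ?g \<tau> \<xi>))
        \<in> borel_measurable (lborel \<Otimes>\<^sub>M lborel)"
      by measurable
  qed (rule p)
  also have "\<dots> = m * (\<integral>\<^sup>+\<tau>. indicator {0..\<theta> * t} \<tau> * ?e \<tau> \<partial>lborel) + x * (\<integral>\<^sup>+\<tau>. indicator {0..t} \<tau> * ?e \<tau> \<partial>lborel)"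
    unfolding l_def by (subst nn_integral_add) (auto simp: nn_integral_cmult)
  also have "\<dots> \<le> m * ennreal (2 * \<theta> / c) + x * ennreal (1 / c)"
    by (intro add_mono mult_left_mono nn_integral_exp_decay nn_integral_exp_decay_initial c t \<theta>) auto
  also have "\<dots> = ennreal (1 / \<nu>) * exp2 (- (2 * \<alpha> * of_int j)) * (ennreal (2 * \<theta>) * m + x)"
  proof -
    have "ennreal (1 / c) = ennreal (1 / \<nu>) * exp2 (- (2 * \<alpha> * of_int j))"
      using \<nu> unfolding c_def exp2_def by (subst ennreal_mult'[symmetric]) (auto simp: powr_minus field_simps)
    moreover have "ennreal (2 * \<theta> / c) = ennreal (2 * \<theta>) * ennreal (1 / c)"
      using \<theta> by (subst ennreal_mult'[symmetric]) auto
    ultimately show ?thesis by (simp add: distrib_left distrib_right mult_ac)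
  qed
  finally show ?thesis .
qed

section \<open>Uniqueness of the Fourier transform as a function\<close>

text \<open>
  With the polynomial factor and the power in the denominator the family of these functions is
  closed under differentiation.
\<close>

definition bump_fun :: "real \<Rightarrow> real \<Rightarrow> real \<Rightarrow> real poly \<Rightarrow> nat \<Rightarrow> real \<Rightarrow> real" where
  "bump_fun a b c P k x = (if a < x \<and> x < b
     then poly P x * exp (- c / ((x - a) * (b - x))) / ((x - a) * (b - x)) ^ k else 0)"

text \<open>A single term of the exponential series at c/w is below the whole sum.\<close>

lemma exp_neg_inverse_bound:
  fixes c w :: real
  assumes c: "c > 0" and w: "w > 0"
  shows "exp (- c / w) / w ^ n \<le> fact n / c ^ n"
proof -
  have "(c / w) ^ n / fact n \<le> (\<Sum>k. (c / w) ^ k /\<^sub>R fact k)"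
    using sum_le_suminf[of "\<lambda>k. (c / w) ^ k /\<^sub>R fact k" "{n}"] summable_exp_generic[of "c / w"] c w
    by (simp add: divide_inverse mult.commute)
  then have "(c / w) ^ n / fact n \<le> exp (c / w)"
    by (simp add: exp_def)
  then have "c ^ n \<le> fact n * (w ^ n * exp (c / w))"
    using w by (simp add: power_divide field_simps)
  then have "c ^ n * exp (- (c / w)) \<le> fact n * w ^ n * (exp (c / w) * exp (- (c / w)))"
    by (simp only: mult.assoc[symmetric], intro mult_right_mono) (auto simp: mult_ac)
  also have "exp (c / w) * exp (- (c / w)) = 1" by (simp add: exp_minus_inverse)
  finally show ?thesis using c w by (simp add: field_simps)
qed

text \<open>Flatness at every point outside the open interval, endpoints included. The exponential
  absorbs the power k + 2 of w = (x - a)(b - x), two more than the denominator has, and the spare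
  w^2 is controlled by (x - x0)^2.\<close>

lemma bump_fun_quadratic:
  assumes ab: "a < b" and c: "c > 0" and x0: "x0 \<le> a \<or> b \<le> x0"
  shows "\<exists>C\<ge>0. \<forall>x. \<bar>bump_fun a b c P k x\<bar> \<le> C * (x - x0)\<^sup>2"
proof -
  have "bounded (poly P ` {a..b})"
    by (intro compact_imp_bounded compact_continuous_image continuous_intros) auto
  then obtain M where M: "M > 0" "\<And>x. x \<in> {a..b} \<Longrightarrow> \<bar>poly P x\<bar> \<le> M"
    by (auto simp: bounded_pos)
  define C where "C = M * (fact (k + 2) / c ^ (k + 2)) * (b - a)\<^sup>2"
  have C: "C \<ge> 0" using M c by (simp add: C_def)
  have "\<bar>bump_fun a b c P k x\<bar> \<le> C * (x - x0)\<^sup>2" for x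
  proof (cases "a < x \<and> x < b")
    case True
    define w where "w = (x - a) * (b - x)"
    have w: "w > 0" using True by (simp add: w_def)
    have "w \<le> (b - a) * \<bar>x - x0\<bar>"
      using x0
    proof
      assume "x0 \<le> a"
      then have "(b - x) * (x - a) \<le> (b - a) * \<bar>x - x0\<bar>"
        using True by (intro mult_mono) auto
      then show ?thesis by (simp add: w_def mult.commute)
    next
      assume "b \<le> x0"
      then show ?thesis
        using True unfolding w_def by (intro mult_mono) auto
    qed
    then have "w ^ 2 \<le> ((b - a) * \<bar>x - x0\<bar>) ^ 2"
      using w by (intro power_mono) auto
    then have w2: "w ^ 2 \<le> (b - a)\<^sup>2 * (x - x0)\<^sup>2" by (simp add: power_mult_distrib)
    have "\<bar>bump_fun a b c P k x\<bar> = \<bar>poly P x\<bar> * (exp (- c / w) / w ^ (k + 2)) * w ^ 2"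
      using True w by (simp add: bump_fun_def w_def[symmetric] abs_mult power_add power2_eq_square)
    also have "\<dots> \<le> M * (fact (k + 2) / c ^ (k + 2)) * ((b - a)\<^sup>2 * (x - x0)\<^sup>2)"
      using M True exp_neg_inverse_bound[OF c w, of "k + 2"] w w2 c
      by (intro mult_mono) auto
    finally show ?thesis by (simp add: C_def mult_ac)
  next
    case False
    then show ?thesis using C by (auto simp: bump_fun_def)
  qed
  with C show ?thesis by blast
qed

lemma has_real_derivative_quadratic:
  assumes "C \<ge> 0" "\<And>x. \<bar>f x\<bar> \<le> C * (x - x0)\<^sup>2"
  shows "(f has_real_derivative 0) (at x0)"
proof -
  have f0: "f x0 = 0" using assms(2)[of x0] by simp
  have "((\<lambda>x. (f x - f x0) / (x - x0)) \<longlongrightarrow> 0) (at x0)"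
  proof (rule Lim_null_comparison)
    have "norm ((f x - f x0) / (x - x0)) \<le> C * \<bar>x - x0\<bar>" for x
      using assms(2)[of x] f0 by (cases "x = x0") (auto simp: divide_le_eq power2_eq_square abs_mult_self_eq)
    then show "\<forall>\<^sub>F x in at x0. norm ((f x - f x0) / (x - x0)) \<le> C * \<bar>x - x0\<bar>" by simp
    show "((\<lambda>x. C * \<bar>x - x0\<bar>) \<longlongrightarrow> 0) (at x0)"
      by (auto intro!: tendsto_eq_intros)
  qed
  then show ?thesis by (simp add: has_field_derivative_iff)
qed

text \<open>Inside the interval this is the quotient rule over the common denominator W^(k+2).
  Outside, the quadratic bound forces the derivative to be 0, which agrees with the default value of
  \<open>bump_fun\<close>.\<close>

lemma bump_fun_has_derivative:
  assumes ab: "a < b" and c: "c > 0"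
  defines "W \<equiv> [:-a, 1:] * [:b, -1:]"
  shows "(bump_fun a b c P k has_real_derivative
    bump_fun a b c (pderiv P * W\<^sup>2 - smult (of_nat k) (P * W * pderiv W) + smult c (P * pderiv W)) (k + 2) x) (at x)"
proof (cases "a < x \<and> x < b")
  case True
  define w where "w = (\<lambda>x. (x - a) * (b - x))"
  define v where "v = a + b - 2 * x"
  have W: "poly W x = w x" "poly (pderiv W) x = v"
    by (simp_all add: W_def w_def v_def pderiv_mult pderiv_pCons algebra_simps)
  have w: "w x > 0" using True by (simp add: w_def)
  have dw: "(w has_real_derivative v) (at x)"
    unfolding w_def v_def by (auto intro!: derivative_eq_intros)
  have dE: "((\<lambda>x. exp (- c / w x)) has_real_derivative exp (- c / w x) * (c * v / (w x)\<^sup>2)) (at x)"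
    using w by (auto intro!: derivative_eq_intros dw simp: power2_eq_square)
  have D: "((\<lambda>x. poly P x * exp (- c / w x) / w x ^ k) has_real_derivative
     ((poly (pderiv P) x * exp (- c / w x) + poly P x * (exp (- c / w x) * (c * v / (w x)\<^sup>2))) * w x ^ k
       - poly P x * exp (- c / w x) * (real k * w x ^ (k - 1) * v)) / (w x ^ k)\<^sup>2) (at x)"
    using w by (auto intro!: derivative_eq_intros dw dE poly_DERIV simp: power2_eq_square)
  have eq: "((poly (pderiv P) x * E + poly P x * (E * (c * v / w\<^sup>2))) * w ^ k
       - poly P x * E * (real k * w ^ (k - 1) * v)) / (w ^ k)\<^sup>2
     = (poly (pderiv P) x * w\<^sup>2 - real k * (poly P x * w * v) + c * (poly P x * v)) * E / w ^ (k + 2)"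
    if "w > 0" for E w
    using that by (cases k) (simp_all add: field_simps power2_eq_square)
  have *: "((\<lambda>x. poly P x * exp (- c / w x) / w x ^ k) has_real_derivative
     (poly (pderiv P) x * (w x)\<^sup>2 - real k * (poly P x * w x * v) + c * (poly P x * v)) * exp (- c / w x) / w x ^ (k + 2)) (at x)"
    using D unfolding eq[OF w] .
  have "(bump_fun a b c P k has_real_derivative
     (poly (pderiv P) x * (w x)\<^sup>2 - real k * (poly P x * w x * v) + c * (poly P x * v)) * exp (- c / w x) / w x ^ (k + 2)) (at x)"
    using True by (intro has_field_derivative_transform_within_open[OF *, of "{a<..<b}"])
      (auto simp: bump_fun_def w_def)
  moreover have "(poly (pderiv P) x * (w x)\<^sup>2 - real k * (poly P x * w x * v) + c * (poly P x * v)) * exp (- c / w x) / w x ^ (k + 2)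
    = bump_fun a b c (pderiv P * W\<^sup>2 - smult (of_nat k) (P * W * pderiv W) + smult c (P * pderiv W)) (k + 2) x"
  proof -
    have "bump_fun a b c R n x = poly R x * exp (- c / w x) / w x ^ n" for R n
      using True by (simp add: bump_fun_def w_def)
    then show ?thesis by (simp add: W mult_ac)
  qed
  ultimately show ?thesis by simp
next
  case False
  then have "x \<le> a \<or> b \<le> x" by auto
  then obtain C where "C \<ge> 0" "\<And>y. \<bar>bump_fun a b c P k y\<bar> \<le> C * (y - x)\<^sup>2"
    using bump_fun_quadratic[OF ab c] by blast
  then have "(bump_fun a b c P k has_real_derivative 0) (at x)"
    by (rule has_real_derivative_quadratic)
  moreover have "bump_fun a b c R n x = 0" for R n
    using False by (auto simp: bump_fun_def)
  ultimately show ?thesis by simp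
qed

section \<open>Smooth approximation of the indicator of a box\<close>

lemma smooth_continuous:
  assumes "smooth f"
  shows "continuous_on UNIV f"
proof -
  have "f differentiable (at x)" for x
    using assms[unfolded smooth_def, rule_format, of "[]" x] by simp
  then show ?thesis
    by (auto intro!: continuous_at_imp_continuous_on differentiable_imp_continuous_within)
qed

text \<open>Smoothness quantifies over all lists of directions; a class of differentiable functions
  invariant under \<open>partial_deriv\<close> handles them by one induction.\<close>

lemma smooth_if_closed:
  assumes "f \<in> \<T>" and diff: "\<And>g x. g \<in> \<T> \<Longrightarrow> g differentiable (at x)"
    and closed: "\<And>g i. g \<in> \<T> \<Longrightarrow> partial_deriv i g \<in> \<T>"
  shows "smooth f"
proof -
  have "iter_partial is f \<in> \<T>" for "is"
    by (induction "is") (auto intro: assms(1) closed)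
  then show ?thesis unfolding smooth_def using diff by blast
qed

definition bump3 :: "(3 \<Rightarrow> real) \<Rightarrow> (3 \<Rightarrow> real) \<Rightarrow> real \<Rightarrow> (3 \<Rightarrow> real poly) \<Rightarrow> (3 \<Rightarrow> nat) \<Rightarrow> real^3 \<Rightarrow> real" where
  "bump3 a b c P k x = bump_fun (a 1) (b 1) c (P 1) (k 1) (x$1) *
     bump_fun (a 2) (b 2) c (P 2) (k 2) (x$2) * bump_fun (a 3) (b 3) c (P 3) (k 3) (x$3)"

text \<open>The invariant class consists of all \<open>bump3\<close> with the same intervals and the
  same \<open>c\<close>: a partial derivative in direction \<open>i\<close> changes only the
  polynomial and the exponent of the factor \<open>i\<close>.\<close>

lemma bump3_smooth:
  assumes ab: "\<And>i. a i < b i" and c: "c > 0"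
  shows "smooth (\<lambda>x. complex_of_real (bump3 a b c P k x))"
proof (rule smooth_if_closed)
  let ?T = "range (\<lambda>(P, k) x. complex_of_real (bump3 a b c P k x))"
  show "(\<lambda>x. complex_of_real (bump3 a b c P k x)) \<in> ?T"
    by (rule image_eqI[where x = "(P, k)"]) auto
  define Q where "Q i P k = pderiv P * ([:- a i, 1:] * [:b i, -1:])\<^sup>2 - smult (of_nat k) (P * ([:- a i, 1:] * [:b i, -1:]) * pderiv ([:- a i, 1:] * [:b i, -1:]))
     + smult c (P * pderiv ([:- a i, 1:] * [:b i, -1:]))" for i P and k :: nat
  have der: "(bump_fun (a i) (b i) c P k has_real_derivative bump_fun (a i) (b i) c (Q i P k) (k + 2) x) (at x)" for i P k x
    unfolding Q_def using ab c by (rule bump_fun_has_derivative)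
  fix g assume "g \<in> ?T"
  then obtain P k where g: "g = (\<lambda>x. complex_of_real (bump3 a b c P k x))" by auto
  have d1: "(\<lambda>x::real^3. bump_fun (a i) (b i) c P k (x $ i)) differentiable (at x)" for i P k x
  proof -
    have "bump_fun (a i) (b i) c P k differentiable (at (x $ i))"
      using der real_differentiable_def by blast
    moreover have "(\<lambda>x::real^3. x $ i) differentiable (at x)"
      by (intro bounded_linear_imp_differentiable bounded_linear_vec_nth)
    ultimately show ?thesis
      by (rule differentiable_compose)
  qed
  have d2: "(\<lambda>x::real^3. complex_of_real (bump_fun (a i) (b i) c P k (x $ i))) differentiable (at x)" for i P k x
    by (rule differentiable_compose[OF _ d1])
       (intro bounded_linear_imp_differentiable bounded_linear_of_real)
  show "g differentiable (at x)" for x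
    unfolding g bump3_def of_real_mult
    by (intro differentiable_mult d2)
  fix i :: 3
  have "partial_deriv i g = (\<lambda>x. complex_of_real (bump3 a b c (P(i := Q i (P i) (k i))) (k(i := k i + 2)) x))"
  proof
    fix x :: "real^3"
    have D: "((\<lambda>h. bump_fun (a i) (b i) c P k (y + h)) has_real_derivative bump_fun (a i) (b i) c (Q i P k) (k + 2) y) (at 0)" for i P k y
      using der[of i P k y] DERIV_at_within_shift[of "bump_fun (a i) (b i) c P k" _ y 0 UNIV]
      by (simp add: add.commute)
    have "((\<lambda>h. bump3 a b c P k (x + h *\<^sub>R axis i 1)) has_real_derivative bump3 a b c (P(i := Q i (P i) (k i))) (k(i := k i + 2)) x) (at 0)"
      using exhaust_3[of i] unfolding bump3_def
      by (elim disjE; simp add: axis_def) (auto intro!: derivative_eq_intros D)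
    then have "((\<lambda>h. complex_of_real (bump3 a b c P k (x + h *\<^sub>R axis i 1))) has_vector_derivative
        complex_of_real (bump3 a b c (P(i := Q i (P i) (k i))) (k(i := k i + 2)) x)) (at 0)"
      by (intro has_vector_derivative_of_real) (simp add: has_real_derivative_iff_has_vector_derivative)
    then show "partial_deriv i g x = complex_of_real (bump3 a b c (P(i := Q i (P i) (k i))) (k(i := k i + 2)) x)"
      unfolding partial_deriv_def g by (rule vector_derivative_at)
  qed
  then show "partial_deriv i g \<in> ?T"
    by (intro image_eqI[where x = "(P(i := Q i (P i) (k i)), k(i := k i + 2))"]) auto
qed

lemma bump_fun_one: "bump_fun a b c 1 0 x = (if a < x \<and> x < b then exp (- c / ((x - a) * (b - x))) else 0)"
  by (simp add: bump_fun_def)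

lemma bump_fun_one_le:
  assumes "c > 0"
  shows "0 \<le> bump_fun a b c 1 0 x" "bump_fun a b c 1 0 x \<le> 1"
  using assms by (auto simp: bump_fun_one)

lemma bump_fun_one_tendsto: "(\<lambda>n. bump_fun a b (1 / real (Suc n)) 1 0 x) \<longlonglongrightarrow> indicator {a<..<b} x"
proof (cases "a < x \<and> x < b")
  case True
  have "(\<lambda>n. exp (- (1 / real (Suc n)) / ((x - a) * (b - x)))) \<longlonglongrightarrow> exp (- 0 / ((x - a) * (b - x)))"
    using True by (intro tendsto_intros LIMSEQ_Suc[OF lim_1_over_n]) auto
  then show ?thesis using True by (simp add: bump_fun_one)
next
  case False
  then show ?thesis by (auto simp: bump_fun_one)
qed

text \<open>With polynomial 1, exponent 0 and c = 1/(n+1) the factors are exp(-c/w). As c tends to 0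
  they tend to 1 inside the box while remaining 0 off it.\<close>

definition box_bump :: "real^3 \<Rightarrow> real^3 \<Rightarrow> nat \<Rightarrow> real^3 \<Rightarrow> real" where
  "box_bump a b n = bump3 (\<lambda>i. a $ i) (\<lambda>i. b $ i) (1 / real (Suc n)) (\<lambda>_. 1) (\<lambda>_. 0)"

lemma box_eq_cart3: "box a b = {x :: real^3. (a$1 < x$1 \<and> x$1 < b$1) \<and> (a$2 < x$2 \<and> x$2 < b$2) \<and> (a$3 < x$3 \<and> x$3 < b$3)}"
  by (auto simp: box_vec_eq_empty mem_box_cart forall_3 set_eq_iff)

lemma box_bump_eq_0: "x \<notin> box a b \<Longrightarrow> box_bump a b n x = 0"
  by (auto simp: box_bump_def bump3_def bump_fun_one box_eq_cart3)

lemma box_bump_bounds: "0 \<le> box_bump a b n x" "box_bump a b n x \<le> 1"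
proof -
  show "0 \<le> box_bump a b n x"
    unfolding box_bump_def bump3_def by (intro mult_nonneg_nonneg bump_fun_one_le) auto
  have "box_bump a b n x \<le> 1 * 1 * 1"
    unfolding box_bump_def bump3_def by (intro mult_mono mult_nonneg_nonneg bump_fun_one_le) auto
  then show "box_bump a b n x \<le> 1" by simp
qed

lemma box_bump_tendsto: "(\<lambda>n. box_bump a b n x) \<longlonglongrightarrow> indicator (box a b) x"
proof -
  have "(\<lambda>n. box_bump a b n x) \<longlonglongrightarrow> indicator {a$1<..<b$1} (x$1) * indicator {a$2<..<b$2} (x$2) * indicator {a$3<..<b$3} (x$3)"
    unfolding box_bump_def bump3_def by (intro tendsto_mult bump_fun_one_tendsto)
  also have "indicator {a$1<..<b$1} (x$1) * indicator {a$2<..<b$2} (x$2) * indicator {a$3<..<b$3} (x$3) = (indicator (box a b) x :: real)"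
    by (auto simp: indicator_def box_eq_cart3)
  finally show ?thesis .
qed

lemma box_bump_test:
  assumes "box a b \<noteq> {}"
  shows "(\<lambda>x. complex_of_real (box_bump a b n x)) \<in> test_functions"
proof -
  have "a $ i < b $ i" for i
    using assms by (auto simp: box_eq_cart3) (metis exhaust_3 order.strict_trans)
  then have "smooth (\<lambda>x. complex_of_real (box_bump a b n x))"
    unfolding box_bump_def by (intro bump3_smooth) auto
  moreover obtain r where "\<forall>x\<in>box a b. norm x \<le> r"
    using bounded_box[of a b] unfolding bounded_iff by blast
  then have "\<forall>x. norm x > r \<longrightarrow> complex_of_real (box_bump a b n x) = 0"
    by (metis box_bump_eq_0 leD of_real_0)
  ultimately show ?thesis unfolding test_functions_def by blast
qed

text \<open>The positive and the negative part of \<open>u\<close>, taken as densities, give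
  measures that agree on open boxes. Boxes are stable under intersection and generate the Borel
  sets, so the measures agree, and densities are unique almost everywhere.\<close>

lemma AE_zero_if_box_integrals_zero:
  fixes u :: "'a::euclidean_space \<Rightarrow> real"
  assumes [measurable]: "u \<in> borel_measurable borel"
    and int: "\<And>a b. set_integrable lborel (box a b) u"
    and zero: "\<And>a b. (LINT x:box a b|lborel. u x) = 0"
  shows "AE x in lborel. u x = 0"
proof -
  have *: "emeasure (density lborel (\<lambda>x. ennreal (max 0 (v x)))) (box a b) = ennreal (LINT x:box a b|lborel. max 0 (v x))"
    if [measurable]: "v \<in> borel_measurable borel" and v: "set_integrable lborel (box a b) v" for v :: "'a \<Rightarrow> real" and a b
  proof -
    have i: "set_integrable lborel (box a b) (\<lambda>x. max 0 (v x))"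
      using v unfolding set_integrable_def
      by (rule Bochner_Integration.integrable_bound) (auto simp: indicator_def)
    have "emeasure (density lborel (\<lambda>x. ennreal (max 0 (v x)))) (box a b)
        = (\<integral>\<^sup>+x. ennreal (indicator (box a b) x *\<^sub>R max 0 (v x)) \<partial>lborel)"
      by (subst emeasure_density) (auto intro!: nn_integral_cong simp: indicator_def)
    also have "\<dots> = ennreal (LINT x:box a b|lborel. max 0 (v x))"
      using i unfolding set_integrable_def set_lebesgue_integral_def
      by (intro nn_integral_eq_integral) auto
    finally show ?thesis .
  qed
  have eq: "(LINT x:box a b|lborel. max 0 (u x)) = (LINT x:box a b|lborel. max 0 (- u x))" for a b
  proof -
    have i1: "set_integrable lborel (box a b) (\<lambda>x. max 0 (u x))"
      using int[of a b] unfolding set_integrable_def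
      by (rule Bochner_Integration.integrable_bound) (auto simp: indicator_def)
    have i2: "set_integrable lborel (box a b) (\<lambda>x. max 0 (- u x))"
      using int[of a b] unfolding set_integrable_def
      by (rule Bochner_Integration.integrable_bound) (auto simp: indicator_def)
    have "(LINT x:box a b|lborel. max 0 (u x)) - (LINT x:box a b|lborel. max 0 (- u x)) = (LINT x:box a b|lborel. max 0 (u x) - max 0 (- u x))"
      using i1 i2 by (rule set_integral_diff(2)[symmetric])
    also have "(\<lambda>x. max 0 (u x) - max 0 (- u x)) = u" by auto
    finally show ?thesis using zero[of a b] by simp
  qed
  let ?E = "range (\<lambda>(a, b). box a b) :: 'a set set"
  have "density lborel (\<lambda>x. ennreal (max 0 (u x))) = density lborel (\<lambda>x. ennreal (max 0 (- u x)))"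
  proof (rule measure_eqI_generator_eq)
    show "Int_stable ?E"
      by (auto simp: Int_stable_def box_Int_box)
    show "?E \<subseteq> Pow UNIV" by simp
    show "sets (density lborel (\<lambda>x. ennreal (max 0 (u x)))) = sigma_sets UNIV ?E"
      "sets (density lborel (\<lambda>x. ennreal (max 0 (- u x)))) = sigma_sets UNIV ?E"
      by (simp_all add: borel_eq_box)
    show "range (\<lambda>n::nat. box (- (real n *\<^sub>R One)) (real n *\<^sub>R One) :: 'a set) \<subseteq> ?E" by auto
    show "(\<Union>n. box (- (real n *\<^sub>R One)) (real n *\<^sub>R One) :: 'a set) = UNIV"
      unfolding UN_box_eq_UNIV by auto
    have neg: "set_integrable lborel (box a b) (\<lambda>x. - u x)" for a b
      using int[of a b] unfolding set_integrable_def by (auto dest: Bochner_Integration.integrable_minus)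
    fix X assume "X \<in> ?E"
    then obtain a b where X: "X = box a b" by auto
    show "emeasure (density lborel (\<lambda>x. ennreal (max 0 (u x)))) X = emeasure (density lborel (\<lambda>x. ennreal (max 0 (- u x)))) X"
      unfolding X using *[OF _ int[of a b]] *[OF _ neg[of a b]] eq[of a b] by simp
  next
    fix n :: nat
    show "emeasure (density lborel (\<lambda>x. ennreal (max 0 (u x)))) (box (- (real n *\<^sub>R One)) (real n *\<^sub>R One)) \<noteq> \<infinity>"
      by (subst *) (auto intro: int)
  qed
  then have "AE x in lborel. ennreal (max 0 (u x)) = ennreal (max 0 (- u x))"
    by (intro sigma_finite_measure.density_unique[OF lborel.sigma_finite_measure_axioms]) auto
  then show ?thesis
    by eventually_elim (auto simp: max_def split: if_splits)
qed

section \<open>Uniqueness of the representing function\<close>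

lemma fourier_rep_measurable [measurable_dest]: "fourier_rep f g \<Longrightarrow> g \<in> borel_measurable borel"
  by (simp add: fourier_rep_def)

lemma fourier_rep_set_integrable_box:
  assumes "fourier_rep f g"
  shows "set_integrable lborel (box a b) g"
proof -
  have "set_integrable lborel (cbox a b) g"
    using assms compact_cbox by (simp add: fourier_rep_def)
  then show ?thesis
    by (rule set_integrable_subset) (auto simp: box_subset_cbox)
qed

text \<open>The left side depends on the distribution alone, so the integrals of a representing
  function over boxes are determined. Local integrability of \<open>g\<close> justifies the
  dominated convergence.\<close>

lemma fourier_rep_box_integral:
  assumes f: "fourier_rep f g" and ne: "box a b \<noteq> {}"
  shows "(\<lambda>n. f (fourier (\<lambda>x. complex_of_real (box_bump a b n x)))) \<longlonglongrightarrow> (LINT x:box a b|lborel. g x)"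
proof -
  have g [measurable]: "g \<in> borel_measurable borel" using f by measurable
  have [measurable]: "box_bump a b n \<in> borel_measurable borel" for n
  proof -
    have "smooth (\<lambda>x. complex_of_real (box_bump a b n x))"
      using box_bump_test[OF ne] by (simp add: test_functions_def)
    then have "continuous_on UNIV (\<lambda>x. Re (complex_of_real (box_bump a b n x)))"
      by (intro continuous_on_Re smooth_continuous)
    then show ?thesis by (intro borel_measurable_continuous_onI) simp
  qed
  have "(\<lambda>n. LINT x|lborel. box_bump a b n x *\<^sub>R g x) \<longlonglongrightarrow> (LINT x|lborel. indicator (box a b) x *\<^sub>R g x)"
  proof (rule integral_dominated_convergence)
    show "integrable lborel (\<lambda>x. norm (indicator (box a b) x *\<^sub>R g x))"
      using fourier_rep_set_integrable_box[OF f, of a b] unfolding set_integrable_def by (rule integrable_norm)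
    show "AE x in lborel. (\<lambda>n. box_bump a b n x *\<^sub>R g x) \<longlonglongrightarrow> indicator (box a b) x *\<^sub>R g x"
      by (intro AE_I2 tendsto_scaleR box_bump_tendsto tendsto_const)
    show "AE x in lborel. norm (box_bump a b n x *\<^sub>R g x) \<le> norm (indicator (box a b) x *\<^sub>R g x)" for n
      using box_bump_bounds[of a b n] box_bump_eq_0[of _ a b n]
      by (intro AE_I2) (auto simp: indicator_def mult_left_le_one_le)
  qed measurable
  moreover have "f (fourier (\<lambda>x. complex_of_real (box_bump a b n x))) = (LINT x|lborel. box_bump a b n x *\<^sub>R g x)" for n
  proof -
    have "complex_of_real c *s v = c *\<^sub>R v" for c and v :: "complex^3"
      unfolding vec_eq_iff vector_scaleR_component vector_scalar_mult_def
      by (simp add: scaleR_conv_of_real)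
    then show ?thesis using f box_bump_test[OF ne, of n] by (simp add: fourier_rep_def)
  qed
  ultimately show ?thesis by (simp add: set_lebesgue_integral_def)
qed

lemma fourier_rep_unique:
  assumes g: "fourier_rep f g" and h: "fourier_rep f h"
  shows "AE \<xi> in lborel. g \<xi> = h \<xi>"
proof -
  have [measurable]: "g \<in> borel_measurable borel" "h \<in> borel_measurable borel"
    using g h by measurable
  have int: "set_integrable lborel (box a b) (\<lambda>x. g x - h x)" for a b
    using g h by (intro set_integral_diff fourier_rep_set_integrable_box)
  have zero: "(LINT x:box a b|lborel. g x - h x) = 0" for a b
  proof (cases "box a b = {}")
    case False
    have "(LINT x:box a b|lborel. g x) = (LINT x:box a b|lborel. h x)"
      using fourier_rep_box_integral[OF g False] fourier_rep_box_integral[OF h False] by (rule LIMSEQ_unique)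
    then show ?thesis
      using g h by (subst set_integral_diff) (auto intro: fourier_rep_set_integrable_box)
  qed (simp add: set_lebesgue_integral_def)
  have "AE x in lborel. (g x - h x) \<bullet> e = 0" for e
  proof (rule AE_zero_if_box_integrals_zero)
    fix a b :: "real^3"
    have "integrable lborel (\<lambda>x. (indicator (box a b) x *\<^sub>R (g x - h x)) \<bullet> e)"
      using int[of a b] unfolding set_integrable_def by (rule integrable_inner_left)
    then show "set_integrable lborel (box a b) (\<lambda>x. (g x - h x) \<bullet> e)"
      by (simp add: set_integrable_def)
    have "(LINT x|lborel. (indicator (box a b) x *\<^sub>R (g x - h x)) \<bullet> e) = (LINT x:box a b|lborel. g x - h x) \<bullet> e"
      using int[of a b] unfolding set_integrable_def set_lebesgue_integral_def by (intro integral_inner_left) auto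
    then show "(LINT x:box a b|lborel. (g x - h x) \<bullet> e) = 0"
      using zero[of a b] by (simp add: set_lebesgue_integral_def)
  qed measurable
  then have "AE x in lborel. \<forall>e\<in>Basis. (g x - h x) \<bullet> e = 0"
    by (intro AE_finite_allI) auto
  then show ?thesis
    by eventually_elim (metis eq_iff_diff_eq_0 euclidean_all_zero_iff)
qed

lemma fourier_rep_cong_AE:
  assumes f: "fourier_rep f g" and [measurable]: "h \<in> borel_measurable borel" and eq: "AE \<xi> in lborel. g \<xi> = h \<xi>"
  shows "fourier_rep f h"
  unfolding fourier_rep_def
proof (intro conjI allI impI ballI)
  have [measurable]: "g \<in> borel_measurable borel" using f by measurable
  fix K :: "(real^3) set" assume K: "compact K"
  then have [measurable]: "K \<in> sets borel" by (simp add: borel_compact)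
  have "set_integrable lborel K g" using f K by (simp add: fourier_rep_def)
  then show "set_integrable lborel K h"
    unfolding set_integrable_def
    by (rule integrable_cong_AE_imp) (use eq in \<open>auto elim: eventually_mono\<close>)
next
  have [measurable]: "g \<in> borel_measurable borel" using f by measurable
  fix \<psi> assume \<psi>: "\<psi> \<in> test_functions"
  then have "smooth \<psi>" by (simp add: test_functions_def)
  then have "continuous_on UNIV \<psi>" by (rule smooth_continuous)
  then have [measurable]: "\<psi> \<in> borel_measurable borel" by (rule borel_measurable_continuous_onI)
  have "f (fourier \<psi>) = (LINT \<xi>|lborel. \<psi> \<xi> *s g \<xi>)" using f \<psi> by (simp add: fourier_rep_def)
  also have "\<dots> = (LINT \<xi>|lborel. \<psi> \<xi> *s h \<xi>)"
    by (rule integral_cong_AE) (use eq in \<open>auto elim: eventually_mono\<close>)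
  finally show "f (fourier \<psi>) = (LINT \<xi>|lborel. \<psi> \<xi> *s h \<xi>)" .
qed simp

section \<open>Properties of the chosen transform\<close>

lemma fourier_rep_ft: "\<exists>g. fourier_rep f g \<Longrightarrow> fourier_rep f (ft f)"
  unfolding ft_def by (rule someI_ex[of "fourier_rep f"])

lemma test_function_smult_integrable:
  assumes \<psi>: "\<psi> \<in> test_functions" and g: "fourier_rep f g"
  shows "integrable lborel (\<lambda>\<xi>. \<psi> \<xi> *s g \<xi>)"
proof -
  have [measurable]: "g \<in> borel_measurable borel" using g by measurable
  have "smooth \<psi>" using \<psi> by (simp add: test_functions_def)
  then have cont: "continuous_on UNIV \<psi>" by (rule smooth_continuous)
  then have [measurable]: "\<psi> \<in> borel_measurable borel" by (rule borel_measurable_continuous_onI)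
  obtain r where r: "\<And>x. norm x > r \<Longrightarrow> \<psi> x = 0" using \<psi> by (auto simp: test_functions_def)
  have "bounded (\<psi> ` cball 0 r)"
    using cont by (intro compact_imp_bounded compact_continuous_image continuous_on_subset[OF cont]) auto
  then obtain M where M: "M > 0" "\<And>x. x \<in> cball 0 r \<Longrightarrow> norm (\<psi> x) \<le> M"
    by (auto simp: bounded_pos)
  have "set_integrable lborel (cball 0 r) g" using g by (simp add: fourier_rep_def)
  then have "integrable lborel (\<lambda>x. M *\<^sub>R (indicator (cball 0 r) x *\<^sub>R g x))"
    unfolding set_integrable_def by (rule integrable_scaleR_right)
  then show ?thesis
  proof (rule Bochner_Integration.integrable_bound)
    have "norm (\<psi> x *s g x) \<le> norm (M *\<^sub>R (indicator (cball 0 r) x *\<^sub>R g x))" for x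
      using M r[of x] by (cases "norm x \<le> r") (auto simp: norm_smult mult_right_mono)
    then show "AE x in lborel. norm (\<psi> x *s g x) \<le> norm (M *\<^sub>R (indicator (cball 0 r) x *\<^sub>R g x))"
      by simp
  qed measurable
qed

lemma fourier_rep_diff:
  assumes f: "fourier_rep f f'" and g: "fourier_rep g g'"
  shows "fourier_rep (\<lambda>\<psi>. f \<psi> - g \<psi>) (\<lambda>\<xi>. f' \<xi> - g' \<xi>)"
  unfolding fourier_rep_def
proof (intro conjI allI impI ballI)
  have [measurable]: "f' \<in> borel_measurable borel" "g' \<in> borel_measurable borel" using f g by measurable
  show "(\<lambda>\<xi>. f' \<xi> - g' \<xi>) \<in> borel_measurable borel" by measurable
  show "set_integrable lborel K (\<lambda>\<xi>. f' \<xi> - g' \<xi>)" if "compact K" for K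
    using f g that by (intro set_integral_diff) (auto simp: fourier_rep_def)
  fix \<psi> assume \<psi>: "\<psi> \<in> test_functions"
  have "(LINT \<xi>|lborel. \<psi> \<xi> *s (f' \<xi> - g' \<xi>)) = (LINT \<xi>|lborel. \<psi> \<xi> *s f' \<xi> - \<psi> \<xi> *s g' \<xi>)"
    by (simp add: vec_eq_iff vector_scalar_mult_def right_diff_distrib minus_vec_def)
  also have "\<dots> = f (fourier \<psi>) - g (fourier \<psi>)"
    using f g \<psi> by (subst Bochner_Integration.integral_diff)
      (auto intro: test_function_smult_integrable simp: fourier_rep_def)
  finally show "f (fourier \<psi>) - g (fourier \<psi>) = (LINT \<xi>|lborel. \<psi> \<xi> *s (f' \<xi> - g' \<xi>))" ..
qed

text \<open>Since \<open>ft\<close> is a choice, additivity can be claimed only almost everywhere;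
  it follows from uniqueness.\<close>

lemma ft_diff:
  assumes "fourier_rep f f'" "fourier_rep g g'"
  shows "AE \<xi> in lborel. ft (\<lambda>\<psi>. f \<psi> - g \<psi>) \<xi> = f' \<xi> - g' \<xi>"
  using fourier_rep_diff[OF assms] fourier_rep_ft fourier_rep_unique by blast

section \<open>Jointly measurable representatives\<close>

lemma ennreal_tendsto_0_le:
  assumes "((g :: 'a \<Rightarrow> ennreal) \<longlongrightarrow> 0) F" "eventually (\<lambda>x. f x \<le> g x) F"
  shows "(f \<longlongrightarrow> 0) F"
  by (rule tendsto_sandwich[OF _ assms(2) tendsto_const assms(1)]) simp

text \<open>The truncated terms tend to 0, so the truncation is eventually inactive.\<close>

lemma summable_norm_if_min_1:
  assumes "(\<Sum>k. ennreal (min 1 (norm (a k)))) < top"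
  shows "summable (\<lambda>k. norm (a k))"
proof -
  have s: "summable (\<lambda>k. min 1 (norm (a k)))"
    using assms by (intro summable_suminf_not_top) auto
  then have "(\<lambda>k. min 1 (norm (a k))) \<longlonglongrightarrow> 0" by (rule summable_LIMSEQ_zero)
  then have "eventually (\<lambda>k. min 1 (norm (a k)) < 1) sequentially"
    by (rule order_tendstoD(2)) simp
  then have "eventually (\<lambda>k. min 1 (norm (a k)) = norm (a k)) sequentially"
    by eventually_elim auto
  from summable_cong[OF this] s show ?thesis by simp
qed

lemma convergent_if_summable_norm_diff:
  fixes u :: "nat \<Rightarrow> 'a::banach"
  assumes "summable (\<lambda>k. norm (u k - u (Suc k)))"
  shows "convergent u"
proof -
  have "summable (\<lambda>k. u k - u (Suc k))" using assms by (rule summable_norm_cancel)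
  then have "convergent (\<lambda>n. \<Sum>k<n. u k - u (Suc k))" by (simp add: summable_iff_convergent)
  then have "convergent (\<lambda>n. u 0 - u n)" by (simp add: sum_lessThan_telescope')
  then have "convergent (\<lambda>n. u 0 - (u 0 - u n))" by (rule convergent_diff[OF convergent_const])
  then show ?thesis by simp
qed

text \<open>The truncated distance describes convergence in measure on a finite measure space and
  always has a finite integral there.\<close>

lemma min_1_norm_triangle:
  "ennreal (min 1 (norm (x - z))) \<le> ennreal (min 1 (norm (x - y))) + ennreal (min 1 (norm (z - y)))"
proof -
  have "norm (x - z) \<le> norm (x - y) + norm (z - y)"
    using norm_triangle_ineq4[of "x - y" "z - y"] by simp
  then have "min 1 (norm (x - z)) \<le> min 1 (norm (x - y)) + min 1 (norm (z - y))"
    using norm_ge_zero[of "x - y"] norm_ge_zero[of "z - y"] unfolding min_def by (simp; linarith)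
  then show ?thesis by (simp add: ennreal_leI flip: ennreal_plus)
qed

lemma fast_subsequence:
  fixes a :: "nat \<Rightarrow> ennreal"
  assumes "a \<longlonglongrightarrow> 0"
  obtains n where "strict_mono n" "(\<Sum>k. a (n k)) < top"
proof -
  have "\<exists>N. \<forall>m\<ge>N. a m < ennreal ((1/2) ^ k)" for k
    using order_tendstoD(2)[OF assms, of "ennreal ((1/2) ^ k)"] by (auto simp: eventually_sequentially)
  then obtain N where N: "\<And>k m. m \<ge> N k \<Longrightarrow> a m < ennreal ((1/2) ^ k)" by metis
  define n where "n k = (\<Sum>i\<le>k. N i) + k" for k
  have "strict_mono n" unfolding strict_mono_Suc_iff by (simp add: n_def)
  moreover have "a (n k) \<le> ennreal ((1/2) ^ k)" for k
    by (rule less_imp_le, rule N) (simp add: n_def member_le_sum trans_le_add1)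
  then have "(\<Sum>k. a (n k)) \<le> (\<Sum>k. ennreal ((1/2) ^ k))"
    by (intro suminf_le) auto
  moreover have "(\<Sum>k. ennreal ((1/2) ^ k)) = ennreal 2"
    using geometric_sums[of "1/2::real"] by (intro suminf_ennreal_eq) auto
  ultimately have "(\<Sum>k. a (n k)) \<le> ennreal 2" by simp
  then have "(\<Sum>k. a (n k)) < top" by (rule le_less_trans) simp
  with \<open>strict_mono n\<close> show ?thesis by (rule that)
qed

text \<open>The limits \<open>F t\<close> are measurable for almost every fixed \<open>t\<close>
  only. A fast subsequence of the jointly measurable \<open>u n\<close> converges almost everywhere
  on the product; its pointwise limit is jointly measurable, and it agrees with \<open>F t\<close>
  because both are limits in measure for fixed \<open>t\<close>.\<close>

lemma jointly_measurable_limit: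
  fixes u :: "nat \<Rightarrow> 'a \<Rightarrow> 'b \<Rightarrow> 'c::{banach, second_countable_topology}"
  assumes M: "finite_measure M" and N: "finite_measure N"
    and u [measurable]: "\<And>n. (\<lambda>(t, x). u n t x) \<in> borel_measurable (M \<Otimes>\<^sub>M N)"
    and F: "AE t in M. F t \<in> borel_measurable N \<and>
      (\<lambda>n. \<integral>\<^sup>+x. ennreal (min 1 (norm (u n t x - F t x))) \<partial>N) \<longlonglongrightarrow> 0"
  shows "\<exists>g. (\<lambda>(t, x). g t x) \<in> borel_measurable (M \<Otimes>\<^sub>M N) \<and> (AE t in M. AE x in N. g t x = F t x)"
proof -
  interpret M: finite_measure M by (rule M)
  interpret N: finite_measure N by (rule N)
  interpret P: pair_sigma_finite M N ..
  define I where "I n m t = (\<integral>\<^sup>+x. ennreal (min 1 (norm (u n t x - u m t x))) \<partial>N)" for n m t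
  define J where "J n t = (\<integral>\<^sup>+x. ennreal (min 1 (norm (u n t x - F t x))) \<partial>N)" for n t
  define s' where "s' n t = (SUP m\<in>{n..}. I n m t)" for n t
  have u1 [measurable]: "u n t \<in> borel_measurable N" if "t \<in> space M" for n t
    using measurable_compose[OF measurable_Pair1'[OF that] u[of n]] by simp
  have [measurable]: "I n m \<in> borel_measurable M" for n m
    unfolding I_def by measurable
  have [measurable]: "s' n \<in> borel_measurable M" for n
    unfolding s'_def by measurable
  have "AE t in M. (\<lambda>n. s' n t) \<longlonglongrightarrow> 0"
    using F AE_space
  proof eventually_elim
    case (elim t)
    then have [measurable]: "F t \<in> borel_measurable N" by simp
    have tri: "I n m t \<le> J n t + J m t" for n m
    proof -
      have "I n m t \<le> (\<integral>\<^sup>+x. ennreal (min 1 (norm (u n t x - F t x))) + ennreal (min 1 (norm (u m t x - F t x))) \<partial>N)"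
        unfolding I_def by (intro nn_integral_mono min_1_norm_triangle)
      also have "\<dots> = J n t + J m t"
        unfolding J_def using elim by (intro nn_integral_add) auto
      finally show ?thesis .
    qed
    have J: "(\<lambda>n. J n t) \<longlonglongrightarrow> 0" using elim by (simp add: J_def)
    show ?case
    proof (rule ennreal_tendsto_0I)
      fix e :: real assume e: "e > 0"
      then have "eventually (\<lambda>n. J n t < ennreal (e / 2)) sequentially"
        by (intro order_tendstoD(2)[OF J]) simp
      then obtain n0 where n0: "\<And>n. n \<ge> n0 \<Longrightarrow> J n t < ennreal (e / 2)"
        by (auto simp: eventually_sequentially)
      have "s' n t \<le> ennreal e" if "n \<ge> n0" for n
        unfolding s'_def
      proof (rule SUP_least)
        fix m assume "m \<in> {n..}"
        then have "I n m t \<le> ennreal (e / 2) + ennreal (e / 2)"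
          using that n0 by (intro order_trans[OF tri] add_mono less_imp_le) auto
        also have "\<dots> = ennreal e" using e by (simp flip: ennreal_plus)
        finally show "I n m t \<le> ennreal e" .
      qed
      then show "eventually (\<lambda>n. s' n t \<le> ennreal e) sequentially"
        unfolding eventually_sequentially by blast
    qed
  qed
  moreover have "s' n t \<le> emeasure N (space N)" for n t
  proof -
    have "I n m t \<le> (\<integral>\<^sup>+x. 1 \<partial>N)" for m
      unfolding I_def by (intro nn_integral_mono) (auto simp: ennreal_1[symmetric] intro!: ennreal_leI simp del: ennreal_1)
    then show ?thesis unfolding s'_def by (intro SUP_least) simp
  qed
  moreover have "(\<integral>\<^sup>+t. emeasure N (space N) \<partial>M) < \<infinity>"
    by (simp add: M.emeasure_eq_measure N.emeasure_eq_measure flip: ennreal_mult')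
  ultimately have "(\<lambda>n. \<integral>\<^sup>+t. s' n t \<partial>M) \<longlonglongrightarrow> (\<integral>\<^sup>+t. 0 \<partial>M)"
    by (intro nn_integral_dominated_convergence[where w = "\<lambda>_. emeasure N (space N)"]) auto
  then have "(\<lambda>n. \<integral>\<^sup>+t. s' n t \<partial>M) \<longlonglongrightarrow> 0" by simp
  then obtain n where n: "strict_mono n" and fin: "(\<Sum>k. \<integral>\<^sup>+t. s' (n k) t \<partial>M) < top"
    by (rule fast_subsequence)
  \<comment> \<open>Along the fast subsequence the truncated increments have a finite total
    integral, so they are summable at almost every pair and the subsequence converges there.\<close>
  have "(\<integral>\<^sup>+t. (\<integral>\<^sup>+x. (\<Sum>k. ennreal (min 1 (norm (u (n k) t x - u (n (Suc k)) t x)))) \<partial>N) \<partial>M)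
      = (\<integral>\<^sup>+t. (\<Sum>k. I (n k) (n (Suc k)) t) \<partial>M)"
    unfolding I_def by (intro nn_integral_cong nn_integral_suminf) measurable
  also have "\<dots> = (\<Sum>k. \<integral>\<^sup>+t. I (n k) (n (Suc k)) t \<partial>M)"
    by (rule nn_integral_suminf) measurable
  also have "\<dots> \<le> (\<Sum>k. \<integral>\<^sup>+t. s' (n k) t \<partial>M)"
  proof (intro suminf_le nn_integral_mono)
    fix k t
    have "n k \<le> n (Suc k)" using n by (simp add: strict_mono_less_eq)
    then show "I (n k) (n (Suc k)) t \<le> s' (n k) t" unfolding s'_def by (intro SUP_upper) simp
  qed auto
  also note fin
  finally have "AE t in M. (\<integral>\<^sup>+x. (\<Sum>k. ennreal (min 1 (norm (u (n k) t x - u (n (Suc k)) t x)))) \<partial>N) \<noteq> \<infinity>"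
    by (intro nn_integral_PInf_AE) auto
  then have conv: "AE t in M. AE x in N. convergent (\<lambda>k. u (n k) t x)"
    using AE_space
  proof eventually_elim
    case (elim t)
    then have "AE x in N. (\<Sum>k. ennreal (min 1 (norm (u (n k) t x - u (n (Suc k)) t x)))) \<noteq> \<infinity>"
      by (intro nn_integral_PInf_AE) auto
    then show ?case
      by eventually_elim
        (auto intro!: convergent_if_summable_norm_diff summable_norm_if_min_1 simp: less_top[symmetric])
  qed
  define g where "g t x = lim (\<lambda>k. u (n k) t x)" for t x
  have [measurable]: "(\<lambda>(t, x). g t x) \<in> borel_measurable (M \<Otimes>\<^sub>M N)"
    unfolding g_def case_prod_beta using u[unfolded case_prod_beta] by (intro borel_measurable_lim_metric)
  have "AE t in M. AE x in N. g t x = F t x"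
    using conv F AE_space
  proof eventually_elim
    case (elim t)
    then have [measurable]: "F t \<in> borel_measurable N" by simp
    have gt [measurable]: "g t \<in> borel_measurable N"
      using measurable_compose[OF measurable_Pair1'[OF elim(3)], of "\<lambda>(t, x). g t x"] by simp
    have "(\<lambda>k. J (n k) t) \<longlonglongrightarrow> 0"
      using LIMSEQ_subseq_LIMSEQ[OF conjunct2[OF elim(2)] n] by (simp add: J_def comp_def)
    moreover have "(\<lambda>k. \<integral>\<^sup>+x. ennreal (min 1 (norm (u (n k) t x - g t x))) \<partial>N) \<longlonglongrightarrow> (\<integral>\<^sup>+x. 0 \<partial>N)"
    proof (rule nn_integral_dominated_convergence)
      show "AE x in N. (\<lambda>k. ennreal (min 1 (norm (u (n k) t x - g t x)))) \<longlonglongrightarrow> 0"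
        using elim(1)
      proof eventually_elim
        case (elim x)
        then have "(\<lambda>k. u (n k) t x) \<longlonglongrightarrow> g t x"
          by (simp add: g_def convergent_LIMSEQ_iff)
        then have "(\<lambda>k. min 1 (norm (u (n k) t x - g t x))) \<longlonglongrightarrow> min 1 (norm (g t x - g t x))"
          by (intro tendsto_intros)
        then have "(\<lambda>k. ennreal (min 1 (norm (u (n k) t x - g t x)))) \<longlonglongrightarrow> ennreal 0"
          by (intro tendsto_ennrealI) simp
        then show ?case by simp
      qed
      show "AE x in N. ennreal (min 1 (norm (u (n k) t x - g t x))) \<le> 1" for k
        by (auto simp: ennreal_1[symmetric] intro!: ennreal_leI simp del: ennreal_1)
      show "(\<integral>\<^sup>+x. 1 \<partial>N) < \<infinity>" by (simp add: N.emeasure_finite less_top[symmetric])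
    qed (use elim in measurable)
    ultimately have "(\<lambda>k. J (n k) t + (\<integral>\<^sup>+x. ennreal (min 1 (norm (u (n k) t x - g t x))) \<partial>N)) \<longlonglongrightarrow> 0 + 0"
      by (intro tendsto_add) auto
    moreover have "(\<integral>\<^sup>+x. ennreal (min 1 (norm (g t x - F t x))) \<partial>N) \<le> J (n k) t + (\<integral>\<^sup>+x. ennreal (min 1 (norm (u (n k) t x - g t x))) \<partial>N)" for k
    proof -
      have "(\<integral>\<^sup>+x. ennreal (min 1 (norm (g t x - F t x))) \<partial>N) \<le>
         (\<integral>\<^sup>+x. ennreal (min 1 (norm (u (n k) t x - F t x))) + ennreal (min 1 (norm (u (n k) t x - g t x))) \<partial>N)"
      proof (rule nn_integral_mono)
        fix x
        show "ennreal (min 1 (norm (g t x - F t x))) \<le> ennreal (min 1 (norm (u (n k) t x - F t x))) + ennreal (min 1 (norm (u (n k) t x - g t x)))"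
          using min_1_norm_triangle[of "F t x" "g t x" "u (n k) t x"] by (simp only: norm_minus_commute)
      qed
      also have "\<dots> = J (n k) t + (\<integral>\<^sup>+x. ennreal (min 1 (norm (u (n k) t x - g t x))) \<partial>N)"
        unfolding J_def using elim by (intro nn_integral_add) auto
      finally show ?thesis .
    qed
    ultimately have "(\<integral>\<^sup>+x. ennreal (min 1 (norm (g t x - F t x))) \<partial>N) \<le> 0"
      by (intro LIMSEQ_le_const) auto
    then have "AE x in N. ennreal (min 1 (norm (g t x - F t x))) = 0"
      by (subst (asm) le_zero_eq, subst (asm) nn_integral_0_iff_AE) auto
    then show ?case
    proof eventually_elim
      case (elim x)
      then have "min 1 (norm (g t x - F t x)) \<le> 0" by (simp only: ennreal_eq_0_iff)
      then show ?case by (auto simp: min_def split: if_splits)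
    qed
  qed
  then show ?thesis by (intro exI[of _ g]) auto
qed

section \<open>Representatives of simple and of Bochner measurable functions\<close>

lemma AE_lebesgue_on_iff: "(AE t in lebesgue_on {0..}. P t) \<longleftrightarrow> (AE t in lborel. (t::real) \<ge> 0 \<longrightarrow> P t)"
  by (subst AE_restrict_space_iff) (auto simp: AE_completion_iff)

lemma lebesgue_set_ex_borel:
  assumes "A \<in> sets lebesgue"
  shows "\<exists>B\<in>sets borel. AE t in lborel. t \<in> A \<longleftrightarrow> t \<in> B"
proof -
  obtain S N N' where *: "A = S \<union> N" "N \<subseteq> N'" "N' \<in> null_sets lborel" "S \<in> sets lborel"
    using assms by (rule sets_completionE)
  have "AE t in lborel. t \<notin> N'" using * by (intro AE_not_in)
  then have "AE t in lborel. t \<in> A \<longleftrightarrow> t \<in> S"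
    by eventually_elim (use * in auto)
  then show ?thesis using * by auto
qed

lemma bounded_annulus: "bounded (annulus j)"
  unfolding bounded_iff annulus_def by (auto intro!: exI[of _ "2 powr (of_int j + 1)"])

lemma measurable_annulus_index [measurable]: "(\<lambda>\<xi>::real^3. \<lfloor>log 2 (norm \<xi>)\<rfloor>) \<in> borel \<rightarrow>\<^sub>M count_space UNIV"
  by measurable

lemma annulus_index:
  assumes "\<xi> \<in> annulus j"
  shows "\<lfloor>log 2 (norm \<xi>)\<rfloor> = j"
proof -
  have *: "2 powr (of_int j) \<le> norm \<xi>" "norm \<xi> < 2 powr (of_int j + 1)"
    using assms by (auto simp: annulus_def)
  moreover have "0 < norm \<xi>"
    by (rule less_le_trans[OF _ *(1)]) simp
  ultimately have "of_int j \<le> log 2 (norm \<xi>)" "log 2 (norm \<xi>) < of_int j + 1"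
    by (simp_all add: le_log_iff log_less_iff)
  then show ?thesis by (intro floor_unique)
qed

text \<open>A simple function takes finitely many distributions as values. Its level sets are
  Lebesgue sets and are replaced by Borel sets up to null sets of times, so that the representative
  is Borel in both variables.\<close>

lemma simple_function_FB_representative:
  assumes h: "simple_function (lebesgue_on {0..}) h" and FB: "\<And>t. t \<ge> 0 \<Longrightarrow> h t \<in> FB \<phi> s p q"
  shows "\<exists>u. (\<lambda>(t, \<xi>). u t \<xi>) \<in> borel_measurable borel \<and> (AE t in lborel. (t::real) \<ge> 0 \<longrightarrow> u t = ft (h t))"
proof -
  define Y where "Y = h ` {0..}"
  have fin: "finite Y" using h by (simp add: simple_function_def Y_def)
  have "\<exists>B\<in>sets borel. AE t in lborel. t \<in> h -` {y} \<inter> {0..} \<longleftrightarrow> t \<in> B" if "y \<in> Y" for y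
  proof (rule lebesgue_set_ex_borel)
    have "h -` {y} \<inter> {0..} \<in> sets (lebesgue_on {0..})"
      using h that by (auto simp: simple_function_def Y_def)
    then show "h -` {y} \<inter> {0..} \<in> sets lebesgue"
      by (subst (asm) sets_restrict_space_iff) auto
  qed
  then obtain B where B [measurable]: "\<And>y. y \<in> Y \<Longrightarrow> B y \<in> sets borel"
    and AEB: "\<And>y. y \<in> Y \<Longrightarrow> AE t in lborel. t \<in> h -` {y} \<inter> {0..} \<longleftrightarrow> t \<in> B y"
    by metis
  have ft [measurable]: "ft y \<in> borel_measurable borel" if "y \<in> Y" for y
  proof -
    have "y \<in> FB \<phi> s p q" using that FB by (auto simp: Y_def)
    then have "fourier_rep y (ft y)" by (intro fourier_rep_ft) (auto simp: FB_def)
    then show ?thesis by measurable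
  qed
  define u where "u t \<xi> = (\<Sum>y\<in>Y. indicator (B y) t *\<^sub>R ft y \<xi>)" for t \<xi>
  have "(\<lambda>(t, \<xi>). u t \<xi>) \<in> borel_measurable (borel \<Otimes>\<^sub>M borel)"
    unfolding u_def by measurable
  moreover have "AE t in lborel. \<forall>y\<in>Y. t \<in> h -` {y} \<inter> {0..} \<longleftrightarrow> t \<in> B y"
    using fin AEB by (intro AE_finite_allI) auto
  then have "AE t in lborel. t \<ge> 0 \<longrightarrow> u t = ft (h t)"
  proof eventually_elim
    case (elim t)
    show ?case
    proof (intro impI ext)
      fix \<xi> assume t: "t \<ge> 0"
      have "u t \<xi> = (\<Sum>y\<in>Y. if y = h t then ft y \<xi> else 0)"
        unfolding u_def by (intro sum.cong) (use elim t in \<open>auto simp: indicator_def\<close>)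
      also have "\<dots> = ft (h t) \<xi>" using fin t by (simp add: Y_def)
      finally show "u t \<xi> = ft (h t) \<xi>" .
    qed
  qed
  ultimately show ?thesis by (auto simp: borel_prod)
qed

text \<open>This makes the choice in the definition of \<open>ft_time\<close> meaningful.\<close>

lemma ex_joint_representative:
  assumes \<phi>: "dyadic_partition \<phi>" and p: "1 \<le> p" and q: "1 \<le> q" and f: "f \<in> LFB \<phi> s p q"
  shows "\<exists>g. (\<lambda>(t, \<xi>). g t \<xi>) \<in> borel_measurable borel \<and> (AE t in lebesgue_on {0..}. fourier_rep (f t) (g t))"
proof -
  have FB: "\<And>t. t \<ge> 0 \<Longrightarrow> f t \<in> FB \<phi> s p q" using f by (auto simp: LFB_def)
  then have rep: "fourier_rep (f t) (ft (f t))" if "t \<ge> 0" for t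
    using that by (intro fourier_rep_ft) (auto simp: FB_def)
  then have ftm: "ft (f t) \<in> borel_measurable borel" if "t \<ge> 0" for t
    using that fourier_rep_measurable by blast
  obtain h where h: "\<And>n. simple_function (lebesgue_on {0..}) (h n)" "\<And>n t. t \<ge> 0 \<Longrightarrow> h n t \<in> FB \<phi> s p q"
    and lim: "AE t in lborel. t \<ge> 0 \<longrightarrow> (\<lambda>n. FB_norm \<phi> s p q (\<lambda>\<psi>. h n t \<psi> - f t \<psi>)) \<longlonglongrightarrow> 0"
    using f unfolding LFB_def bochner_measurable_def AE_lebesgue_on_iff by blast
  have "\<forall>n. \<exists>u. (\<lambda>(t, \<xi>). u t \<xi>) \<in> borel_measurable borel \<and> (AE t in lborel. (t::real) \<ge> 0 \<longrightarrow> u t = ft (h n t))"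
    using simple_function_FB_representative[OF h] by blast
  from choice[OF this] obtain u
    where U: "\<forall>n. (\<lambda>(t, \<xi>). u n t \<xi>) \<in> borel_measurable borel \<and> (AE t in lborel. (t::real) \<ge> 0 \<longrightarrow> u n t = ft (h n t))"
    by blast
  have u: "(\<lambda>(t, \<xi>). u n t \<xi>) \<in> borel_measurable (borel \<Otimes>\<^sub>M borel)" for n
    using U unfolding borel_prod by blast
  have uh: "AE t in lborel. (t::real) \<ge> 0 \<longrightarrow> u n t = ft (h n t)" for n
    using U by blast
  have uh': "AE t in lborel. \<forall>n. t \<ge> 0 \<longrightarrow> u n t = ft (h n t)"
    unfolding AE_all_countable using uh by blast
  \<comment> \<open>A positive integrable density gives a finite measure on the half line with the
    null sets of Lebesgue measure, as \<open>jointly_measurable_limit\<close> requires.\<close>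
  obtain \<rho> :: "real \<Rightarrow> ennreal" where \<rho> [measurable]: "\<rho> \<in> borel_measurable borel"
    and \<rho>_fin: "integral\<^sup>N lborel \<rho> \<noteq> \<infinity>" and \<rho>_pos: "\<And>t. 0 < \<rho> t"
    using sigma_finite_measure.Ex_finite_integrable_function[OF lborel.sigma_finite_measure_axioms] by auto
  define M where "M = density lborel (\<lambda>t. \<rho> t * indicator {0..} t)"
  have AEM: "(AE t in M. P t) \<longleftrightarrow> (AE t in lborel. t \<ge> 0 \<longrightarrow> P t)" for P
  proof -
    have "0 < \<rho> t * indicator {0..} t \<longleftrightarrow> 0 \<le> t" for t
      using \<rho>_pos[of t] by (auto simp: indicator_def)
    then show ?thesis unfolding M_def by (subst AE_density) auto
  qed
  have Mfin: "finite_measure M"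
  proof
    have "emeasure M (space M) = (\<integral>\<^sup>+t. \<rho> t * indicator {0..} t \<partial>lborel)"
      unfolding M_def by (subst emeasure_density) (auto intro!: nn_integral_cong)
    also have "\<dots> \<le> integral\<^sup>N lborel \<rho>" by (intro nn_integral_mono) (auto simp: indicator_def)
    also have "\<dots> < \<infinity>" using \<rho>_fin by (simp add: less_top)
    finally show "emeasure M (space M) \<noteq> \<infinity>" by simp
  qed
  \<comment> \<open>On a single annulus the frequency measure is finite, and by Bernstein's
    inequality convergence in the Fourier-Besov norm implies convergence in L^1 there.\<close>
  have local: "\<exists>g. (\<lambda>(t, \<xi>). g t \<xi>) \<in> borel_measurable (M \<Otimes>\<^sub>M density lborel (indicator (annulus j))) \<and>
      (AE t in M. AE \<xi> in density lborel (indicator (annulus j)). g t \<xi> = ft (f t) \<xi>)" for j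
  proof (rule jointly_measurable_limit[OF Mfin])
    show "finite_measure (density lborel (indicator (annulus j)))"
    proof
      have "emeasure lborel (annulus j) < \<infinity>" by (rule emeasure_bounded_finite[OF bounded_annulus])
      then show "emeasure (density lborel (indicator (annulus j))) (space (density lborel (indicator (annulus j)))) \<noteq> \<infinity>"
        by (subst emeasure_density) auto
    qed
    show "(\<lambda>(t, \<xi>). u n t \<xi>) \<in> borel_measurable (M \<Otimes>\<^sub>M density lborel (indicator (annulus j)))" for n
      using u[of n] unfolding M_def by (simp cong: measurable_cong_sets sets_pair_measure_cong)
    show "AE t in M. ft (f t) \<in> borel_measurable (density lborel (indicator (annulus j))) \<and>
      (\<lambda>n. \<integral>\<^sup>+\<xi>. ennreal (min 1 (norm (u n t \<xi> - ft (f t) \<xi>))) \<partial>density lborel (indicator (annulus j))) \<longlonglongrightarrow> 0"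
      unfolding AEM using lim uh'
    proof eventually_elim
      case (elim t)
      show ?case
      proof (intro impI conjI)
        assume t: "0 \<le> t"
        have [measurable]: "ft (f t) \<in> borel_measurable borel" using ftm t .
        have hrep: "fourier_rep (h n t) (ft (h n t))" for n
          using h(2)[OF t] by (intro fourier_rep_ft) (auto simp: FB_def)
        then have [measurable]: "ft (h n t) \<in> borel_measurable borel" for n
          by (rule fourier_rep_measurable)
        have [measurable]: "ft (\<lambda>\<psi>. h n t \<psi> - f t \<psi>) \<in> borel_measurable borel" for n
          using fourier_rep_ft[OF exI, OF fourier_rep_diff[OF hrep rep[OF t]]] by measurable
        show "ft (f t) \<in> borel_measurable (density lborel (indicator (annulus j)))" by simp
        define a where "a n = ann p j (\<lambda>\<xi>. ennreal (norm (ft (\<lambda>\<psi>. h n t \<psi> - f t \<psi>) \<xi>)))" for n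
        have "(\<lambda>n. 64 * exp2 (of_int j * dual_dim p) * exp2 (- (of_int j * s)) *
            (3 * exp2 \<bar>s\<bar> * FB_norm \<phi> s p q (\<lambda>\<psi>. h n t \<psi> - f t \<psi>))) \<longlonglongrightarrow>
            64 * exp2 (of_int j * dual_dim p) * exp2 (- (of_int j * s)) * (3 * exp2 \<bar>s\<bar> * 0)"
          using elim(1) t by (intro ennreal_tendsto_cmult) (auto simp: ennreal_mult_less_top less_top)
        then have *: "(\<lambda>n. 64 * exp2 (of_int j * dual_dim p) * exp2 (- (of_int j * s)) *
            (3 * exp2 \<bar>s\<bar> * FB_norm \<phi> s p q (\<lambda>\<psi>. h n t \<psi> - f t \<psi>))) \<longlonglongrightarrow> 0"
          by simp
        show "(\<lambda>n. \<integral>\<^sup>+\<xi>. ennreal (min 1 (norm (u n t \<xi> - ft (f t) \<xi>))) \<partial>density lborel (indicator (annulus j))) \<longlonglongrightarrow> 0"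
        proof (rule ennreal_tendsto_0_le[OF *], intro always_eventually allI)
          fix n
          have un: "u n t = ft (h n t)" using elim(2) t by simp
          have "(\<integral>\<^sup>+\<xi>. ennreal (min 1 (norm (u n t \<xi> - ft (f t) \<xi>))) \<partial>density lborel (indicator (annulus j)))
              = (\<integral>\<^sup>+\<xi>. indicator (annulus j) \<xi> * ennreal (min 1 (norm (ft (h n t) \<xi> - ft (f t) \<xi>))) \<partial>lborel)"
            unfolding un by (subst nn_integral_density) auto
          also have "\<dots> \<le> (\<integral>\<^sup>+\<xi>. indicator (annulus j) \<xi> * ennreal (norm (ft (\<lambda>\<psi>. h n t \<psi> - f t \<psi>) \<xi>)) \<partial>lborel)"
            using ft_diff[OF hrep[of n] rep[OF t]]
            by (intro nn_integral_mono_AE) (auto elim!: eventually_mono intro!: mult_left_mono ennreal_leI)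
          also have "\<dots> \<le> 64 * exp2 (of_int j * dual_dim p) * a n"
            unfolding a_def by (rule bernstein[OF _ p]) measurable
          also have "a n = exp2 (- (of_int j * s)) * FB_seq s p (ft (\<lambda>\<psi>. h n t \<psi> - f t \<psi>)) j"
            by (simp add: a_def FB_seq_def exp2_mult_cancel)
          also have "\<dots> \<le> exp2 (- (of_int j * s)) * (3 * exp2 \<bar>s\<bar> * FB_norm \<phi> s p q (\<lambda>\<psi>. h n t \<psi> - f t \<psi>))"
            unfolding FB_norm_def
            by (intro mult_left_mono order_trans[OF le_ell[OF q] ell_FB_seq_le[OF \<phi> _ p q]]) auto
          finally show "(\<integral>\<^sup>+\<xi>. ennreal (min 1 (norm (u n t \<xi> - ft (f t) \<xi>))) \<partial>density lborel (indicator (annulus j)))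
            \<le> 64 * exp2 (of_int j * dual_dim p) * exp2 (- (of_int j * s)) *
            (3 * exp2 \<bar>s\<bar> * FB_norm \<phi> s p q (\<lambda>\<psi>. h n t \<psi> - f t \<psi>))"
            by (simp add: mult_left_mono mult.assoc)
        qed
      qed
    qed
  qed
  have "\<forall>j. \<exists>g. (\<lambda>(t, \<xi>). g t \<xi>) \<in> borel_measurable (M \<Otimes>\<^sub>M density lborel (indicator (annulus j))) \<and>
      (AE t in M. AE \<xi> in density lborel (indicator (annulus j)). g t \<xi> = ft (f t) \<xi>)"
    using local by blast
  from choice[OF this] obtain G
    where GG: "\<forall>j. (\<lambda>(t, \<xi>). G j t \<xi>) \<in> borel_measurable (M \<Otimes>\<^sub>M density lborel (indicator (annulus j))) \<and>
      (AE t in M. AE \<xi> in density lborel (indicator (annulus j)). G j t \<xi> = ft (f t) \<xi>)"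
    by blast
  have G: "(\<lambda>(t, \<xi>). G j t \<xi>) \<in> borel_measurable (M \<Otimes>\<^sub>M density lborel (indicator (annulus j)))" for j
    using GG by blast
  have Gf: "AE t in M. AE \<xi> in density lborel (indicator (annulus j)). G j t \<xi> = ft (f t) \<xi>" for j
    using GG by blast
  have [measurable]: "(\<lambda>(t, \<xi>). G j t \<xi>) \<in> borel_measurable (borel \<Otimes>\<^sub>M borel)" for j
    using G[of j] unfolding M_def by (simp cong: measurable_cong_sets sets_pair_measure_cong)
  \<comment> \<open>The pieces are glued by reading off from \<xi> the index of its annulus. The
    countably many exceptional sets of times are united beforehand.\<close>
  define g where "g t \<xi> = G \<lfloor>log 2 (norm \<xi>)\<rfloor> t \<xi>" for t \<xi>
  have g [measurable]: "(\<lambda>(t, \<xi>). g t \<xi>) \<in> borel_measurable (borel \<Otimes>\<^sub>M borel)"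
  proof -
    have "(\<lambda>x. (\<lambda>j x. G j (fst x) (snd x)) \<lfloor>log 2 (norm (snd x))\<rfloor> x) \<in> borel_measurable (borel \<Otimes>\<^sub>M borel)"
      by (rule measurable_compose_countable) measurable
    then show ?thesis by (simp add: g_def case_prod_beta)
  qed
  have [measurable]: "g t \<in> borel_measurable borel" for t
    using measurable_compose[OF measurable_Pair1'[of t borel borel] g] by simp
  have "AE t in M. \<forall>j. AE \<xi> in density lborel (indicator (annulus j)). G j t \<xi> = ft (f t) \<xi>"
    unfolding AE_all_countable using Gf by blast
  then have "AE t in lborel. t \<ge> 0 \<longrightarrow> fourier_rep (f t) (g t)"
    unfolding AEM
  proof eventually_elim
    case (elim t)
    show ?case
    proof
      assume t: "0 \<le> t"
      have "AE \<xi> in lborel. \<forall>j. \<xi> \<in> annulus j \<longrightarrow> G j t \<xi> = ft (f t) \<xi>"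
        unfolding AE_all_countable
      proof
        fix j
        have "AE \<xi> in density lborel (indicator (annulus j)). G j t \<xi> = ft (f t) \<xi>"
          using elim t by blast
        then show "AE \<xi> in lborel. \<xi> \<in> annulus j \<longrightarrow> G j t \<xi> = ft (f t) \<xi>"
          by (subst (asm) AE_density) (auto simp: indicator_def)
      qed
      moreover have "AE \<xi> in lborel. (\<xi>::real^3) \<noteq> 0" by (rule AE_lborel_singleton)
      ultimately have "AE \<xi> in lborel. ft (f t) \<xi> = g t \<xi>"
      proof eventually_elim
        case (elim \<xi>)
        obtain j where "\<xi> \<in> annulus j" using ex_annulus[OF elim(2)] by blast
        then show ?case using elim(1) by (simp add: g_def annulus_index)
      qed
      then show "fourier_rep (f t) (g t)"
        by (intro fourier_rep_cong_AE[OF rep[OF t]]) auto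
    qed
  qed
  then show ?thesis using g by (auto simp: AE_lebesgue_on_iff borel_prod)
qed

lemma ft_time:
  assumes \<phi>: "dyadic_partition \<phi>" and p: "1 \<le> p" and q: "1 \<le> q" and f: "f \<in> LFB \<phi> s p q"
  shows "(\<lambda>(t, \<xi>). ft_time f t \<xi>) \<in> borel_measurable borel"
    and "AE t in lebesgue_on {0..}. fourier_rep (f t) (ft_time f t)"
  using someI_ex[OF ex_joint_representative[OF assms]] unfolding ft_time_def by blast+

section \<open>Symbols\<close>

lemma measurable_vec_lambda [measurable (raw)]:
  fixes f :: "'n::finite \<Rightarrow> 'a \<Rightarrow> 'b::euclidean_space"
  assumes [measurable]: "\<And>i. f i \<in> borel_measurable M"
  shows "(\<lambda>x. \<chi> i. f i x) \<in> borel_measurable M"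
proof (subst borel_measurable_euclidean_space, intro ballI)
  fix b :: "'b^'n" assume "b \<in> Basis"
  then obtain i u where "b = axis i u" by (auto simp: Basis_vec_def)
  then show "(\<lambda>x. (\<chi> i. f i x) \<bullet> b) \<in> borel_measurable M"
    by (simp add: inner_axis)
qed

lemma measurable_vec_nth [measurable (raw)]:
  fixes f :: "'a \<Rightarrow> 'b::euclidean_space^'n"
  assumes [measurable]: "f \<in> borel_measurable M"
  shows "(\<lambda>x. f x $ i) \<in> borel_measurable M"
proof -
  have "continuous_on UNIV (\<lambda>v :: 'b^'n. v $ i)"
    by (intro continuous_on_component continuous_on_id)
  then show ?thesis
    by (intro measurable_compose[OF assms borel_measurable_continuous_onI])
qed

lemma measurable_matrix_vector_mult:
  fixes A :: "'a \<Rightarrow> complex^3^3"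
  assumes [measurable]: "\<And>i j. (\<lambda>x. A x $ i $ j) \<in> borel_measurable M" "v \<in> borel_measurable M"
  shows "(\<lambda>x. A x *v v x) \<in> borel_measurable M"
  unfolding matrix_vector_mult_def by measurable

lemma measurable_vector_matrix_mult:
  fixes A :: "'a \<Rightarrow> complex^3^3"
  assumes [measurable]: "\<And>i j. (\<lambda>x. A x $ i $ j) \<in> borel_measurable M" "v \<in> borel_measurable M"
  shows "(\<lambda>x. v x v* A x) \<in> borel_measurable M"
  unfolding vector_matrix_mult_def by measurable

section \<open>Bounds and measurability of the matrix symbols\<close>

lemma norm_le_sum_components: "norm (x :: complex^3) \<le> (\<Sum>i\<in>UNIV. norm (x $ i))"
  unfolding norm_vec_def by (rule L2_set_le_sum) simp

text \<open>Nine entries of size at most \<open>B\<close>; the loss against the operator norm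
  affects only numerical constants.\<close>

lemma norm_matrix_vector_le:
  fixes A :: "complex^3^3"
  assumes "\<And>i j. norm (A $ i $ j) \<le> B"
  shows "norm (A *v v) \<le> 9 * B * norm v"
proof -
  have "norm (A *v v) \<le> (\<Sum>i\<in>UNIV. norm ((A *v v) $ i))" by (rule norm_le_sum_components)
  also have "\<dots> \<le> (\<Sum>i\<in>(UNIV::3 set). \<Sum>j\<in>(UNIV::3 set). B * norm v)"
    unfolding matrix_vector_mult_def vec_lambda_beta
    using assms by (intro sum_mono order_trans[OF norm_sum])
      (auto simp: norm_mult intro!: sum_mono mult_mono Finite_Cartesian_Product.norm_nth_le order_trans[OF norm_ge_zero])
  also have "\<dots> = 9 * B * norm v" by simp
  finally show ?thesis .
qed

lemma norm_vector_matrix_le: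
  fixes A :: "complex^3^3"
  assumes "\<And>i j. norm (A $ i $ j) \<le> B"
  shows "norm (v v* A) \<le> 9 * B * norm v"
proof -
  have "norm (transpose A $ i $ j) \<le> B" for i j
    using assms by (simp add: transpose_def)
  from norm_matrix_vector_le[OF this, of v] show ?thesis
    by (simp add: transpose_matrix_vector)
qed

text \<open>A uniform shape for the nine entries, from which both the bound by 1 and the
  measurability are read off without a case distinction.\<close>

lemma coriolis_entry: "\<exists>c k. \<bar>c\<bar> \<le> 1 \<and> (\<forall>\<xi>. coriolis_matrix \<xi> $ i $ j = c * (\<xi> $ k / norm \<xi>))"
proof -
  have eqs: "coriolis_matrix \<xi> $ 1 $ 1 = 0" "coriolis_matrix \<xi> $ 1 $ 2 = \<xi>$3 / norm \<xi>"
    "coriolis_matrix \<xi> $ 1 $ 3 = - (\<xi>$2 / norm \<xi>)" "coriolis_matrix \<xi> $ 2 $ 1 = - (\<xi>$3 / norm \<xi>)"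
    "coriolis_matrix \<xi> $ 2 $ 2 = 0" "coriolis_matrix \<xi> $ 2 $ 3 = \<xi>$1 / norm \<xi>"
    "coriolis_matrix \<xi> $ 3 $ 1 = \<xi>$2 / norm \<xi>" "coriolis_matrix \<xi> $ 3 $ 2 = - (\<xi>$1 / norm \<xi>)"
    "coriolis_matrix \<xi> $ 3 $ 3 = 0" for \<xi>
    by (simp_all add: coriolis_matrix_def)
  have z: "\<exists>c k. \<bar>c\<bar> \<le> 1 \<and> (\<forall>\<xi>::real^3. 0 = c * (\<xi> $ k / norm \<xi>))"
    by (intro exI[of _ 0]) simp
  have p: "\<exists>c k. \<bar>c\<bar> \<le> 1 \<and> (\<forall>\<xi>::real^3. \<xi> $ l / norm \<xi> = c * (\<xi> $ k / norm \<xi>))" for l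
    by (intro exI[of _ 1] exI[of _ l]) simp
  have n: "\<exists>c k. \<bar>c\<bar> \<le> 1 \<and> (\<forall>\<xi>::real^3. - (\<xi> $ l / norm \<xi>) = c * (\<xi> $ k / norm \<xi>))" for l
    by (intro exI[of _ "-1"] exI[of _ l]) simp
  show ?thesis
    using exhaust_3[of i] exhaust_3[of j] by (elim disjE) (simp_all only: eqs z p n)
qed

lemma coriolis_entry_bound: "\<bar>coriolis_matrix \<xi> $ i $ j\<bar> \<le> 1"
proof -
  obtain c k where "\<bar>c\<bar> \<le> 1" and e: "coriolis_matrix \<xi> $ i $ j = c * (\<xi> $ k / norm \<xi>)"
    using coriolis_entry by blast
  moreover have "\<bar>\<xi> $ k / norm \<xi>\<bar> \<le> 1"
    using component_le_norm_cart[of \<xi> k] by (simp add: divide_le_eq_1)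
  ultimately show ?thesis
    unfolding e abs_mult by (intro mult_le_one) auto
qed

lemma measurable_coriolis [measurable]: "(\<lambda>\<xi>. coriolis_matrix \<xi> $ i $ j) \<in> borel_measurable borel"
proof -
  obtain c k where "\<forall>\<xi>. coriolis_matrix \<xi> $ i $ j = c * (\<xi> $ k / norm \<xi>)"
    using coriolis_entry by blast
  then show ?thesis by simp
qed

definition decay :: "real \<Rightarrow> real \<Rightarrow> real \<Rightarrow> real^3 \<Rightarrow> real" where
  "decay \<nu> \<alpha> t \<xi> = exp (- \<nu> * norm \<xi> powr (2 * \<alpha>) * t)"

lemma semigroup_entry: "semigroup_symbol \<nu> \<Omega> \<alpha> t \<xi> $ i $ j = complex_of_real (decay \<nu> \<alpha> t \<xi> *
    (cos (\<Omega> * (\<xi>$3 / norm \<xi>) * t) * (if i = j then 1 else 0) + sin (\<Omega> * (\<xi>$3 / norm \<xi>) * t) * coriolis_matrix \<xi> $ i $ j))"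
  by (simp add: semigroup_symbol_def map_matrix_def mat_def decay_def)

lemma semigroup_entry_bound: "norm (semigroup_symbol \<nu> \<Omega> \<alpha> t \<xi> $ i $ j) \<le> 2 * decay \<nu> \<alpha> t \<xi>"
proof -
  let ?a = "\<Omega> * (\<xi>$3 / norm \<xi>) * t"
  have "\<bar>cos ?a * (if i = j then 1 else 0) + sin ?a * coriolis_matrix \<xi> $ i $ j\<bar>
      \<le> \<bar>cos ?a\<bar> * \<bar>if i = j then 1 else 0\<bar> + \<bar>sin ?a\<bar> * \<bar>coriolis_matrix \<xi> $ i $ j\<bar>"
    unfolding abs_mult[symmetric] by (rule abs_triangle_ineq)
  also have "\<dots> \<le> 1 * 1 + 1 * 1"
    by (intro add_mono mult_mono coriolis_entry_bound) auto
  finally have "decay \<nu> \<alpha> t \<xi> * \<bar>cos ?a * (if i = j then 1 else 0) + sin ?a * coriolis_matrix \<xi> $ i $ j\<bar>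
      \<le> decay \<nu> \<alpha> t \<xi> * 2"
    by (intro mult_left_mono) (auto simp: decay_def)
  then show ?thesis
    unfolding semigroup_entry norm_of_real abs_mult by (simp add: decay_def)
qed

text \<open>Nine entries, each at most twice the heat factor: one part for the cosine and one for
  the sine. The bound also holds at \<xi> = 0, where the quotients have the value 0.\<close>

lemma norm_semigroup_le: "norm (semigroup_symbol \<nu> \<Omega> \<alpha> t \<xi> *v v) \<le> 18 * decay \<nu> \<alpha> t \<xi> * norm v"
  using norm_matrix_vector_le[of "semigroup_symbol \<nu> \<Omega> \<alpha> t \<xi>" "2 * decay \<nu> \<alpha> t \<xi>" v]
    semigroup_entry_bound by simp

lemma leray_entry: "leray_symbol \<xi> $ i $ j = complex_of_real ((if i = j then 1 else 0) - \<xi>$i * \<xi>$j / (norm \<xi>)\<^sup>2)"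
  by (simp add: leray_symbol_def map_matrix_def)

lemma norm_leray_le: "norm (leray_symbol \<xi> *v v) \<le> 18 * norm v"
proof -
  have "norm (leray_symbol \<xi> $ i $ j) \<le> 2" for i j
  proof -
    have "\<bar>\<xi>$i * \<xi>$j / (norm \<xi>)\<^sup>2\<bar> \<le> 1"
      using mult_mono[OF component_le_norm_cart[of \<xi> i] component_le_norm_cart[of \<xi> j]]
      by (cases "\<xi> = 0") (simp_all add: divide_le_eq_1 abs_mult power2_eq_square)
    then have "\<bar>if i = j then 1 else (0::real)\<bar> + \<bar>\<xi>$i * \<xi>$j / (norm \<xi>)\<^sup>2\<bar> \<le> 1 + 1"
      by (intro add_mono) simp_all
    then have "\<bar>(if i = j then 1 else 0) - \<xi>$i * \<xi>$j / (norm \<xi>)\<^sup>2\<bar> \<le> 2"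
      using abs_triangle_ineq4[of "if i = j then 1 else 0" "\<xi>$i * \<xi>$j / (norm \<xi>)\<^sup>2"] by linarith
    then show ?thesis unfolding leray_entry norm_of_real .
  qed
  from norm_matrix_vector_le[OF this, of v] show ?thesis by simp
qed

definition duhamel_kernel :: "real \<Rightarrow> real \<Rightarrow> real \<Rightarrow> real \<Rightarrow> real^3 \<Rightarrow> complex^3 \<Rightarrow> complex^3" where
  "duhamel_kernel \<nu> \<Omega> \<alpha> t \<xi> v = semigroup_symbol \<nu> \<Omega> \<alpha> t \<xi> *v (leray_symbol \<xi> *v v)"

lemma norm_duhamel_kernel_le: "norm (duhamel_kernel \<nu> \<Omega> \<alpha> t \<xi> v) \<le> 324 * decay \<nu> \<alpha> t \<xi> * norm v"
proof -
  have "norm (duhamel_kernel \<nu> \<Omega> \<alpha> t \<xi> v) \<le> 18 * decay \<nu> \<alpha> t \<xi> * norm (leray_symbol \<xi> *v v)"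
    unfolding duhamel_kernel_def by (rule norm_semigroup_le)
  also have "\<dots> \<le> 18 * decay \<nu> \<alpha> t \<xi> * (18 * norm v)"
    by (intro mult_left_mono norm_leray_le) (simp add: decay_def)
  finally show ?thesis by simp
qed

lemma duhamel_kernel_diff:
  "duhamel_kernel \<nu> \<Omega> \<alpha> t \<xi> v - duhamel_kernel \<nu> \<Omega> \<alpha> t \<xi> w = duhamel_kernel \<nu> \<Omega> \<alpha> t \<xi> (v - w)"
  by (simp add: duhamel_kernel_def matrix_vector_mult_diff_distrib)

lemma measurable_decay [measurable (raw)]:
  assumes [measurable]: "f \<in> borel_measurable M" "g \<in> borel_measurable M"
  shows "(\<lambda>x. decay \<nu> \<alpha> (f x) (g x)) \<in> borel_measurable M"
  unfolding decay_def by measurable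

lemma measurable_semigroup:
  assumes [measurable]: "f \<in> borel_measurable M" "g \<in> borel_measurable M" "h \<in> borel_measurable M"
  shows "(\<lambda>x. semigroup_symbol \<nu> \<Omega> \<alpha> (f x) (g x) *v h x) \<in> borel_measurable M"
proof (rule measurable_matrix_vector_mult)
  have [measurable]: "(\<lambda>x. coriolis_matrix (g x) $ i $ j) \<in> borel_measurable M" for i j
    by (rule measurable_compose[OF assms(2) measurable_coriolis])
  show "(\<lambda>x. semigroup_symbol \<nu> \<Omega> \<alpha> (f x) (g x) $ i $ j) \<in> borel_measurable M" for i j
    unfolding semigroup_entry by measurable
qed simp

lemma measurable_duhamel_kernel [measurable (raw)]:
  assumes [measurable]: "f \<in> borel_measurable M" "g \<in> borel_measurable M" "h \<in> borel_measurable M"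
  shows "(\<lambda>x. duhamel_kernel \<nu> \<Omega> \<alpha> (f x) (g x) (h x)) \<in> borel_measurable M"
  unfolding duhamel_kernel_def
proof (intro measurable_semigroup measurable_matrix_vector_mult)
  show "(\<lambda>x. leray_symbol (g x) $ i $ j) \<in> borel_measurable M" for i j
    unfolding leray_entry by measurable
qed simp_all

section \<open>The quadratic term in Fourier variables\<close>

abbreviation mag :: "(real^3 \<Rightarrow> complex^3) \<Rightarrow> real^3 \<Rightarrow> ennreal" where
  "mag f \<equiv> \<lambda>\<xi>. ennreal (norm (f \<xi>))"

lemma norm_integral_le_nn_integral:
  fixes f :: "'a \<Rightarrow> 'b::{banach, second_countable_topology}"
  shows "ennreal (norm (integral\<^sup>L M f)) \<le> (\<integral>\<^sup>+x. ennreal (norm (f x)) \<partial>M)"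
  by (cases "integrable M f") (simp_all add: integral_norm_bound_ennreal not_integrable_integral_eq)

lemma tensor_integrable:
  assumes [measurable]: "g \<in> borel_measurable borel" "h \<in> borel_measurable borel"
    and fin: "conv (mag g) (mag h) \<xi> < top"
  shows "integrable lborel (\<lambda>\<eta>. g (\<xi> - \<eta>) $ m * h \<eta> $ k)"
proof (rule integrableI_bounded)
  have "(\<integral>\<^sup>+\<eta>. ennreal (norm (g (\<xi> - \<eta>) $ m * h \<eta> $ k)) \<partial>lborel) \<le> conv (mag g) (mag h) \<xi>"
    unfolding conv_def
    by (intro nn_integral_mono)
      (auto simp: norm_mult Finite_Cartesian_Product.norm_nth_le intro!: mult_mono ennreal_leI simp flip: ennreal_mult)
  then show "(\<integral>\<^sup>+\<eta>. ennreal (norm (g (\<xi> - \<eta>) $ m * h \<eta> $ k)) \<partial>lborel) < \<infinity>"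
    using fin by (auto simp: less_top)
qed measurable

lemma norm_tensor_le:
  assumes "\<And>m k. ennreal (norm (A $ m $ k)) \<le> c"
  shows "ennreal (norm ((\<chi> m. \<i> * complex_of_real (\<xi>$m)) v* (A :: complex^3^3))) \<le> 27 * (ennreal (norm \<xi>) * c)"
proof (cases c)
  case (real b)
  then have "norm (A $ m $ k) \<le> b" for m k using assms[of m k] by simp
  then have 1: "norm ((\<chi> m. \<i> * complex_of_real (\<xi>$m)) v* A) \<le> 9 * b * norm (\<chi> m. \<i> * complex_of_real (\<xi>$m))"
    by (rule norm_vector_matrix_le)
  have 2: "norm (\<chi> m. \<i> * complex_of_real (\<xi>$m)) \<le> 3 * norm \<xi>"
  proof -
    have "norm (\<chi> m. \<i> * complex_of_real (\<xi>$m)) \<le> (\<Sum>m\<in>UNIV. \<bar>\<xi> $ m\<bar>)"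
      using norm_le_sum_components[of "\<chi> m. \<i> * complex_of_real (\<xi>$m)"] by (simp add: norm_mult)
    also have "\<dots> \<le> (\<Sum>m\<in>(UNIV::3 set). norm \<xi>)"
      by (intro sum_mono component_le_norm_cart)
    finally show ?thesis by simp
  qed
  have "9 * b * norm (\<chi> m. \<i> * complex_of_real (\<xi>$m)) \<le> 9 * b * (3 * norm \<xi>)"
    using 2 real by (intro mult_left_mono) auto
  with 1 have "norm ((\<chi> m. \<i> * complex_of_real (\<xi>$m)) v* A) \<le> 27 * (norm \<xi> * b)"
    by (simp add: mult_ac)
  then show ?thesis
    using real by (metis ennreal_leI ennreal_mult ennreal_numeral norm_ge_zero mult_nonneg_nonneg zero_le_numeral)
next
  case top
  show ?thesis
  \<comment> \<open>The right side is infinite except at the origin, where the product with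
    \<open>top\<close> is 0; there the left side vanishes as well.\<close>
  proof (cases "\<xi> = 0")
    case True
    then have "(\<chi> m. \<i> * complex_of_real (\<xi>$m)) v* A = 0"
      by (simp add: vector_matrix_mult_def vec_eq_iff)
    then show ?thesis by simp
  next
    case False
    then show ?thesis using top by (simp add: ennreal_mult_top)
  qed
qed

lemma norm_div_tensor_le:
  "ennreal (norm (div_tensor_ft g h \<xi>)) \<le> 27 * (ennreal (norm \<xi>) * conv (mag g) (mag h) \<xi>)"
  unfolding div_tensor_ft_def
proof (rule norm_tensor_le)
  fix m k
  have "ennreal (norm (tensor_ft g h \<xi> $ m $ k)) \<le> (\<integral>\<^sup>+\<eta>. ennreal (norm (g (\<xi> - \<eta>) $ m * h \<eta> $ k)) \<partial>lborel)"
    unfolding tensor_ft_def by (simp add: norm_integral_le_nn_integral)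
  also have "\<dots> \<le> conv (mag g) (mag h) \<xi>"
    unfolding conv_def
    by (intro nn_integral_mono)
      (auto simp: norm_mult Finite_Cartesian_Product.norm_nth_le intro!: mult_mono ennreal_leI simp flip: ennreal_mult)
  finally show "ennreal (norm (tensor_ft g h \<xi> $ m $ k)) \<le> conv (mag g) (mag h) \<xi>" .
qed

text \<open>With D = g - w, the identity g \<otimes> g - w \<otimes> w = D \<otimes> g + w \<otimes>
  D. The convolutions must be finite for the difference of the two integrals to be the integral of
  the difference.\<close>

lemma norm_div_tensor_diff_le:
  assumes [measurable]: "g \<in> borel_measurable borel" "w \<in> borel_measurable borel"
    and fin: "conv (mag g) (mag g) \<xi> < top" "conv (mag w) (mag w) \<xi> < top"
  shows "ennreal (norm (div_tensor_ft g g \<xi> - div_tensor_ft w w \<xi>))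
    \<le> 27 * (ennreal (norm \<xi>) * (conv (mag (\<lambda>\<xi>. g \<xi> - w \<xi>)) (mag g) \<xi> + conv (mag w) (mag (\<lambda>\<xi>. g \<xi> - w \<xi>)) \<xi>))"
  unfolding div_tensor_ft_def vector_matrix_mult_diff_rdistrib[symmetric]
proof (rule norm_tensor_le)
  fix m k
  let ?D = "\<lambda>\<xi>. g \<xi> - w \<xi>"
  have "(tensor_ft g g \<xi> - tensor_ft w w \<xi>) $ m $ k
      = (LINT \<eta>|lborel. g (\<xi> - \<eta>) $ m * g \<eta> $ k - w (\<xi> - \<eta>) $ m * w \<eta> $ k)"
    unfolding tensor_ft_def using tensor_integrable[OF _ _ fin(1)] tensor_integrable[OF _ _ fin(2)]
    by (simp add: Bochner_Integration.integral_diff)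
  then have "ennreal (norm ((tensor_ft g g \<xi> - tensor_ft w w \<xi>) $ m $ k))
      \<le> (\<integral>\<^sup>+\<eta>. ennreal (norm (g (\<xi> - \<eta>) $ m * g \<eta> $ k - w (\<xi> - \<eta>) $ m * w \<eta> $ k)) \<partial>lborel)"
    by (simp add: norm_integral_le_nn_integral)
  also have "\<dots> \<le> (\<integral>\<^sup>+\<eta>. mag ?D (\<xi> - \<eta>) * mag g \<eta> + mag w (\<xi> - \<eta>) * mag ?D \<eta> \<partial>lborel)"
  proof (rule nn_integral_mono)
    fix \<eta>
    have "g (\<xi> - \<eta>) $ m * g \<eta> $ k - w (\<xi> - \<eta>) $ m * w \<eta> $ k
        = ?D (\<xi> - \<eta>) $ m * g \<eta> $ k + w (\<xi> - \<eta>) $ m * ?D \<eta> $ k"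
      by (simp add: algebra_simps)
    also have "norm \<dots> \<le> norm (?D (\<xi> - \<eta>) $ m) * norm (g \<eta> $ k) + norm (w (\<xi> - \<eta>) $ m) * norm (?D \<eta> $ k)"
      unfolding norm_mult[symmetric] by (rule norm_triangle_ineq)
    also have "\<dots> \<le> norm (?D (\<xi> - \<eta>)) * norm (g \<eta>) + norm (w (\<xi> - \<eta>)) * norm (?D \<eta>)"
      by (intro add_mono mult_mono Finite_Cartesian_Product.norm_nth_le) auto
    finally have "ennreal (norm (g (\<xi> - \<eta>) $ m * g \<eta> $ k - w (\<xi> - \<eta>) $ m * w \<eta> $ k))
      \<le> ennreal (norm (?D (\<xi> - \<eta>)) * norm (g \<eta>) + norm (w (\<xi> - \<eta>)) * norm (?D \<eta>))"
      by (rule ennreal_leI)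
    then show "ennreal (norm (g (\<xi> - \<eta>) $ m * g \<eta> $ k - w (\<xi> - \<eta>) $ m * w \<eta> $ k))
      \<le> mag ?D (\<xi> - \<eta>) * mag g \<eta> + mag w (\<xi> - \<eta>) * mag ?D \<eta>"
      by (simp add: ennreal_mult)
  qed
  also have "\<dots> = conv (mag ?D) (mag g) \<xi> + conv (mag w) (mag ?D) \<xi>"
    unfolding conv_def by (rule nn_integral_add) measurable
  finally show "ennreal (norm ((tensor_ft g g \<xi> - tensor_ft w w \<xi>) $ m $ k)) \<le> conv (mag ?D) (mag g) \<xi> + conv (mag w) (mag ?D) \<xi>" .
qed

section \<open>The difference of two Duhamel formulas\<close>

lemma measurable_uncurry:
  fixes f :: "'s::second_countable_topology \<Rightarrow> 't::second_countable_topology \<Rightarrow> 'c::topological_space"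
  assumes f: "(\<lambda>(s, x). f s x) \<in> borel_measurable borel"
    and [measurable]: "g \<in> borel_measurable M" "h \<in> borel_measurable M"
  shows "(\<lambda>x. f (g x) (h x)) \<in> borel_measurable M"
proof -
  have "(\<lambda>x. (g x, h x)) \<in> M \<rightarrow>\<^sub>M borel" unfolding borel_prod[symmetric] by measurable
  from measurable_compose[OF this f] show ?thesis by simp
qed

lemma measurable_conv_time:
  fixes a b :: "real \<Rightarrow> real^3 \<Rightarrow> ennreal"
  assumes a: "(\<lambda>(s, x). a s x) \<in> borel_measurable borel" and b: "(\<lambda>(s, x). b s x) \<in> borel_measurable borel"
    and [measurable]: "f \<in> borel_measurable M" "g \<in> borel_measurable M"
  shows "(\<lambda>x. conv (a (f x)) (b (f x)) (g x)) \<in> borel_measurable M"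
proof -
  have "(\<lambda>(x, \<eta>). a (f x) (g x - \<eta>)) \<in> borel_measurable (M \<Otimes>\<^sub>M lborel)"
    "(\<lambda>(x, \<eta>). b (f x) \<eta>) \<in> borel_measurable (M \<Otimes>\<^sub>M lborel)"
    unfolding case_prod_beta' by (intro measurable_uncurry[OF a] measurable_uncurry[OF b]; measurable)+
  then show ?thesis unfolding conv_def by measurable
qed

lemma measurable_div_tensor_time:
  fixes V :: "real \<Rightarrow> real^3 \<Rightarrow> complex^3"
  assumes V: "(\<lambda>(s, x). V s x) \<in> borel_measurable borel"
    and [measurable]: "f \<in> borel_measurable M" "g \<in> borel_measurable M"
  shows "(\<lambda>x. div_tensor_ft (V (f x)) (V (f x)) (g x)) \<in> borel_measurable M"
  unfolding div_tensor_ft_def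
proof (rule measurable_vector_matrix_mult)
  have [measurable]: "(\<lambda>(x, \<eta>). V (f x) (g x - \<eta>)) \<in> borel_measurable (M \<Otimes>\<^sub>M lborel)"
    "(\<lambda>(x, \<eta>). V (f x) \<eta>) \<in> borel_measurable (M \<Otimes>\<^sub>M lborel)"
    unfolding case_prod_beta' by (intro measurable_uncurry[OF V]; measurable)+
  have "(\<lambda>(x, \<eta>). V (f x) (g x - \<eta>) $ i * V (f x) \<eta> $ j) \<in> borel_measurable (M \<Otimes>\<^sub>M lborel)" for i j
    by measurable
  then show "(\<lambda>x. tensor_ft (V (f x)) (V (f x)) (g x) $ i $ j) \<in> borel_measurable M" for i j
    unfolding tensor_ft_def vec_lambda_beta by (rule lborel.borel_measurable_lebesgue_integral)
qed measurable

text \<open>By Bernstein's inequality \<open>f\<close> is integrable over each annulus, hence finite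
  almost everywhere on each of them.\<close>

lemma ann_finite_AE:
  assumes [measurable]: "f \<in> borel_measurable borel" and p: "1 \<le> p" and fin: "\<And>j. ann p j f < top"
  shows "AE \<xi> in lborel. f \<xi> < top"
proof -
  have "AE \<xi> in lborel. \<forall>j. indicator (annulus j) \<xi> * f \<xi> \<noteq> \<infinity>"
    unfolding AE_all_countable
  proof
    fix j
    have "(\<integral>\<^sup>+\<xi>. indicator (annulus j) \<xi> * f \<xi> \<partial>lborel) \<le> 64 * exp2 (of_int j * dual_dim p) * ann p j f"
      by (rule bernstein[OF _ p]) simp
    also have "\<dots> < top" using fin by (simp add: ennreal_mult_less_top)
    finally show "AE \<xi> in lborel. indicator (annulus j) \<xi> * f \<xi> \<noteq> \<infinity>"
      by (intro nn_integral_PInf_AE) auto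
  qed
  moreover have "AE \<xi> in lborel. (\<xi>::real^3) \<noteq> 0" by (rule AE_lborel_singleton)
  ultimately show ?thesis
  proof eventually_elim
    case (elim \<xi>)
    obtain j where "\<xi> \<in> annulus j" using ex_annulus[OF elim(2)] by blast
    then show ?case using elim(1)[rule_format, of j] by (simp add: less_top)
  qed
qed

text \<open>The stationary equation has S(\<tau>) in its forcing term and the mild equation S(t -
  \<tau>); this substitution brings both to one form.\<close>

lemma set_integral_reflect:
  fixes f :: "real \<Rightarrow> 'a::{banach, second_countable_topology}"
  assumes [measurable]: "f \<in> borel_measurable borel"
  shows "(LINT \<tau>:{0..t}|lborel. f \<tau>) = (LINT \<tau>:{0..t}|lborel. f (t - \<tau>))"
proof -
  have "(LINT \<tau>:{0..t}|lborel. f \<tau>) = (LINT \<tau>|distr lborel borel (\<lambda>\<tau>. t - \<tau>). indicator {0..t} \<tau> *\<^sub>R f \<tau>)"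
    by (simp add: set_lebesgue_integral_def lborel_eq_distr_reflect[symmetric])
  also have "\<dots> = (LINT \<tau>|lborel. indicator {0..t} (t - \<tau>) *\<^sub>R f (t - \<tau>))"
    by (rule integral_distr) measurable
  also have "\<dots> = (LINT \<tau>:{0..t}|lborel. f (t - \<tau>))"
    unfolding set_lebesgue_integral_def by (intro Bochner_Integration.integral_cong) (auto simp: indicator_def)
  finally show ?thesis .
qed

lemma norm_set_integral_diff_le:
  fixes f g :: "'a \<Rightarrow> 'b::{banach, second_countable_topology}"
  assumes "set_integrable M A f" "set_integrable M A g"
    and le: "AE x in M. x \<in> A \<longrightarrow> ennreal (norm (f x - g x)) \<le> b x"
  shows "ennreal (norm ((LINT x:A|M. f x) - (LINT x:A|M. g x))) \<le> (\<integral>\<^sup>+x. indicator A x * b x \<partial>M)"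
proof -
  have "(LINT x:A|M. f x) - (LINT x:A|M. g x) = (LINT x:A|M. f x - g x)"
    using assms by (simp add: set_integral_diff)
  then have "ennreal (norm ((LINT x:A|M. f x) - (LINT x:A|M. g x))) \<le> (\<integral>\<^sup>+x. ennreal (norm (indicator A x *\<^sub>R (f x - g x))) \<partial>M)"
    by (simp only: set_lebesgue_integral_def norm_integral_le_nn_integral)
  also have "\<dots> \<le> (\<integral>\<^sup>+x. indicator A x * b x \<partial>M)"
    using le by (intro nn_integral_mono_AE) (auto elim!: eventually_mono simp: indicator_def)
  finally show ?thesis .
qed

lemma set_integrable_if_bound:
  fixes f :: "'a \<Rightarrow> 'b::{banach, second_countable_topology}"
  assumes "f \<in> borel_measurable M" "A \<in> sets M" "b \<in> borel_measurable M"
    and le: "\<And>x. x \<in> A \<Longrightarrow> ennreal (norm (f x)) \<le> c * b x"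
    and fin: "(\<integral>\<^sup>+x. indicator A x * b x \<partial>M) < top" "c < top"
  shows "set_integrable M A f"
  unfolding set_integrable_def
proof (rule integrableI_bounded)
  show "(\<lambda>x. indicator A x *\<^sub>R f x) \<in> borel_measurable M"
    using assms(1,2) by simp
  have "(\<integral>\<^sup>+x. ennreal (norm (indicator A x *\<^sub>R f x)) \<partial>M) \<le> (\<integral>\<^sup>+x. c * (indicator A x * b x) \<partial>M)"
    using le by (intro nn_integral_mono) (auto simp: indicator_def)
  also have "\<dots> = c * (\<integral>\<^sup>+x. indicator A x * b x \<partial>M)"
    using assms(2,3) by (intro nn_integral_cmult) simp
  also have "\<dots> < top" using fin by (simp add: ennreal_mult_less_top)
  finally show "(\<integral>\<^sup>+x. ennreal (norm (indicator A x *\<^sub>R f x)) \<partial>M) < \<infinity>" by simp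
qed

section \<open>Scalar majorants of the Duhamel terms\<close>

definition damped :: "real \<Rightarrow> real \<Rightarrow> real \<Rightarrow> (real \<Rightarrow> real^3 \<Rightarrow> ennreal) \<Rightarrow> real^3 \<Rightarrow> ennreal" where
  "damped \<nu> \<alpha> t f \<xi> = (\<integral>\<^sup>+\<tau>. indicator {0..t} \<tau> * (ennreal (decay \<nu> \<alpha> (t - \<tau>) \<xi>) * f \<tau> \<xi>) \<partial>lborel)"

lemma measurable_damped:
  assumes f: "(\<lambda>(\<tau>, \<xi>). f \<tau> \<xi>) \<in> borel_measurable borel"
  shows "damped \<nu> \<alpha> t f \<in> borel_measurable borel"
proof -
  have [measurable]: "(\<lambda>(\<xi>, \<tau>). f \<tau> \<xi>) \<in> borel_measurable (borel \<Otimes>\<^sub>M lborel)"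
    unfolding case_prod_beta' by (intro measurable_uncurry[OF f]) measurable
  show ?thesis unfolding damped_def by measurable
qed

text \<open>Up to a constant, a pointwise majorant of the transform of the divergence of a tensor
  product whose factors have the magnitudes \<open>a\<close> and \<open>b\<close>.\<close>

definition advection :: "(real \<Rightarrow> real^3 \<Rightarrow> ennreal) \<Rightarrow> (real \<Rightarrow> real^3 \<Rightarrow> ennreal) \<Rightarrow> real \<Rightarrow> real^3 \<Rightarrow> ennreal" where
  "advection a b \<tau> \<xi> = ennreal (norm \<xi>) * conv (a \<tau>) (b \<tau>) \<xi>"

lemma measurable_advection:
  assumes a: "(\<lambda>(\<tau>, \<xi>). a \<tau> \<xi>) \<in> borel_measurable borel" and b: "(\<lambda>(\<tau>, \<xi>). b \<tau> \<xi>) \<in> borel_measurable borel"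
  shows "(\<lambda>(\<tau>, \<xi>). advection a b \<tau> \<xi>) \<in> borel_measurable borel"
  unfolding advection_def case_prod_beta'
  by (intro borel_measurable_times_ennreal measurable_conv_time[OF a b]) (simp_all add: borel_prod[symmetric])

text \<open>The constant is 324 * 27, from the kernel and from the divergence.\<close>

lemma advection_integrand_bound:
  "ennreal (norm (duhamel_kernel \<nu> \<Omega> \<alpha> (t - \<tau>) \<xi> (div_tensor_ft (V \<tau>) (V \<tau>) \<xi>)))
    \<le> ennreal 8748 * (ennreal (decay \<nu> \<alpha> (t - \<tau>) \<xi>) * advection (\<lambda>\<tau>. mag (V \<tau>)) (\<lambda>\<tau>. mag (V \<tau>)) \<tau> \<xi>)"
proof -
  have d: "0 \<le> decay \<nu> \<alpha> (t - \<tau>) \<xi>" by (simp add: decay_def)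
  have "ennreal (norm (duhamel_kernel \<nu> \<Omega> \<alpha> (t - \<tau>) \<xi> (div_tensor_ft (V \<tau>) (V \<tau>) \<xi>)))
      \<le> ennreal (324 * decay \<nu> \<alpha> (t - \<tau>) \<xi> * norm (div_tensor_ft (V \<tau>) (V \<tau>) \<xi>))"
    by (intro ennreal_leI norm_duhamel_kernel_le)
  also have "\<dots> = 324 * (ennreal (decay \<nu> \<alpha> (t - \<tau>) \<xi>) * ennreal (norm (div_tensor_ft (V \<tau>) (V \<tau>) \<xi>)))"
    using d by (simp add: ennreal_mult mult.assoc)
  also have "\<dots> \<le> 324 * (ennreal (decay \<nu> \<alpha> (t - \<tau>) \<xi>) * (27 * advection (\<lambda>\<tau>. mag (V \<tau>)) (\<lambda>\<tau>. mag (V \<tau>)) \<tau> \<xi>))"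
    unfolding advection_def by (intro mult_left_mono norm_div_tensor_le) auto
  also have "\<dots> = (324 * 27) * (ennreal (decay \<nu> \<alpha> (t - \<tau>) \<xi>) * advection (\<lambda>\<tau>. mag (V \<tau>)) (\<lambda>\<tau>. mag (V \<tau>)) \<tau> \<xi>)"
    by (simp only: mult_ac)
  finally show ?thesis by simp
qed

lemma measurable_mag_time:
  fixes U :: "real \<Rightarrow> real^3 \<Rightarrow> complex^3"
  assumes "(\<lambda>(\<tau>, \<xi>). U \<tau> \<xi>) \<in> borel_measurable borel"
  shows "(\<lambda>(\<tau>, \<xi>). mag (U \<tau>) \<xi>) \<in> borel_measurable borel"
proof -
  have [measurable]: "(\<lambda>x. U (fst x) (snd x)) \<in> borel_measurable borel"
    using assms unfolding case_prod_beta' .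
  show ?thesis unfolding case_prod_beta' by measurable
qed

lemma measurable_diff_time:
  fixes U :: "real \<Rightarrow> real^3 \<Rightarrow> complex^3"
  assumes "(\<lambda>(\<tau>, \<xi>). U \<tau> \<xi>) \<in> borel_measurable borel" and w: "w \<in> borel_measurable borel"
  shows "(\<lambda>(\<tau>, \<xi>). U \<tau> \<xi> - w \<xi>) \<in> borel_measurable borel"
proof -
  have [measurable]: "(\<lambda>x. U (fst x) (snd x)) \<in> borel_measurable borel"
    using assms(1) unfolding case_prod_beta' .
  have "(snd :: real \<times> (real^3) \<Rightarrow> _) \<in> borel \<rightarrow>\<^sub>M borel"
    by (intro borel_measurable_continuous_onI continuous_intros)
  from measurable_compose[OF this w] have [measurable]: "(\<lambda>x :: real \<times> (real^3). w (snd x)) \<in> borel_measurable borel" .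
  show ?thesis unfolding case_prod_beta' by measurable
qed

lemma measurable_const_time:
  fixes w :: "real^3 \<Rightarrow> complex^3"
  assumes w [measurable]: "w \<in> borel_measurable borel"
  shows "(\<lambda>(\<tau>::real, \<xi>). w \<xi>) \<in> borel_measurable borel"
  unfolding case_prod_beta' borel_prod[symmetric] by measurable

text \<open>The right side of the mild equation without the free evolution, so that the evolutionary
  and the stationary equation share one shape.\<close>

definition duhamel :: "real \<Rightarrow> real \<Rightarrow> real \<Rightarrow> real \<Rightarrow> (real \<Rightarrow> real^3 \<Rightarrow> complex^3) \<Rightarrow>
    (real \<Rightarrow> real^3 \<Rightarrow> complex^3) \<Rightarrow> real^3 \<Rightarrow> complex^3" where
  "duhamel \<nu> \<Omega> \<alpha> t V G \<xi> = bilinear_ft \<nu> \<Omega> \<alpha> V V t \<xi>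
     + (LINT \<tau>:{0..t}|lborel. duhamel_kernel \<nu> \<Omega> \<alpha> (t - \<tau>) \<xi> (G \<tau> \<xi>))"

text \<open>
  The finiteness assumptions make the time integrals and the convolutions absolutely convergent;
  otherwise the Bochner integral has the junk value \<open>0\<close> and the difference of two integrals is not
  the integral of the difference.
\<close>

lemma duhamel_difference:
  assumes V: "(\<lambda>(\<tau>, \<xi>). V \<tau> \<xi>) \<in> borel_measurable borel" and G: "(\<lambda>(\<tau>, \<xi>). G \<tau> \<xi>) \<in> borel_measurable borel"
    and w [measurable]: "w \<in> borel_measurable borel" and F [measurable]: "F \<in> borel_measurable borel"
    and \<xi>: "\<xi> \<noteq> 0"
    and finV: "damped \<nu> \<alpha> t (advection (\<lambda>\<tau>. mag (V \<tau>)) (\<lambda>\<tau>. mag (V \<tau>))) \<xi> < top"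
    and finw: "damped \<nu> \<alpha> t (advection (\<lambda>_. mag w) (\<lambda>_. mag w)) \<xi> < top"
    and finG: "damped \<nu> \<alpha> t (\<lambda>\<tau>. mag (G \<tau>)) \<xi> < top" and finF: "damped \<nu> \<alpha> t (\<lambda>_. mag F) \<xi> < top"
  shows "ennreal (norm (duhamel \<nu> \<Omega> \<alpha> t V G \<xi> - duhamel \<nu> \<Omega> \<alpha> t (\<lambda>_. w) (\<lambda>_. F) \<xi>))
    \<le> 8748 * damped \<nu> \<alpha> t (\<lambda>\<tau> \<xi>. advection (\<lambda>\<tau>. mag (\<lambda>\<xi>. V \<tau> \<xi> - w \<xi>)) (\<lambda>\<tau>. mag (V \<tau>)) \<tau> \<xi>
          + advection (\<lambda>_. mag w) (\<lambda>\<tau>. mag (\<lambda>\<xi>. V \<tau> \<xi> - w \<xi>)) \<tau> \<xi>) \<xi>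
      + 324 * damped \<nu> \<alpha> t (\<lambda>\<tau>. mag (\<lambda>\<xi>. G \<tau> \<xi> - F \<xi>)) \<xi>"
    (is "_ \<le> 8748 * damped \<nu> \<alpha> t ?A \<xi> + 324 * damped \<nu> \<alpha> t ?B \<xi>")
proof -
  let ?K = "\<lambda>\<tau>. duhamel_kernel \<nu> \<Omega> \<alpha> (t - \<tau>) \<xi>"
  let ?d = "\<lambda>\<tau>. ennreal (decay \<nu> \<alpha> (t - \<tau>) \<xi>)"
  let ?V = "\<lambda>\<tau>. div_tensor_ft (V \<tau>) (V \<tau>) \<xi>" and ?w = "\<lambda>\<tau>::real. div_tensor_ft w w \<xi>"
  have Vt [measurable]: "V \<tau> \<in> borel_measurable borel" for \<tau>
    by (rule measurable_uncurry[OF V]) auto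
  have [measurable]: "(\<lambda>\<tau>. G \<tau> \<xi>) \<in> borel_measurable borel"
    by (rule measurable_uncurry[OF G]) auto
  note wt = measurable_const_time[OF w] and magm = measurable_mag_time
  have adv [measurable]: "(\<lambda>\<tau>. advection (\<lambda>\<tau>. mag (U \<tau>)) (\<lambda>\<tau>. mag (U \<tau>)) \<tau> \<xi>) \<in> borel_measurable borel"
    if "(\<lambda>(\<tau>, \<xi>). U \<tau> \<xi>) \<in> borel_measurable borel" for U :: "real \<Rightarrow> real^3 \<Rightarrow> complex^3"
    using measurable_uncurry[OF measurable_advection[OF magm[OF that] magm[OF that]], of "\<lambda>\<tau>. \<tau>" borel "\<lambda>_. \<xi>"] by simp
  have [measurable]: "?V \<in> borel_measurable borel"
    by (rule measurable_div_tensor_time[OF V]) auto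
  have bil: "bilinear_ft \<nu> \<Omega> \<alpha> U U t \<xi> = - (LINT \<tau>:{0..t}|lborel. ?K \<tau> (div_tensor_ft (U \<tau>) (U \<tau>) \<xi>))" for U
    by (simp add: bilinear_ft_def duhamel_kernel_def)
  have iV: "set_integrable lborel {0..t} (\<lambda>\<tau>. ?K \<tau> (?V \<tau>))"
    using finV unfolding damped_def
    by (intro set_integrable_if_bound[OF _ _ _ advection_integrand_bound] borel_measurable_times_ennreal) (auto intro: adv V)
  have iw: "set_integrable lborel {0..t} (\<lambda>\<tau>. ?K \<tau> (?w \<tau>))"
    using finw unfolding damped_def
    by (intro set_integrable_if_bound[OF _ _ _ advection_integrand_bound[where V = "\<lambda>_. w"]] borel_measurable_times_ennreal) (auto intro: adv wt)
  have kb: "ennreal (norm (?K \<tau> v)) \<le> ennreal 324 * (?d \<tau> * ennreal (norm v))" for \<tau> v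
  proof -
    have "ennreal (norm (?K \<tau> v)) \<le> ennreal (324 * decay \<nu> \<alpha> (t - \<tau>) \<xi> * norm v)"
      by (intro ennreal_leI norm_duhamel_kernel_le)
    then show ?thesis by (simp add: ennreal_mult mult.assoc decay_def)
  qed
  have iG: "set_integrable lborel {0..t} (\<lambda>\<tau>. ?K \<tau> (G \<tau> \<xi>))"
    using finG unfolding damped_def by (intro set_integrable_if_bound[OF _ _ _ kb]) auto
  have iF: "set_integrable lborel {0..t} (\<lambda>\<tau>. ?K \<tau> (F \<xi>))"
    using finF unfolding damped_def by (intro set_integrable_if_bound[OF _ _ _ kb]) auto
  have d_pos: "0 < decay \<nu> \<alpha> s \<xi>" for s by (simp add: decay_def)
  \<comment> \<open>The heat factor is positive and \<xi> is nonzero, so finiteness of the damped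
    integral passes to the convolution at almost every time.\<close>
  have fin_conv: "AE \<tau> in lborel. \<tau> \<in> {0..t} \<longrightarrow> conv (mag (U \<tau>)) (mag (U \<tau>)) \<xi> < top"
    if U: "(\<lambda>(\<tau>, \<xi>). U \<tau> \<xi>) \<in> borel_measurable borel"
      and fin: "damped \<nu> \<alpha> t (advection (\<lambda>\<tau>. mag (U \<tau>)) (\<lambda>\<tau>. mag (U \<tau>))) \<xi> < top" for U :: "real \<Rightarrow> real^3 \<Rightarrow> complex^3"
  proof -
    have "AE \<tau> in lborel. indicator {0..t} \<tau> * (?d \<tau> * advection (\<lambda>\<tau>. mag (U \<tau>)) (\<lambda>\<tau>. mag (U \<tau>)) \<tau> \<xi>) \<noteq> \<infinity>"
      using fin adv[OF U] unfolding damped_def by (intro nn_integral_PInf_AE) auto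
    then show ?thesis
    proof eventually_elim
      case (elim \<tau>)
      then show ?case using \<xi> d_pos[of "t - \<tau>"]
        by (auto simp: advection_def less_top[symmetric] ennreal_mult_eq_top_iff ennreal_eq_0_iff)
    qed
  qed
  have 1: "ennreal (norm ((LINT \<tau>:{0..t}|lborel. ?K \<tau> (?V \<tau>)) - (LINT \<tau>:{0..t}|lborel. ?K \<tau> (?w \<tau>))))
      \<le> (\<integral>\<^sup>+\<tau>. indicator {0..t} \<tau> * (8748 * (?d \<tau> * ?A \<tau> \<xi>)) \<partial>lborel)"
  proof (rule norm_set_integral_diff_le[OF iV iw])
    show "AE \<tau> in lborel. \<tau> \<in> {0..t} \<longrightarrow> ennreal (norm (?K \<tau> (?V \<tau>) - ?K \<tau> (?w \<tau>))) \<le> 8748 * (?d \<tau> * ?A \<tau> \<xi>)"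
      using fin_conv[OF V finV] fin_conv[OF wt finw]
    proof eventually_elim
      case (elim \<tau>)
      show ?case
      proof
        assume \<tau>: "\<tau> \<in> {0..t}"
        have "ennreal (norm (?K \<tau> (?V \<tau>) - ?K \<tau> (?w \<tau>))) \<le> ennreal 324 * (?d \<tau> * ennreal (norm (?V \<tau> - ?w \<tau>)))"
          unfolding duhamel_kernel_diff by (rule kb)
        also have "\<dots> \<le> ennreal 324 * (?d \<tau> * (27 * ?A \<tau> \<xi>))"
          using elim \<tau> unfolding advection_def distrib_left[symmetric]
          by (intro mult_left_mono norm_div_tensor_diff_le) auto
        also have "\<dots> = (324 * 27) * (?d \<tau> * ?A \<tau> \<xi>)" by (simp only: mult_ac ennreal_numeral)
        finally show "ennreal (norm (?K \<tau> (?V \<tau>) - ?K \<tau> (?w \<tau>))) \<le> 8748 * (?d \<tau> * ?A \<tau> \<xi>)" by simp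
      qed
    qed
  qed
  note Dm = measurable_diff_time[OF V w]
  have [measurable]: "(\<lambda>\<tau>. ?A \<tau> \<xi>) \<in> borel_measurable borel"
    using measurable_uncurry[OF measurable_advection[OF magm[OF Dm] magm[OF V]], of "\<lambda>\<tau>. \<tau>" borel "\<lambda>_. \<xi>"]
      measurable_uncurry[OF measurable_advection[OF magm[OF wt] magm[OF Dm]], of "\<lambda>\<tau>. \<tau>" borel "\<lambda>_. \<xi>"] by simp
  have 1: "ennreal (norm ((LINT \<tau>:{0..t}|lborel. ?K \<tau> (?V \<tau>)) - (LINT \<tau>:{0..t}|lborel. ?K \<tau> (?w \<tau>))))
      \<le> 8748 * damped \<nu> \<alpha> t ?A \<xi>"
    using 1 unfolding damped_def by (simp add: mult.left_commute[of _ 8748] nn_integral_cmult)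
  have 2: "ennreal (norm ((LINT \<tau>:{0..t}|lborel. ?K \<tau> (G \<tau> \<xi>)) - (LINT \<tau>:{0..t}|lborel. ?K \<tau> (F \<xi>))))
      \<le> (\<integral>\<^sup>+\<tau>. indicator {0..t} \<tau> * (324 * (?d \<tau> * ?B \<tau> \<xi>)) \<partial>lborel)"
    by (rule norm_set_integral_diff_le[OF iG iF]) (use kb in \<open>simp add: duhamel_kernel_diff\<close>)
  then have 2: "ennreal (norm ((LINT \<tau>:{0..t}|lborel. ?K \<tau> (G \<tau> \<xi>)) - (LINT \<tau>:{0..t}|lborel. ?K \<tau> (F \<xi>))))
      \<le> 324 * damped \<nu> \<alpha> t ?B \<xi>"
    unfolding damped_def by (simp add: mult.left_commute[of _ 324] nn_integral_cmult)
  have tri: "ennreal (norm ((- a + c) - (- b + e))) \<le> ennreal (norm (a - b)) + ennreal (norm (c - e))" for a b c e :: "complex^3"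
  proof -
    have eq: "(- a + c) - (- b + e) = (c - e) - (a - b)" by simp
    have "norm ((- a + c) - (- b + e)) \<le> norm (a - b) + norm (c - e)"
      unfolding eq using norm_triangle_ineq4[of "c - e" "a - b"] by linarith
    then show ?thesis by (simp add: ennreal_leI flip: ennreal_plus)
  qed
  show ?thesis
    unfolding duhamel_def bil by (rule order_trans[OF tri add_mono[OF 1 2]])
qed

text \<open>The gain 2^(-2\<alpha>j) of \<open>time_estimate\<close> is exactly the gap between the
  weight s - 2\<alpha> of the source and the weight s of the result, so the bound has no further
  dependence on \<open>j\<close>.\<close>

lemma damped_bound:
  assumes f: "(\<lambda>(\<tau>, \<xi>). f \<tau> \<xi>) \<in> borel_measurable borel"
    and p: "1 \<le> p" and \<nu>: "\<nu> > 0" and \<alpha>: "\<alpha> > 0" and t: "t \<ge> 0" and \<theta>: "0 \<le> \<theta>" "\<theta> \<le> 1/2"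
    and m: "AE \<tau> in lborel. 0 \<le> \<tau> \<longrightarrow> (\<forall>k. exp2 (of_int k * (s - 2 * \<alpha>)) * ann p k (f \<tau>) \<le> m k)"
    and x: "AE \<tau> in lborel. \<theta> * t \<le> \<tau> \<longrightarrow> (\<forall>k. exp2 (of_int k * (s - 2 * \<alpha>)) * ann p k (f \<tau>) \<le> x k)"
  shows "exp2 (of_int j * s) * ann p j (damped \<nu> \<alpha> t f) \<le> ennreal (1 / \<nu>) * (ennreal (2 * \<theta>) * m j + x j)"
proof -
  let ?e = "exp2 (- (of_int j * (s - 2 * \<alpha>)))"
  have *: "a \<le> ?e * b" if "exp2 (of_int j * (s - 2 * \<alpha>)) * a \<le> b" for a b
  proof -
    have "a = ?e * (exp2 (of_int j * (s - 2 * \<alpha>)) * a)" by (simp only: exp2_mult_cancel)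
    also have "\<dots> \<le> ?e * b" by (rule mult_left_mono[OF that]) simp
    finally show ?thesis .
  qed
  have "ann p j (damped \<nu> \<alpha> t f) \<le> ennreal (1 / \<nu>) * exp2 (- (2 * \<alpha> * of_int j)) * (ennreal (2 * \<theta>) * (?e * m j) + ?e * x j)"
    unfolding damped_def[abs_def] decay_def
  proof (rule time_estimate[OF f p \<nu> \<alpha> t \<theta>])
    show "AE \<tau> in lborel. 0 \<le> \<tau> \<and> \<tau> \<le> t \<longrightarrow> ann p j (f \<tau>) \<le> ?e * m j"
      using m by eventually_elim (use * in blast)
    show "AE \<tau> in lborel. \<theta> * t \<le> \<tau> \<and> \<tau> \<le> t \<longrightarrow> ann p j (f \<tau>) \<le> ?e * x j"
      using x by eventually_elim (use * in blast)
  qed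
  also have "\<dots> = (exp2 (- (2 * \<alpha> * of_int j)) * ?e) * (ennreal (1 / \<nu>) * (ennreal (2 * \<theta>) * m j + x j))"
    by (simp only: distrib_left mult_ac)
  also have "exp2 (- (2 * \<alpha> * of_int j)) * ?e = exp2 (- (of_int j * s))"
    unfolding exp2_add[symmetric] by (simp add: algebra_simps)
  finally have "exp2 (of_int j * s) * ann p j (damped \<nu> \<alpha> t f)
      \<le> exp2 (of_int j * s) * (exp2 (- (of_int j * s)) * (ennreal (1 / \<nu>) * (ennreal (2 * \<theta>) * m j + x j)))"
    by (rule mult_left_mono) simp
  then show ?thesis by (simp only: exp2_mult_cancel)
qed

text \<open>On the annulus \<open>k\<close> the derivative |\<xi>| is below 2^(k+1). Its factor 2^k
  is the 1 in \<open>rel\<close>, which matches the weight of the product estimate; the remaining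
  factor 2 stays.\<close>

lemma advection_bound:
  assumes [measurable]: "a \<tau> \<in> borel_measurable borel" "b \<tau> \<in> borel_measurable borel"
    and p: "1 \<le> p" and q: "1 \<le> q" and \<delta>: "0 < dual_dim p - s"
    and rel: "2 * s - dual_dim p = s - 2 * \<alpha> + 1"
    and x: "\<And>k. exp2 (of_int k * s) * ann p k (a \<tau>) \<le> x k"
    and y: "\<And>k. exp2 (of_int k * s) * ann p k (b \<tau>) \<le> y k"
  shows "exp2 (of_int k * (s - 2 * \<alpha>)) * ann p k (advection a b \<tau>)
    \<le> 2 * para p s q x y k"
    (is "_ \<le> 2 * ?P")
proof -
  have "ann p k (advection a b \<tau>) \<le> ann p k (\<lambda>\<xi>. exp2 (of_int k + 1) * conv (a \<tau>) (b \<tau>) \<xi>)"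
    unfolding advection_def[abs_def]
    using p by (intro ann_mono_AE AE_I2) (auto simp: annulus_def exp2_def intro!: mult_right_mono ennreal_leI)
  also have "\<dots> \<le> exp2 (of_int k + 1) * ann p k (conv (a \<tau>) (b \<tau>))"
    using p by (intro ann_cmult_le) auto
  finally have "exp2 (of_int k * (s - 2 * \<alpha>)) * ann p k (advection a b \<tau>)
      \<le> exp2 (of_int k * (s - 2 * \<alpha>)) * (exp2 (of_int k + 1) * ann p k (conv (a \<tau>) (b \<tau>)))"
    by (rule mult_left_mono) simp
  also have "\<dots> = exp2 1 * (exp2 (of_int k * (2 * s - dual_dim p)) * ann p k (conv (a \<tau>) (b \<tau>)))"
    unfolding rel mult.assoc[symmetric] exp2_add[symmetric] by (simp add: algebra_simps)
  also have "\<dots> \<le> exp2 1 * ?P"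
    by (intro mult_left_mono product_estimate p q \<delta> x y) auto
  also have "exp2 1 = 2" by (simp add: exp2_def)
  finally show ?thesis .
qed

section \<open>Comparison of a time-dependent with a stationary Duhamel formula\<close>

context
  fixes p q :: ennreal and s \<alpha> \<nu> \<Omega> :: real
    and V G :: "real \<Rightarrow> real^3 \<Rightarrow> complex^3" and w F :: "real^3 \<Rightarrow> complex^3"
    and mV mG :: "int \<Rightarrow> ennreal"
  assumes p: "1 \<le> p" and q: "1 \<le> q" and \<nu>: "\<nu> > 0" and \<alpha>: "\<alpha> > 0"
    and \<delta>: "0 < dual_dim p - s" and \<sigma>: "0 < 2 * s - dual_dim p"
    and rel: "2 * s - dual_dim p = s - 2 * \<alpha> + 1"
    and V: "(\<lambda>(\<tau>, \<xi>). V \<tau> \<xi>) \<in> borel_measurable borel" and G: "(\<lambda>(\<tau>, \<xi>). G \<tau> \<xi>) \<in> borel_measurable borel"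
    and w [measurable]: "w \<in> borel_measurable borel" and F [measurable]: "F \<in> borel_measurable borel"
    and mV: "AE \<tau> in lborel. 0 \<le> \<tau> \<longrightarrow> (\<forall>k. FB_seq s p (V \<tau>) k \<le> mV k)" "ell q mV < top"
    and mw: "ell q (FB_seq s p w) < top"
    and mG: "AE \<tau> in lborel. 0 \<le> \<tau> \<longrightarrow> (\<forall>k. FB_seq (s - 2 * \<alpha>) p (G \<tau>) k \<le> mG k)" "ell q mG < top"
    and mF: "ell q (FB_seq (s - 2 * \<alpha>) p F) < top"
begin

text \<open>Majorant for D \<otimes> v + w \<otimes> D when \<open>x\<close> dominates the shells of
  D. The factor 2 of \<open>advection_bound\<close> is kept outside.\<close>

definition linearised :: "(int \<Rightarrow> ennreal) \<Rightarrow> int \<Rightarrow> ennreal" where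
  "linearised x j = para p s q x mV j
    + para p s q (FB_seq s p w) x j"

lemma ell_linearised_le:
  "ell q (linearised x) \<le> ennreal (para_const p s) * (ell q mV + ell q (FB_seq s p w)) * ell q x"
proof -
  have "ell q (linearised x) \<le> ell q (para p s q x mV) + ell q (para p s q (FB_seq s p w) x)"
    unfolding linearised_def[abs_def] by (rule ell_add_le[OF q])
  also have "\<dots> \<le> ennreal (para_const p s) * (ell q x * ell q mV) + ennreal (para_const p s) * (ell q (FB_seq s p w) * ell q x)"
    by (intro add_mono ell_para_le q \<delta> \<sigma>)
  finally show ?thesis by (simp only: distrib_left distrib_right mult_ac)
qed

text \<open>Supplies the absolute convergence that \<open>duhamel_difference\<close> assumes. With
  \<theta> = 0 in \<open>damped_bound\<close> the initial interval contributes nothing and a single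
  majorant suffices.\<close>

lemma damped_advection_finite:
  assumes U: "(\<lambda>(\<tau>, \<xi>). U \<tau> \<xi>) \<in> borel_measurable borel"
    and m: "AE \<tau> in lborel. 0 \<le> \<tau> \<longrightarrow> (\<forall>k. FB_seq s p (U \<tau>) k \<le> m k)" "ell q m < top" and t: "t \<ge> 0"
  shows "AE \<xi> in lborel. damped \<nu> \<alpha> t (advection (\<lambda>\<tau>. mag (U \<tau>)) (\<lambda>\<tau>. mag (U \<tau>))) \<xi> < top"
proof (rule ann_finite_AE[OF _ p])
  let ?A = "advection (\<lambda>\<tau>. mag (U \<tau>)) (\<lambda>\<tau>. mag (U \<tau>))"
  let ?P = "\<lambda>k. 2 * para p s q m m k"
  note A = measurable_advection[OF measurable_mag_time[OF U] measurable_mag_time[OF U]]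
  show "damped \<nu> \<alpha> t ?A \<in> borel_measurable borel" by (rule measurable_damped[OF A])
  have [measurable]: "U \<tau> \<in> borel_measurable borel" for \<tau>
    by (rule measurable_uncurry[OF U]) auto
  have "AE \<tau> in lborel. 0 \<le> \<tau> \<longrightarrow> (\<forall>k. exp2 (of_int k * (s - 2 * \<alpha>)) * ann p k (?A \<tau>) \<le> ?P k)"
    using m(1)
  proof eventually_elim
    case (elim \<tau>)
    then show ?case
      by (intro impI allI advection_bound p q \<delta> rel) (auto simp: FB_seq_def)
  qed
  note * = this
  fix j
  have "exp2 (of_int j * s) * ann p j (damped \<nu> \<alpha> t ?A) \<le> ennreal (1 / \<nu>) * (ennreal (2 * 0) * ?P j + ?P j)"
    by (rule damped_bound[OF A p \<nu> \<alpha> t _ _ *]) (use * t in \<open>auto elim!: eventually_mono\<close>)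
  also have "\<dots> < top"
    using para_finite[OF q \<delta> \<sigma> m(2) m(2)] by (simp add: ennreal_mult_less_top)
  finally show "ann p j (damped \<nu> \<alpha> t ?A) < top"
    by (auto simp: ennreal_mult_less_top)
qed

lemma damped_forcing_finite:
  assumes U: "(\<lambda>(\<tau>, \<xi>). U \<tau> \<xi>) \<in> borel_measurable borel"
    and m: "AE \<tau> in lborel. 0 \<le> \<tau> \<longrightarrow> (\<forall>k. FB_seq (s - 2 * \<alpha>) p (U \<tau>) k \<le> m k)" "ell q m < top" and t: "t \<ge> 0"
  shows "AE \<xi> in lborel. damped \<nu> \<alpha> t (\<lambda>\<tau>. mag (U \<tau>)) \<xi> < top"
proof (rule ann_finite_AE[OF _ p])
  note A = measurable_mag_time[OF U]
  show "damped \<nu> \<alpha> t (\<lambda>\<tau>. mag (U \<tau>)) \<in> borel_measurable borel" by (rule measurable_damped[OF A])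
  fix j
  have "exp2 (of_int j * s) * ann p j (damped \<nu> \<alpha> t (\<lambda>\<tau>. mag (U \<tau>))) \<le> ennreal (1 / \<nu>) * (ennreal (2 * 0) * m j + m j)"
    by (rule damped_bound[OF A p \<nu> \<alpha> t]) (use m(1) t in \<open>auto elim!: eventually_mono simp: FB_seq_def\<close>)
  also have "\<dots> < top"
    using le_less_trans[OF le_ell[OF q] m(2)] by (simp add: ennreal_mult_less_top)
  finally show "ann p j (damped \<nu> \<alpha> t (\<lambda>\<tau>. mag (U \<tau>))) < top"
    by (auto simp: ennreal_mult_less_top)
qed

text \<open>The estimate for D at one time \<open>t\<close>, shell by shell. The majorants
  \<open>m\<close> and \<open>mf\<close>, valid at all times, appear only with the factor 2\<theta>;
  \<open>x\<close> and \<open>xf\<close> are required only from \<theta> t on. The constant 17496 is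
  8748 times the factor 2 of \<open>advection_bound\<close>.\<close>

lemma difference_bound:
  assumes t: "t \<ge> 0" and \<theta>: "0 \<le> \<theta>" "\<theta> \<le> 1/2"
    and Y [measurable]: "Y \<in> borel_measurable borel" and D [measurable]: "D \<in> borel_measurable borel"
    and eq: "AE \<xi> in lborel. D \<xi> = Y \<xi> +
      (duhamel \<nu> \<Omega> \<alpha> t V G \<xi> - duhamel \<nu> \<Omega> \<alpha> t (\<lambda>_. w) (\<lambda>_. F) \<xi>)"
    and m: "AE \<tau> in lborel. 0 \<le> \<tau> \<longrightarrow> (\<forall>k. FB_seq s p (\<lambda>\<xi>. V \<tau> \<xi> - w \<xi>) k \<le> m k)"
    and x: "AE \<tau> in lborel. \<theta> * t \<le> \<tau> \<longrightarrow> (\<forall>k. FB_seq s p (\<lambda>\<xi>. V \<tau> \<xi> - w \<xi>) k \<le> x k)"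
    and mf: "AE \<tau> in lborel. 0 \<le> \<tau> \<longrightarrow> (\<forall>k. FB_seq (s - 2 * \<alpha>) p (\<lambda>\<xi>. G \<tau> \<xi> - F \<xi>) k \<le> mf k)"
    and xf: "AE \<tau> in lborel. \<theta> * t \<le> \<tau> \<longrightarrow> (\<forall>k. FB_seq (s - 2 * \<alpha>) p (\<lambda>\<xi>. G \<tau> \<xi> - F \<xi>) k \<le> xf k)"
  shows "FB_seq s p D j \<le> FB_seq s p Y j
    + ennreal (17496 / \<nu>) * (ennreal (2 * \<theta>) * linearised m j + linearised x j)
    + ennreal (324 / \<nu>) * (ennreal (2 * \<theta>) * mf j + xf j)"
proof -
  let ?DV = "\<lambda>\<tau> \<xi>. V \<tau> \<xi> - w \<xi>" and ?DF = "\<lambda>\<tau> \<xi>. G \<tau> \<xi> - F \<xi>"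
  let ?A = "\<lambda>\<tau> \<xi>. advection (\<lambda>\<tau>. mag (?DV \<tau>)) (\<lambda>\<tau>. mag (V \<tau>)) \<tau> \<xi> + advection (\<lambda>_. mag w) (\<lambda>\<tau>. mag (?DV \<tau>)) \<tau> \<xi>"
  note Dm = measurable_diff_time[OF V w] and Fm = measurable_diff_time[OF G F]
  note A1 = measurable_advection[OF measurable_mag_time[OF Dm] measurable_mag_time[OF V]]
  note A2 = measurable_advection[OF measurable_mag_time[OF measurable_const_time[OF w]] measurable_mag_time[OF Dm]]
  have A: "(\<lambda>(\<tau>, \<xi>). ?A \<tau> \<xi>) \<in> borel_measurable borel"
    using A1 A2 unfolding case_prod_beta' by (rule borel_measurable_add)
  have [measurable]: "V \<tau> \<in> borel_measurable borel" for \<tau> by (rule measurable_uncurry[OF V]) auto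
  have dA [measurable]: "damped \<nu> \<alpha> t ?A \<in> borel_measurable borel" by (rule measurable_damped[OF A])
  have dB [measurable]: "damped \<nu> \<alpha> t (\<lambda>\<tau>. mag (?DF \<tau>)) \<in> borel_measurable borel"
    by (rule measurable_damped[OF measurable_mag_time[OF Fm]])
  have "AE \<xi> in lborel. (\<xi>::real^3) \<noteq> 0" by (rule AE_lborel_singleton)
  then have pointwise: "AE \<xi> in lborel. mag D \<xi> \<le> mag Y \<xi> + (8748 * damped \<nu> \<alpha> t ?A \<xi> + 324 * damped \<nu> \<alpha> t (\<lambda>\<tau>. mag (?DF \<tau>)) \<xi>)"
    using eq damped_advection_finite[OF V mV t]
      damped_advection_finite[OF measurable_const_time[OF w] _ mw t, simplified]
      damped_forcing_finite[OF G mG t]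
      damped_forcing_finite[OF measurable_const_time[OF F] _ mF t, simplified]
  proof eventually_elim
    case (elim \<xi>)
    have "mag D \<xi> \<le> mag Y \<xi> + ennreal (norm (duhamel \<nu> \<Omega> \<alpha> t V G \<xi> - duhamel \<nu> \<Omega> \<alpha> t (\<lambda>_. w) (\<lambda>_. F) \<xi>))"
      unfolding elim(2) by (simp add: ennreal_leI norm_triangle_ineq flip: ennreal_plus)
    also have "\<dots> \<le> mag Y \<xi> + (8748 * damped \<nu> \<alpha> t ?A \<xi> + 324 * damped \<nu> \<alpha> t (\<lambda>\<tau>. mag (?DF \<tau>)) \<xi>)"
      using elim by (intro add_left_mono duhamel_difference V G w F) auto
    finally show ?case .
  qed
  have "ann p j (mag D) \<le> ann p j (\<lambda>\<xi>. mag Y \<xi> + (8748 * damped \<nu> \<alpha> t ?A \<xi> + 324 * damped \<nu> \<alpha> t (\<lambda>\<tau>. mag (?DF \<tau>)) \<xi>))"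
    using p pointwise by (intro ann_mono_AE) (auto elim!: eventually_mono)
  also have "\<dots> \<le> ann p j (mag Y) + ann p j (\<lambda>\<xi>. 8748 * damped \<nu> \<alpha> t ?A \<xi> + 324 * damped \<nu> \<alpha> t (\<lambda>\<tau>. mag (?DF \<tau>)) \<xi>)"
    using p by (intro ann_add_le) auto
  also have "\<dots> \<le> ann p j (mag Y) + (ann p j (\<lambda>\<xi>. 8748 * damped \<nu> \<alpha> t ?A \<xi>) + ann p j (\<lambda>\<xi>. 324 * damped \<nu> \<alpha> t (\<lambda>\<tau>. mag (?DF \<tau>)) \<xi>))"
    using p by (intro add_left_mono ann_add_le) auto
  also have "\<dots> \<le> ann p j (mag Y) + (8748 * ann p j (damped \<nu> \<alpha> t ?A) + 324 * ann p j (damped \<nu> \<alpha> t (\<lambda>\<tau>. mag (?DF \<tau>))))"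
    using p by (intro add_left_mono add_mono ann_cmult_le) auto
  finally have "FB_seq s p D j \<le> exp2 (of_int j * s) *
      (ann p j (mag Y) + (8748 * ann p j (damped \<nu> \<alpha> t ?A) + 324 * ann p j (damped \<nu> \<alpha> t (\<lambda>\<tau>. mag (?DF \<tau>)))))"
    unfolding FB_seq_def by (rule mult_left_mono) simp
  also have "\<dots> = FB_seq s p Y j + 8748 * (exp2 (of_int j * s) * ann p j (damped \<nu> \<alpha> t ?A))
      + 324 * (exp2 (of_int j * s) * ann p j (damped \<nu> \<alpha> t (\<lambda>\<tau>. mag (?DF \<tau>))))"
    by (simp only: FB_seq_def distrib_left mult_ac add.assoc)
  also have "\<dots> \<le> FB_seq s p Y j + 8748 * (ennreal (1 / \<nu>) * (ennreal (2 * \<theta>) * (2 * linearised m j) + 2 * linearised x j))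
      + 324 * (ennreal (1 / \<nu>) * (ennreal (2 * \<theta>) * mf j + xf j))"
  proof (intro add_mono mult_left_mono order_refl)
    have bound: "(\<forall>k. exp2 (of_int k * (s - 2 * \<alpha>)) * ann p k (?A \<tau>) \<le> 2 * linearised z k)"
      if z: "\<forall>k. FB_seq s p (?DV \<tau>) k \<le> z k" and v: "\<forall>k. FB_seq s p (V \<tau>) k \<le> mV k" for z \<tau>
    proof
      fix k
      have [measurable]: "advection (\<lambda>\<tau>. mag (?DV \<tau>)) (\<lambda>\<tau>. mag (V \<tau>)) \<tau> \<in> borel_measurable borel"
        "advection (\<lambda>_. mag w) (\<lambda>\<tau>. mag (?DV \<tau>)) \<tau> \<in> borel_measurable borel"
        by (rule measurable_uncurry[OF A1]; simp) (rule measurable_uncurry[OF A2]; simp)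
      have "exp2 (of_int k * (s - 2 * \<alpha>)) * ann p k (?A \<tau>)
          \<le> exp2 (of_int k * (s - 2 * \<alpha>)) * (ann p k (advection (\<lambda>\<tau>. mag (?DV \<tau>)) (\<lambda>\<tau>. mag (V \<tau>)) \<tau>)
            + ann p k (advection (\<lambda>_. mag w) (\<lambda>\<tau>. mag (?DV \<tau>)) \<tau>))"
        using p by (intro mult_left_mono ann_add_le) auto
      also have "\<dots> \<le> 2 * linearised z k"
        unfolding distrib_left linearised_def
        using z v by (intro add_mono advection_bound p q \<delta> rel) (auto simp: FB_seq_def)
      finally show "exp2 (of_int k * (s - 2 * \<alpha>)) * ann p k (?A \<tau>) \<le> 2 * linearised z k" .
    qed
    have "0 \<le> \<theta> * t" using t \<theta> by simp
    then show "exp2 (of_int j * s) * ann p j (damped \<nu> \<alpha> t ?A) \<le> ennreal (1 / \<nu>) * (ennreal (2 * \<theta>) * (2 * linearised m j) + 2 * linearised x j)"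
    proof (intro damped_bound[OF A p \<nu> \<alpha> t \<theta>])
      show "AE \<tau> in lborel. 0 \<le> \<tau> \<longrightarrow> (\<forall>k. exp2 (of_int k * (s - 2 * \<alpha>)) * ann p k (?A \<tau>) \<le> 2 * linearised m k)"
        using m mV(1) by eventually_elim (use bound in blast)
      show "AE \<tau> in lborel. \<theta> * t \<le> \<tau> \<longrightarrow> (\<forall>k. exp2 (of_int k * (s - 2 * \<alpha>)) * ann p k (?A \<tau>) \<le> 2 * linearised x k)"
        using x mV(1) by eventually_elim (use bound \<open>0 \<le> \<theta> * t\<close> order_trans in blast)
    qed
    show "exp2 (of_int j * s) * ann p j (damped \<nu> \<alpha> t (\<lambda>\<tau>. mag (?DF \<tau>))) \<le> ennreal (1 / \<nu>) * (ennreal (2 * \<theta>) * mf j + xf j)"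
      using mf xf by (intro damped_bound[OF measurable_mag_time[OF Fm] p \<nu> \<alpha> t \<theta>]) (simp_all only: FB_seq_def)
  qed auto
  also have "\<dots> = FB_seq s p Y j + (8748 * 2 * ennreal (1 / \<nu>)) * (ennreal (2 * \<theta>) * linearised m j + linearised x j)
      + (324 * ennreal (1 / \<nu>)) * (ennreal (2 * \<theta>) * mf j + xf j)"
    by (simp only: distrib_left mult_ac)
  also have "8748 * 2 * ennreal (1 / \<nu>) = ennreal (17496 / \<nu>)"
    using \<nu> by (simp add: ennreal_mult'[symmetric] flip: ennreal_numeral)
  also have "324 * ennreal (1 / \<nu>) = ennreal (324 / \<nu>)"
    using \<nu> by (simp add: ennreal_mult'[symmetric] flip: ennreal_numeral)
  finally show ?thesis .
qed

end

section \<open>Asymptotic stability\<close>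

lemma FB_seq_cong_AE:
  assumes "f \<in> borel_measurable borel" "g \<in> borel_measurable borel" "1 \<le> p" "AE \<xi> in lborel. f \<xi> = g \<xi>"
  shows "FB_seq s p f = FB_seq s p g"
proof -
  have "ann p j (mag f) = ann p j (mag g)" for j
    using assms by (intro antisym ann_mono_AE) (auto elim!: eventually_mono)
  then show ?thesis by (simp add: FB_seq_def[abs_def])
qed

lemma FB_seq_diff_le:
  assumes [measurable]: "f \<in> borel_measurable borel" "g \<in> borel_measurable borel" and p: "1 \<le> p"
  shows "FB_seq s p (\<lambda>\<xi>. f \<xi> - g \<xi>) j \<le> FB_seq s p f j + FB_seq s p g j"
proof -
  have "ann p j (mag (\<lambda>\<xi>. f \<xi> - g \<xi>)) \<le> ann p j (\<lambda>\<xi>. mag f \<xi> + mag g \<xi>)"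
    using p by (intro ann_mono_AE AE_I2)
      (auto simp: norm_triangle_ineq4 intro!: ennreal_leI simp flip: ennreal_plus)
  also have "\<dots> \<le> ann p j (mag f) + ann p j (mag g)"
    using p by (intro ann_add_le) auto
  finally show ?thesis
    unfolding FB_seq_def distrib_left[symmetric] by (rule mult_left_mono) simp
qed

lemma measurable_semigroup_ft [measurable]:
  assumes [measurable]: "g \<in> borel_measurable borel"
  shows "semigroup_ft \<nu> \<Omega> \<alpha> t g \<in> borel_measurable borel"
  unfolding semigroup_ft_def[abs_def] by (rule measurable_semigroup) auto

text \<open>A bound uniform in time, which later serves as the majorant for the free evolution in
  \<open>ell_tail\<close>.\<close>

lemma FB_seq_semigroup_le:
  assumes [measurable]: "g \<in> borel_measurable borel" and p: "1 \<le> p" and "\<nu> > 0" "t \<ge> 0"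
  shows "FB_seq s p (semigroup_ft \<nu> \<Omega> \<alpha> t g) j \<le> 18 * FB_seq s p g j"
proof -
  have "norm (semigroup_ft \<nu> \<Omega> \<alpha> t g \<xi>) \<le> 18 * norm (g \<xi>)" for \<xi>
  proof -
    have "norm (semigroup_ft \<nu> \<Omega> \<alpha> t g \<xi>) \<le> 18 * decay \<nu> \<alpha> t \<xi> * norm (g \<xi>)"
      unfolding semigroup_ft_def by (rule norm_semigroup_le)
    also have "\<dots> \<le> 18 * 1 * norm (g \<xi>)"
      using assms by (intro mult_mono) (auto simp: decay_def)
    finally show ?thesis by simp
  qed
  then have "mag (semigroup_ft \<nu> \<Omega> \<alpha> t g) \<xi> \<le> 18 * mag g \<xi>" for \<xi>
    using ennreal_leI[of _ "18 * norm (g \<xi>)"] by (simp add: ennreal_mult)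
  then have "ann p j (mag (semigroup_ft \<nu> \<Omega> \<alpha> t g)) \<le> ann p j (\<lambda>\<xi>. 18 * mag g \<xi>)"
    using p by (intro ann_mono_AE) auto
  also have "\<dots> \<le> 18 * ann p j (mag g)" using p by (intro ann_cmult_le) auto
  finally have "FB_seq s p (semigroup_ft \<nu> \<Omega> \<alpha> t g) j \<le> exp2 (of_int j * s) * (18 * ann p j (mag g))"
    unfolding FB_seq_def by (rule mult_left_mono) simp
  then show ?thesis by (simp only: FB_seq_def mult_ac)
qed

text \<open>The triangle inequality for a right side of the shape in
  \<open>difference_bound\<close>.\<close>

lemma ell_affine_le:
  assumes q: "1 \<le> q"
  shows "ell q (\<lambda>j. y j + a * (b * u j + v j) + c * (d * f j + g j))
    \<le> ell q y + a * (b * ell q u + ell q v) + c * (d * ell q f + ell q g)"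
proof -
  have *: "ell q (\<lambda>j. a * (b * u j + v j)) \<le> a * (b * ell q u + ell q v)" for a b u v
    by (intro order_trans[OF ell_cmult_le[OF q]] mult_left_mono order_trans[OF ell_add_le[OF q]] add_mono ell_cmult_le q) auto
  show ?thesis
    by (intro order_trans[OF ell_add_le[OF q]] add_mono *) auto
qed

theorem corollary4p10:
  fixes \<phi> :: "real^3 \<Rightarrow> complex" and p q :: ennreal and \<alpha> \<nu> \<Omega> K :: real
  defines "s \<equiv> 4 - 2 * \<alpha> - enn2real (3 / p)"
    and "r \<equiv> 4 - 4 * \<alpha> - enn2real (3 / p)"
  assumes "dyadic_partition \<phi>"
    and "1 < p" and "1 \<le> q"
    and "1/2 < \<alpha>" and "\<alpha> < 1/4 * (5 - enn2real (3 / p))"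
    and "0 < \<nu>"
    and "0 < K"
    and "\<And>u v. u \<in> LFB \<phi> s p q \<Longrightarrow> v \<in> LFB \<phi> s p q \<Longrightarrow>
      LFB_norm_ft \<phi> s p q (bilinear_ft \<nu> \<Omega> \<alpha> (ft_time u) (ft_time v))
        \<le> ennreal K * LFB_norm \<phi> s p q u * LFB_norm \<phi> s p q v"
  shows "\<exists>C>0. \<exists>\<epsilon>>0. \<epsilon> < 1 / (4 * K) \<and>
    (\<forall>F w v\<^sub>0 G v.
      F \<in> FB \<phi> r p q \<and> FB_norm \<phi> r p q F < ennreal (\<epsilon> * \<nu> / C) \<and>
      w \<in> FB \<phi> s p q \<and> FB_norm \<phi> s p q w \<le> ennreal (2 * \<epsilon>) \<and>
      stationary_mild_solution \<nu> \<Omega> \<alpha> F w \<and>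
      v\<^sub>0 \<in> FB \<phi> s p q \<and> G \<in> LFB \<phi> r p q \<and>
      FB_norm \<phi> s p q v\<^sub>0 + LFB_norm \<phi> r p q G \<le> ennreal \<epsilon> \<and>
      v \<in> LFB \<phi> s p q \<and> LFB_norm \<phi> s p q v \<le> ennreal (2 * \<epsilon>) \<and>
      mild_solution \<nu> \<Omega> \<alpha> v\<^sub>0 G v \<and>
      ((\<lambda>t. FB_norm_ft \<phi> s p q (semigroup_ft \<nu> \<Omega> \<alpha> t (ft (\<lambda>\<psi>. v\<^sub>0 \<psi> - w \<psi>)))) \<longlongrightarrow> 0) at_top \<and>
      ((\<lambda>t. FB_norm \<phi> r p q (\<lambda>\<psi>. G t \<psi> - F \<psi>)) \<longlongrightarrow> 0) at_top
      \<longrightarrow> ((\<lambda>t. FB_norm \<phi> s p q (\<lambda>\<psi>. v t \<psi> - w \<psi>)) \<longlongrightarrow> 0) at_top)"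
proof -
  note \<phi> = \<open>dyadic_partition \<phi>\<close> and q = \<open>1 \<le> q\<close> and \<nu> = \<open>0 < \<nu>\<close> and K = \<open>0 < K\<close>
  have p: "1 \<le> p" using \<open>1 < p\<close> by simp
  have \<alpha>: "0 < \<alpha>" using \<open>1/2 < \<alpha>\<close> by simp
  \<comment> \<open>For \<open>p = top\<close> both sides are 0: the left by division in
    \<open>ennreal\<close>, the right because \<open>enn2real top\<close> is 0 and division by 0
    gives 0.\<close>
  have inv_p: "enn2real (3 / p) = 3 / enn2real p"
    using \<open>1 < p\<close> by (cases p) (auto simp: divide_ennreal simp flip: ennreal_numeral)
  \<comment> \<open>The difference is 2\<alpha> - 1. The quantity in \<sigma> below is 5 - 4\<alpha>
    - 3/p, so the two bounds on \<alpha> are exactly the two conditions of the product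
    estimate.\<close>
  have \<delta>: "0 < dual_dim p - s"
    using \<open>1/2 < \<alpha>\<close> by (simp add: s_def inv_p)
  have \<sigma>: "0 < 2 * s - dual_dim p"
    using \<open>\<alpha> < 1/4 * (5 - enn2real (3 / p))\<close> by (simp add: s_def inv_p)
  have rel: "2 * s - dual_dim p = s - 2 * \<alpha> + 1"
    by (simp add: s_def inv_p)
  have r: "r = s - 2 * \<alpha>" by (simp add: r_def s_def)
  define A where "A = 17496 / \<nu>"
  define B where "B = para_const p s"
  define c where "c = 3 * 2 powr \<bar>s\<bar>"
  define cr where "cr = 3 * 2 powr \<bar>r\<bar>"
  have A: "A > 0" using \<nu> by (simp add: A_def)
  have B: "B > 0" unfolding B_def by (rule para_const_pos[OF \<delta> \<sigma>])
  have c: "c > 0" "3 * exp2 \<bar>s\<bar> = ennreal c"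
    by (simp_all add: c_def exp2_def ennreal_mult)
  have cr: "cr > 0" "3 * exp2 \<bar>r\<bar> = ennreal cr"
    by (simp_all add: cr_def exp2_def ennreal_mult)
  \<comment> \<open>The shell sequences of \<open>v\<close> and \<open>w\<close> have norm at most 2
    c \<epsilon> each, so the linearised term carries the factor 4 A B c \<epsilon>. The second
    entry makes this at most 1/2, the first gives \<epsilon> < 1/(4K).\<close>
  define \<epsilon> where "\<epsilon> = min (1 / (8 * K)) (1 / (8 * A * B * c))"
  have \<epsilon>: "\<epsilon> > 0" using A B c K by (simp add: \<epsilon>_def)
  have "\<epsilon> \<le> 1 / (8 * K)" by (simp add: \<epsilon>_def)
  also have "\<dots> < 1 / (4 * K)" using K by (simp add: field_simps)
  finally have \<epsilon>K: "\<epsilon> < 1 / (4 * K)" .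
  have "\<epsilon> \<le> 1 / (8 * A * B * c)" by (simp add: \<epsilon>_def)
  then have small: "A * (B * (4 * c * \<epsilon>)) \<le> 1 / 2"
    using A B c by (simp add: field_simps)
  define M where "M = 4 * c * \<epsilon>"
  have M: "M > 0" using c \<epsilon> by (simp add: M_def)
  have "((\<lambda>t. FB_norm \<phi> s p q (\<lambda>\<psi>. v t \<psi> - w \<psi>)) \<longlongrightarrow> 0) at_top"
    if FB: "F \<in> FB \<phi> r p q" "w \<in> FB \<phi> s p q" "v\<^sub>0 \<in> FB \<phi> s p q" "G \<in> LFB \<phi> r p q" "v \<in> LFB \<phi> s p q"
      and w_le: "FB_norm \<phi> s p q w \<le> ennreal (2 * \<epsilon>)"
      and v_le: "LFB_norm \<phi> s p q v \<le> ennreal (2 * \<epsilon>)"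
      and stat: "stationary_mild_solution \<nu> \<Omega> \<alpha> F w" and mild: "mild_solution \<nu> \<Omega> \<alpha> v\<^sub>0 G v"
      and lim_S: "((\<lambda>t. FB_norm_ft \<phi> s p q (semigroup_ft \<nu> \<Omega> \<alpha> t (ft (\<lambda>\<psi>. v\<^sub>0 \<psi> - w \<psi>)))) \<longlongrightarrow> 0) at_top"
      and lim_G: "((\<lambda>t. FB_norm \<phi> r p q (\<lambda>\<psi>. G t \<psi> - F \<psi>)) \<longlongrightarrow> 0) at_top"
    for F w v\<^sub>0 G v
  proof -
    have FB_rep: "fourier_rep f (ft f)" if "f \<in> FB \<phi> a p q" for f a
      using that by (intro fourier_rep_ft) (auto simp: FB_def)
    have LFB_rep: "fourier_rep (f t) (ft (f t))" if "f \<in> LFB \<phi> a p q" "t \<ge> 0" for f a t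
      using that by (intro FB_rep) (auto simp: LFB_def)
    note reps = FB_rep[OF FB(1)] FB_rep[OF FB(2)] FB_rep[OF FB(3)] LFB_rep[OF FB(4)] LFB_rep[OF FB(5)]
    have meas [measurable]: "ft F \<in> borel_measurable borel" "ft w \<in> borel_measurable borel" "ft v\<^sub>0 \<in> borel_measurable borel"
      using reps(1-3) by (auto intro: fourier_rep_measurable)
    have Gm: "ft (G t) \<in> borel_measurable borel" and vm: "ft (v t) \<in> borel_measurable borel" if "t \<ge> 0" for t
      using reps(4,5)[OF that] by (auto intro: fourier_rep_measurable)
    note V = ft_time(1)[OF \<phi> p q FB(5)] and G' = ft_time(1)[OF \<phi> p q FB(4)]
    have [measurable]: "ft_time v t \<in> borel_measurable borel" "ft_time G t \<in> borel_measurable borel" for t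
      by (rule measurable_uncurry[OF V]; simp) (rule measurable_uncurry[OF G']; simp)
    have joint: "AE t in lborel. t \<ge> 0 \<longrightarrow> (AE \<xi> in lborel. ft_time f t \<xi> = ft (f t) \<xi>)"
      if "f \<in> LFB \<phi> a p q" for f a
      using ft_time(2)[OF \<phi> p q that] unfolding AE_lebesgue_on_iff
      by eventually_elim (use LFB_rep[OF that] fourier_rep_unique in blast)
    define D where "D t = (\<lambda>\<xi>. ft (v t) \<xi> - ft w \<xi>)" for t
    define d where "d = ft (\<lambda>\<psi>. v\<^sub>0 \<psi> - w \<psi>)"
    define Y where "Y t = semigroup_ft \<nu> \<Omega> \<alpha> t d" for t
    have d_rep: "fourier_rep (\<lambda>\<psi>. v\<^sub>0 \<psi> - w \<psi>) d"
      unfolding d_def using fourier_rep_diff[OF reps(3,2)] by (intro fourier_rep_ft) auto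
    then have [measurable]: "d \<in> borel_measurable borel" by (rule fourier_rep_measurable)
    have d_AE: "AE \<xi> in lborel. d \<xi> = ft v\<^sub>0 \<xi> - ft w \<xi>"
      unfolding d_def by (rule ft_diff[OF reps(3,2)])
    have [measurable]: "Y t \<in> borel_measurable borel" for t by (simp add: Y_def)
    have Dm: "D t \<in> borel_measurable borel" if "t \<ge> 0" for t
      using vm[OF that] by (simp add: D_def)

    obtain mV where mV: "ell q mV \<le> 3 * exp2 \<bar>s\<bar> * LFB_norm_ft \<phi> s p q (\<lambda>t. ft (v t))"
      and mV_dom: "AE t in lborel. t \<ge> 0 \<longrightarrow> (\<forall>j. FB_seq s p (ft (v t)) j \<le> mV j)"
      using LFB_dominated[where g = "\<lambda>t. ft (v t)" and s = s, OF \<phi> vm p q]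
      unfolding AE_lebesgue_on_iff by auto
    have "ell q mV \<le> ennreal c * ennreal (2 * \<epsilon>)"
      using mV v_le unfolding c LFB_norm_def[symmetric] by (rule order_trans[OF _ mult_left_mono]) simp
    then have mV_le: "ell q mV \<le> ennreal (2 * c * \<epsilon>)"
      using c \<epsilon> by (simp add: ennreal_mult[symmetric] mult_ac)
    have "ell q (FB_seq s p (ft w)) \<le> ennreal c * FB_norm_ft \<phi> s p q (ft w)"
      using ell_FB_seq_le[OF \<phi> meas(2) p q, of s] by (simp add: c)
    also have "\<dots> \<le> ennreal c * ennreal (2 * \<epsilon>)"
      using w_le by (intro mult_left_mono) (simp_all add: FB_norm_def)
    finally have mw_le: "ell q (FB_seq s p (ft w)) \<le> ennreal (2 * c * \<epsilon>)"
      using c \<epsilon> by (simp add: ennreal_mult[symmetric] mult_ac)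
    obtain mG where mG: "ell q mG \<le> 3 * exp2 \<bar>r\<bar> * LFB_norm_ft \<phi> r p q (\<lambda>t. ft (G t))"
      and mG_dom: "AE t in lborel. t \<ge> 0 \<longrightarrow> (\<forall>j. FB_seq r p (ft (G t)) j \<le> mG j)"
      using LFB_dominated[where g = "\<lambda>t. ft (G t)" and s = r, OF \<phi> Gm p q]
      unfolding AE_lebesgue_on_iff by auto
    have mG_fin: "ell q mG < top"
    proof (rule le_less_trans[OF mG])
      have "LFB_norm \<phi> r p q G < top" using FB(4) by (simp add: LFB_def)
      then show "3 * exp2 \<bar>r\<bar> * LFB_norm_ft \<phi> r p q (\<lambda>t. ft (G t)) < top"
        by (simp add: LFB_norm_def ennreal_mult_less_top)
    qed
    have mF_fin: "ell q (FB_seq r p (ft F)) < top"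
    proof (rule le_less_trans[OF ell_FB_seq_le[OF \<phi> meas(1) p q]])
      have "FB_norm \<phi> r p q F < top" using FB(1) by (simp add: FB_def)
      then show "3 * exp2 \<bar>r\<bar> * FB_norm_ft \<phi> r p q (ft F) < top"
        by (simp add: FB_norm_def ennreal_mult_less_top)
    qed
    \<comment> \<open>These sequences dominate the shells of v - w and of G - F at almost every
      time; \<open>M\<close> and \<open>g\<close> below are bounds for their norms.\<close>
    define m where "m j = mV j + FB_seq s p (ft w) j" for j
    define mf where "mf j = mG j + FB_seq r p (ft F) j" for j
    have "ell q m \<le> ennreal (2 * c * \<epsilon>) + ennreal (2 * c * \<epsilon>)"
      unfolding m_def[abs_def] by (intro order_trans[OF ell_add_le[OF q]] add_mono mV_le mw_le)
    also have "\<dots> = ennreal M" using c \<epsilon> by (simp add: M_def flip: ennreal_plus)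
    finally have m_le: "ell q m \<le> ennreal M" .
    have mf_fin: "ell q mf < top"
      unfolding mf_def[abs_def] using mG_fin mF_fin
      by (intro le_less_trans[OF ell_add_le[OF q]]) (simp add: ennreal_add_less_top)
    define g where "g = enn2real (ell q mf)"
    have g: "g \<ge> 0" "ell q mf = ennreal g" using mf_fin by (simp_all add: g_def)

    have V_dom: "AE t in lborel. t \<ge> 0 \<longrightarrow> (\<forall>j. FB_seq s p (ft_time v t) j \<le> mV j)"
      using mV_dom joint[OF FB(5)]
      by eventually_elim (use FB_seq_cong_AE[OF _ vm p] in auto)
    have G_dom: "AE t in lborel. t \<ge> 0 \<longrightarrow> (\<forall>j. FB_seq r p (ft_time G t) j \<le> mG j)"
      using mG_dom joint[OF FB(4)]
      by eventually_elim (use FB_seq_cong_AE[OF _ Gm p] in auto)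
    have DV_dom: "AE t in lborel. t \<ge> 0 \<longrightarrow> (\<forall>j. FB_seq s p (\<lambda>\<xi>. ft_time v t \<xi> - ft w \<xi>) j \<le> m j)"
      using V_dom unfolding m_def
      by eventually_elim (auto intro!: order_trans[OF FB_seq_diff_le[OF _ _ p]] add_mono)
    have DG_dom: "AE t in lborel. t \<ge> 0 \<longrightarrow> (\<forall>j. FB_seq r p (\<lambda>\<xi>. ft_time G t \<xi> - ft F \<xi>) j \<le> mf j)"
      using G_dom unfolding mf_def
      by eventually_elim (auto intro!: order_trans[OF FB_seq_diff_le[OF _ _ p]] add_mono)

    have tail_Y: "\<exists>T x. ell q x \<le> ennreal e \<and> (\<forall>t\<in>{0..}. t \<ge> T \<longrightarrow> (\<forall>j. FB_seq s p (Y t) j \<le> x j))"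
      if e: "e > 0" for e
    proof (rule ell_tail[OF q _ _ _ e])
      show "FB_seq s p (Y t) j \<le> 18 * FB_seq s p d j" if "t \<in> {0..}" for t j
        unfolding Y_def using that by (intro FB_seq_semigroup_le p \<nu>) auto
      have "FB_norm \<phi> s p q v\<^sub>0 < top" "FB_norm \<phi> s p q w < top" using FB by (simp_all add: FB_def)
      then have fin: "ell q (FB_seq s p (ft v\<^sub>0)) < top" "ell q (FB_seq s p (ft w)) < top"
        by (auto intro!: le_less_trans[OF ell_FB_seq_le[OF \<phi> _ p q]] simp: ennreal_mult_less_top FB_norm_def)
      have "FB_seq s p d = FB_seq s p (\<lambda>\<xi>. ft v\<^sub>0 \<xi> - ft w \<xi>)"
        by (rule FB_seq_cong_AE[OF _ _ p d_AE]) auto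
      then have "ell q (FB_seq s p d) \<le> ell q (\<lambda>j. FB_seq s p (ft v\<^sub>0) j + FB_seq s p (ft w) j)"
        by (auto intro!: ell_mono q FB_seq_diff_le p)
      also have "\<dots> \<le> ell q (FB_seq s p (ft v\<^sub>0)) + ell q (FB_seq s p (ft w))"
        by (rule ell_add_le[OF q])
      also have "\<dots> < top" using fin by (simp add: ennreal_add_less_top)
      finally have d_fin: "ell q (FB_seq s p d) < top" .
      show "ell q (\<lambda>j. 18 * FB_seq s p d j) < top"
        using d_fin by (intro le_less_trans[OF ell_cmult_le[OF q]]) (simp add: ennreal_mult_less_top)
      have "((\<lambda>t. ennreal c * FB_norm_ft \<phi> s p q (Y t)) \<longlongrightarrow> ennreal c * 0) at_top"
        using lim_S unfolding Y_def d_def by (intro ennreal_tendsto_cmult) auto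
      then have "((\<lambda>t. ennreal c * FB_norm_ft \<phi> s p q (Y t)) \<longlongrightarrow> 0) at_top" by simp
      then show "((\<lambda>t. ell q (FB_seq s p (Y t))) \<longlongrightarrow> 0) at_top"
        by (rule ennreal_tendsto_0_le)
           (use ell_FB_seq_le[OF \<phi> _ p q, of _ s] in \<open>simp add: c\<close>)
    qed
    have tail_G: "\<exists>T x. ell q x \<le> ennreal e \<and> (AE t in lborel. 0 \<le> t \<and> T \<le> t \<longrightarrow>
        (\<forall>j. FB_seq r p (\<lambda>\<xi>. ft_time G t \<xi> - ft F \<xi>) j \<le> x j))" if e: "e > 0" for e
    proof -
      \<comment> \<open>Nothing is known about \<open>G\<close> at negative times, so the sequence
        is set to 0 there in order that the norm bound holds for every real
        \<open>t\<close>.\<close>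
      let ?y = "\<lambda>t. if t \<ge> 0 then FB_seq r p (ft (\<lambda>\<psi>. G t \<psi> - F \<psi>)) else (\<lambda>_. 0)"
      have rep: "fourier_rep (\<lambda>\<psi>. G t \<psi> - F \<psi>) (ft (\<lambda>\<psi>. G t \<psi> - F \<psi>))" if "t \<ge> 0" for t
        using fourier_rep_diff[OF reps(4)[OF that] reps(1)] by (intro fourier_rep_ft) auto
      \<comment> \<open>The domination by \<open>mf\<close> holds only at almost every time; the set
        of good times is passed to \<open>ell_tail\<close>.\<close>
      have "\<exists>T x. ell q x \<le> ennreal e \<and> (\<forall>t\<in>{t. \<forall>j. ?y t j \<le> mf j}. t \<ge> T \<longrightarrow> (\<forall>j. ?y t j \<le> x j))"
      proof (rule ell_tail[OF q _ mf_fin _ e])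
        have "((\<lambda>t. ennreal cr * FB_norm \<phi> r p q (\<lambda>\<psi>. G t \<psi> - F \<psi>)) \<longlongrightarrow> ennreal cr * 0) at_top"
          using lim_G by (intro ennreal_tendsto_cmult) auto
        then have "((\<lambda>t. ennreal cr * FB_norm \<phi> r p q (\<lambda>\<psi>. G t \<psi> - F \<psi>)) \<longlongrightarrow> 0) at_top" by simp
        then show "((\<lambda>t. ell q (?y t)) \<longlongrightarrow> 0) at_top"
        proof (rule ennreal_tendsto_0_le, intro always_eventually allI)
          fix t
          show "ell q (?y t) \<le> ennreal cr * FB_norm \<phi> r p q (\<lambda>\<psi>. G t \<psi> - F \<psi>)"
            using ell_FB_seq_le[OF \<phi> fourier_rep_measurable[OF rep] p q, of t r] q
            by (simp add: cr FB_norm_def)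
        qed
      qed auto
      then obtain T x where x: "ell q x \<le> ennreal e"
        and Tx: "\<And>t. \<forall>j. ?y t j \<le> mf j \<Longrightarrow> t \<ge> T \<Longrightarrow> \<forall>j. ?y t j \<le> x j"
        by auto
      have "AE t in lborel. 0 \<le> t \<and> T \<le> t \<longrightarrow> (\<forall>j. FB_seq r p (\<lambda>\<xi>. ft_time G t \<xi> - ft F \<xi>) j \<le> x j)"
        using DG_dom joint[OF FB(4)]
      proof eventually_elim
        case (elim t)
        show ?case
        proof
          assume t: "0 \<le> t \<and> T \<le> t"
          then have "AE \<xi> in lborel. ft_time G t \<xi> = ft (G t) \<xi>" using elim by simp
          moreover have "AE \<xi> in lborel. ft (\<lambda>\<psi>. G t \<psi> - F \<psi>) \<xi> = ft (G t) \<xi> - ft F \<xi>"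
            using t by (intro ft_diff reps) simp
          ultimately have "AE \<xi> in lborel. ft_time G t \<xi> - ft F \<xi> = ft (\<lambda>\<psi>. G t \<psi> - F \<psi>) \<xi>"
            by eventually_elim simp
          then have eq: "FB_seq r p (\<lambda>\<xi>. ft_time G t \<xi> - ft F \<xi>) = ?y t"
            using t by (simp, intro FB_seq_cong_AE p fourier_rep_measurable[OF rep]) auto
          show "\<forall>j. FB_seq r p (\<lambda>\<xi>. ft_time G t \<xi> - ft F \<xi>) j \<le> x j"
            unfolding eq using elim(1) t by (intro Tx) (auto simp only: eq)
        qed
      qed
      with x show ?thesis by blast
    qed

    \<comment> \<open>The two equations are subtracted at a fixed time. It is taken positive because
      the stationary equation is given only for positive times.\<close>
    have eq: "AE \<xi> in lborel. D t \<xi> = Y t \<xi> +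
      (duhamel \<nu> \<Omega> \<alpha> t (ft_time v) (ft_time G) \<xi> - duhamel \<nu> \<Omega> \<alpha> t (\<lambda>_. ft w) (\<lambda>_. ft F) \<xi>)"
      if t: "t > 0" for t
    proof -
      have reflect: "(LINT \<tau>:{0..t}|lborel. duhamel_kernel \<nu> \<Omega> \<alpha> \<tau> \<xi> z) = (LINT \<tau>:{0..t}|lborel. duhamel_kernel \<nu> \<Omega> \<alpha> (t - \<tau>) \<xi> z)" for \<xi> z
        by (rule set_integral_reflect) measurable
      have "AE \<xi> in lborel. ft (v t) \<xi> = semigroup_ft \<nu> \<Omega> \<alpha> t (ft v\<^sub>0) \<xi> + duhamel \<nu> \<Omega> \<alpha> t (ft_time v) (ft_time G) \<xi>"
        using mild t unfolding mild_solution_def duhamel_def duhamel_kernel_def by (simp add: add.assoc)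
      moreover have "AE \<xi> in lborel. ft w \<xi> = semigroup_ft \<nu> \<Omega> \<alpha> t (ft w) \<xi> + duhamel \<nu> \<Omega> \<alpha> t (\<lambda>_. ft w) (\<lambda>_. ft F) \<xi>"
        using stat t unfolding stationary_mild_solution_def duhamel_def reflect[symmetric]
        by (simp add: add.assoc duhamel_kernel_def)
      ultimately show ?thesis
        using d_AE
      proof eventually_elim
        case (elim \<xi>)
        have Y_eq: "Y t \<xi> = semigroup_ft \<nu> \<Omega> \<alpha> t (ft v\<^sub>0) \<xi> - semigroup_ft \<nu> \<Omega> \<alpha> t (ft w) \<xi>"
          by (simp add: Y_def semigroup_ft_def elim(3) matrix_vector_mult_diff_distrib)
        show ?case
          unfolding D_def Y_eq by (subst elim(1), subst elim(2), rule add_diff_add)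
      qed
    qed

    have mV_top: "ell q mV < top" and mw_top: "ell q (FB_seq s p (ft w)) < top"
      using mV_le mw_le by (auto intro: le_less_trans)
    note bound = difference_bound[OF p q \<nu> \<alpha> \<delta> \<sigma> rel V G' meas(2,1) V_dom mV_top mw_top
        G_dom[unfolded r] mG_fin mF_fin[unfolded r]]
    let ?Q = "linearised p q s (ft w) mV"
    \<comment> \<open>The smallness of \<epsilon> is spent here: the linearised term, with its
      constant, at most halves the norm.\<close>
    have ell_Q: "ennreal A * ell q (?Q z) \<le> ennreal (1/2) * ell q z" for z
    proof -
      have "ell q (?Q z) \<le> ennreal B * (ell q mV + ell q (FB_seq s p (ft w))) * ell q z"
        unfolding B_def by (rule ell_linearised_le[OF p q \<nu> \<alpha> \<delta> \<sigma> rel V G' meas(2,1) V_dom mV_top mw_top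
            G_dom[unfolded r] mG_fin mF_fin[unfolded r]])
      also have "\<dots> \<le> ennreal B * (ennreal (2 * c * \<epsilon>) + ennreal (2 * c * \<epsilon>)) * ell q z"
        by (intro mult_right_mono mult_left_mono add_mono mV_le mw_le) auto
      also have "\<dots> = ennreal (B * (4 * c * \<epsilon>)) * ell q z"
        using B c \<epsilon> by (simp add: ennreal_mult[symmetric] mult_ac flip: ennreal_plus)
      finally have "ennreal A * ell q (?Q z) \<le> ennreal A * (ennreal (B * (4 * c * \<epsilon>)) * ell q z)"
        by (rule mult_left_mono) simp
      also have "\<dots> = ennreal (A * (B * (4 * c * \<epsilon>))) * ell q z"
        using A by (simp add: ennreal_mult' mult.assoc)
      also have "\<dots> \<le> ennreal (1/2) * ell q z"
        using small by (intro mult_right_mono ennreal_leI) auto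
      finally show ?thesis .
    qed

    \<comment> \<open>The hypothesis speaks of almost every time and of the joint representative,
      the conclusion of every late time and of D(t) itself, because \<open>eq\<close> holds at each
      positive time.\<close>
    have step: "\<exists>T' x'. ell q x' \<le> ennreal (3/4 * \<rho>) \<and> (\<forall>t\<ge>T'. t > 0 \<longrightarrow> (\<forall>j. FB_seq s p (D t) j \<le> x' j))"
      if \<rho>: "\<rho> > 0" and x: "ell q x \<le> ennreal \<rho>"
        and Tx: "AE t in lborel. 0 \<le> t \<and> T \<le> t \<longrightarrow> (\<forall>j. FB_seq s p (\<lambda>\<xi>. ft_time v t \<xi> - ft w \<xi>) j \<le> x j)"
      for T x \<rho>
    proof -
      define b where "b = 324 / \<nu>"
      have b: "b > 0" using \<nu> by (simp add: b_def)
      \<comment> \<open>The interval [0, \<theta> t] contributes at most \<theta> M through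
        \<open>m\<close> and 2 \<theta> b g through \<open>mf\<close>; this choice makes the sum at
        most \<rho>/12.\<close>
      define \<theta> where "\<theta> = min (1/2) (\<rho> / 12 / (M + 2 * b * g + 1))"
      have pos: "M + 2 * b * g + 1 > 0" using M b g by (simp add: add_pos_nonneg)
      have \<theta>: "0 < \<theta>" "\<theta> \<le> 1/2"
        unfolding \<theta>_def using \<rho> pos by (simp, intro min.cobounded1)
      have "\<theta> * (M + 2 * b * g + 1) \<le> \<rho> / 12 / (M + 2 * b * g + 1) * (M + 2 * b * g + 1)"
        using pos by (intro mult_right_mono) (auto simp: \<theta>_def)
      also have "\<dots> = \<rho> / 12"
      proof -
        have "a / n * n = a" if "n > 0" for a n :: real using that by simp
        from this[OF pos] show ?thesis .
      qed
      finally have "\<theta> * M + 2 * \<theta> * b * g + \<theta> \<le> \<rho> / 12" by (simp add: algebra_simps)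
      then have \<theta>_small: "\<theta> * M + 2 * \<theta> * b * g \<le> \<rho> / 12" using \<theta> by linarith
      obtain Ty y where y: "ell q y \<le> ennreal (\<rho> / 12)"
        and Ty: "\<forall>t\<in>{0..}. t \<ge> Ty \<longrightarrow> (\<forall>j. FB_seq s p (Y t) j \<le> y j)"
        using tail_Y[of "\<rho> / 12"] \<rho> by auto
      obtain Tf xf where xf: "ell q xf \<le> ennreal (\<rho> / (12 * b))"
        and Tf: "AE t in lborel. 0 \<le> t \<and> Tf \<le> t \<longrightarrow> (\<forall>j. FB_seq r p (\<lambda>\<xi>. ft_time G t \<xi> - ft F \<xi>) j \<le> xf j)"
        using tail_G[of "\<rho> / (12 * b)"] \<rho> b by auto
      define x' where "x' j = y j + ennreal A * (ennreal (2 * \<theta>) * ?Q m j + ?Q x j)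
        + ennreal b * (ennreal (2 * \<theta>) * mf j + xf j)" for j
      \<comment> \<open>From this time on, \<theta> t has passed both \<open>T\<close> and
        \<open>Tf\<close>, so the improved bounds hold on all of [\<theta> t, t].\<close>
      define T' where "T' = max Ty (max (T / \<theta>) (Tf / \<theta>))"
      have "FB_seq s p (D t) j \<le> x' j" if t: "t \<ge> T'" "t > 0" for t j
      proof -
        have ge: "0 \<le> \<theta> * t" "T \<le> \<theta> * t" "Tf \<le> \<theta> * t"
          using t \<theta> by (auto simp: T'_def field_simps)
        have "FB_seq s p (D t) j \<le> FB_seq s p (Y t) j
          + ennreal (17496 / \<nu>) * (ennreal (2 * \<theta>) * ?Q m j + ?Q x j)
          + ennreal (324 / \<nu>) * (ennreal (2 * \<theta>) * mf j + xf j)"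
        proof (rule bound[OF _ _ _ _ _ eq])
          show "AE \<tau> in lborel. \<theta> * t \<le> \<tau> \<longrightarrow> (\<forall>k. FB_seq s p (\<lambda>\<xi>. ft_time v \<tau> \<xi> - ft w \<xi>) k \<le> x k)"
            using Tx by eventually_elim (use ge in auto)
          show "AE \<tau> in lborel. \<theta> * t \<le> \<tau> \<longrightarrow> (\<forall>k. FB_seq (s - 2 * \<alpha>) p (\<lambda>\<xi>. ft_time G \<tau> \<xi> - ft F \<xi>) k \<le> xf k)"
            using Tf unfolding r by eventually_elim (use ge in auto)
          show "AE \<tau> in lborel. 0 \<le> \<tau> \<longrightarrow> (\<forall>k. FB_seq (s - 2 * \<alpha>) p (\<lambda>\<xi>. ft_time G \<tau> \<xi> - ft F \<xi>) k \<le> mf k)"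
            using DG_dom unfolding r .
        qed (use t \<theta> DV_dom Dm in auto)
        also have "\<dots> \<le> x' j"
          unfolding x'_def A_def b_def using Ty t by (intro add_right_mono) (auto simp: T'_def)
        finally show ?thesis .
      qed
      moreover have "ell q x' \<le> ennreal (3/4 * \<rho>)"
      proof -
        have "ell q x' \<le> ell q y + ennreal A * (ennreal (2 * \<theta>) * ell q (?Q m) + ell q (?Q x))
            + ennreal b * (ennreal (2 * \<theta>) * ell q mf + ell q xf)"
          unfolding x'_def[abs_def] by (rule ell_affine_le[OF q])
        also have "\<dots> = ell q y + (ennreal (2 * \<theta>) * (ennreal A * ell q (?Q m)) + ennreal A * ell q (?Q x))
            + (ennreal (2 * \<theta>) * (ennreal b * ell q mf) + ennreal b * ell q xf)"
          by (simp only: distrib_left mult_ac)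
        also have "\<dots> \<le> ennreal (\<rho> / 12) + (ennreal (2 * \<theta>) * (ennreal (1/2) * ennreal M) + ennreal (1/2) * ennreal \<rho>)
            + (ennreal (2 * \<theta>) * (ennreal b * ennreal g) + ennreal b * ennreal (\<rho> / (12 * b)))"
          using g(2) by (intro add_mono mult_left_mono y xf order_trans[OF ell_Q] m_le x) auto
        also have "\<dots> = ennreal (\<rho> / 12 + (2 * \<theta> * (1/2 * M) + 1/2 * \<rho>) + (2 * \<theta> * (b * g) + b * (\<rho> / (12 * b))))"
        proof -
          have "ennreal a + (ennreal k * (ennreal h * ennreal M) + ennreal h * ennreal \<rho>) + (ennreal k * (ennreal b * ennreal g) + ennreal b * ennreal u)
            = ennreal (a + (k * (h * M) + h * \<rho>) + (k * (b * g) + b * u))"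
            if "a \<ge> 0" "k \<ge> 0" "h \<ge> 0" "u \<ge> 0" for a k h u
            using that M \<rho> b g by (simp add: ennreal_mult[symmetric] flip: ennreal_plus)
          moreover have "0 \<le> \<rho> / 12" "0 \<le> 2 * \<theta>" "0 \<le> (1/2::real)" "0 \<le> \<rho> / (12 * b)"
            using \<theta> \<rho> b by simp_all
          ultimately show ?thesis by blast
        qed
        \<comment> \<open>The budget is \<rho>/12 for the free evolution, \<rho>/12 for the interval
          [0, \<theta> t], \<rho>/2 for the linearised term and \<rho>/12 for the forcing on
          [\<theta> t, t].\<close>
        also have "\<dots> \<le> ennreal (3/4 * \<rho>)"
        proof (rule ennreal_leI)
          have "b * (\<rho> / (12 * b)) = \<rho> / 12" using b by simp
          then show "\<rho> / 12 + (2 * \<theta> * (1/2 * M) + 1/2 * \<rho>) + (2 * \<theta> * (b * g) + b * (\<rho> / (12 * b))) \<le> 3/4 * \<rho>"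
            using \<theta>_small by (simp add: mult_ac)
        qed
        finally show ?thesis .
      qed
      ultimately show ?thesis by blast
    qed

    have iterate: "\<exists>T x. ell q x \<le> ennreal (M * (3/4) ^ n) \<and>
        (AE t in lborel. 0 \<le> t \<and> T \<le> t \<longrightarrow> (\<forall>j. FB_seq s p (\<lambda>\<xi>. ft_time v t \<xi> - ft w \<xi>) j \<le> x j))" for n
    proof (induction n)
      case 0
      show ?case
        using m_le DV_dom by (intro exI[of _ 0] exI[of _ m]) auto
    next
      case (Suc n)
      then obtain T x where "ell q x \<le> ennreal (M * (3/4) ^ n)"
        and "AE t in lborel. 0 \<le> t \<and> T \<le> t \<longrightarrow> (\<forall>j. FB_seq s p (\<lambda>\<xi>. ft_time v t \<xi> - ft w \<xi>) j \<le> x j)"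
        by blast
      from step[OF _ this] M obtain T' x' where x': "ell q x' \<le> ennreal (3/4 * (M * (3/4) ^ n))"
        and T': "\<forall>t\<ge>T'. t > 0 \<longrightarrow> (\<forall>j. FB_seq s p (D t) j \<le> x' j)"
        by auto
      \<comment> \<open>The maximum with 1 keeps the times positive, as the conclusion of
        \<open>step\<close> demands.\<close>
      have "AE t in lborel. 0 \<le> t \<and> max 1 T' \<le> t \<longrightarrow> (\<forall>j. FB_seq s p (\<lambda>\<xi>. ft_time v t \<xi> - ft w \<xi>) j \<le> x' j)"
        using joint[OF FB(5)]
      proof eventually_elim
        case (elim t)
        show ?case
        proof
          assume t: "0 \<le> t \<and> max 1 T' \<le> t"
          then have "AE \<xi> in lborel. ft_time v t \<xi> = ft (v t) \<xi>" using elim by simp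
          then have "AE \<xi> in lborel. ft_time v t \<xi> - ft w \<xi> = D t \<xi>"
            by eventually_elim (simp add: D_def)
          then have "FB_seq s p (\<lambda>\<xi>. ft_time v t \<xi> - ft w \<xi>) = FB_seq s p (D t)"
            using t Dm by (intro FB_seq_cong_AE p) auto
          then show "\<forall>j. FB_seq s p (\<lambda>\<xi>. ft_time v t \<xi> - ft w \<xi>) j \<le> x' j"
            using T' t by auto
        qed
      qed
      with x' show ?case
        by (intro exI[of _ "max 1 T'"] exI[of _ x']) (simp add: mult_ac)
    qed

    \<comment> \<open>A bound for the cutoff, needed to return from the annuli to the norm defined
      with \<phi>.\<close>
    obtain P where P: "P > 0" "\<And>\<xi>. norm (\<phi> \<xi>) \<le> P" using cutoff_bounded[OF \<phi>] by blast
    show "((\<lambda>t. FB_norm \<phi> s p q (\<lambda>\<psi>. v t \<psi> - w \<psi>)) \<longlongrightarrow> 0) at_top"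
    proof (rule ennreal_tendsto_0I)
      fix e :: real assume e: "e > 0"
      have "(\<lambda>n. P * c * (M * (3/4) ^ n)) \<longlonglongrightarrow> P * c * (M * 0)"
        by (intro tendsto_intros LIMSEQ_power_zero) simp
      then have "eventually (\<lambda>n. P * c * (M * (3/4) ^ n) < e) sequentially"
        using e by (intro order_tendstoD(2)) auto
      then obtain n where n: "P * c * (M * (3/4) ^ n) < e"
        by (auto simp: eventually_sequentially)
      obtain T x where "ell q x \<le> ennreal (M * (3/4) ^ n)"
        and "AE t in lborel. 0 \<le> t \<and> T \<le> t \<longrightarrow> (\<forall>j. FB_seq s p (\<lambda>\<xi>. ft_time v t \<xi> - ft w \<xi>) j \<le> x j)"
        using iterate by blast
      \<comment> \<open>One more application of \<open>step\<close>, whose purpose here is not the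
        factor 3/4 but the passage from almost every time to every late time.\<close>
      from step[OF _ this] M obtain T' x' where x': "ell q x' \<le> ennreal (3/4 * (M * (3/4) ^ n))"
        and T': "\<forall>t\<ge>T'. t > 0 \<longrightarrow> (\<forall>j. FB_seq s p (D t) j \<le> x' j)"
        by auto
      have "FB_norm \<phi> s p q (\<lambda>\<psi>. v t \<psi> - w \<psi>) \<le> ennreal e" if t: "t \<ge> max 1 T'" for t
      proof -
        let ?f = "ft (\<lambda>\<psi>. v t \<psi> - w \<psi>)"
        have t0: "t \<ge> 0" using t by simp
        have [measurable]: "?f \<in> borel_measurable borel"
          using fourier_rep_ft[OF exI, OF fourier_rep_diff[OF reps(5)[OF t0] reps(2)]] by (rule fourier_rep_measurable)
        have "FB_seq s p ?f = FB_seq s p (D t)"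
          unfolding D_def
          using ft_diff[OF reps(5)[OF t0] reps(2)] Dm[OF t0, unfolded D_def] by (intro FB_seq_cong_AE p) auto
        then have "FB_norm \<phi> s p q (\<lambda>\<psi>. v t \<psi> - w \<psi>) \<le> ennreal P * ennreal c * ell q (FB_seq s p (D t))"
          using FB_norm_ft_le_ell[OF \<phi> _ p q P(2), of ?f s] by (simp add: FB_norm_def c)
        also have "\<dots> \<le> ennreal P * ennreal c * ell q x'"
          using T' t by (intro mult_left_mono ell_mono q) auto
        also have "\<dots> \<le> ennreal P * ennreal c * ennreal (3/4 * (M * (3/4) ^ n))"
          by (intro mult_left_mono x') auto
        also have "\<dots> = ennreal (P * c * (3/4 * (M * (3/4) ^ n)))"
          using P c by (simp only: ennreal_mult'[symmetric] less_imp_le mult_pos_pos mult.assoc)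
        also have "\<dots> \<le> ennreal e"
        proof (rule ennreal_leI)
          have "P * c * (3/4 * (M * (3/4) ^ n)) \<le> P * c * (1 * (M * (3/4) ^ n))"
            using P c M by (intro mult_left_mono mult_right_mono) auto
          then show "P * c * (3/4 * (M * (3/4) ^ n)) \<le> e" using n by linarith
        qed
        finally show ?thesis .
      qed
      then show "eventually (\<lambda>t. FB_norm \<phi> s p q (\<lambda>\<psi>. v t \<psi> - w \<psi>) \<le> ennreal e) at_top"
        unfolding eventually_at_top_linorder by blast
    qed
  qed
  then show ?thesis
    using \<epsilon> \<epsilon>K by (intro exI[of _ 1] conjI exI[of _ \<epsilon>]) auto
qed

end
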